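(* Let $(X,d)$ be a compact metric space admitting a uniformly distributed probability measure $\mu$. Then for every compact quantum group $\mathcal{Q}$ and every isometric action $\alpha$ of $\mathcal{Q}$ on $(X,d)$, the measure $\mu$ is invariant under $\alpha$; that is, $\mu\triangleleft\varphi=\mu$ for every state $\varphi$ of $\mathcal{Q}$.
   Context: All tensor products of $C^*$-algebras are minimal. A compact quantum group (CQG) is a unital $C^*$-algebra $\mathcal{Q}$ with a unital $*$-homomorphism $\Delta:\mathcal{Q}\to\mathcal{Q}\otimes\mathcal{Q}$ that is coassociative and such that $\Delta(\mathcal{Q})(\mathcal{Q}\otimes 1)$ and $\Delta(\mathcal{Q})(1\otimes\mathcal{Q})$ span norm-dense subspaces of $\mathcal{Q}\otimes\mathcal{Q}$. It has a unique dense Hopf $*$-subalgebra $\mathcal{Q}_0$, with antipode $\kappa$. Whenever isometric actions are mentioned, it is assumed that $\kappa$ is bounded, hence extends to $\mathcal{Q}$; this extension is also denoted $\kappa$. An action of $\mathcal{Q}$ on a unital $C^*$-algebra $\mathcal{C}$ is a unital $*$-homomorphism $\alpha:\mathcal{C}\to\mathcal{C}\otimes\mathcal{Q}$ with $(\alpha\otimes\mathrm{id})\alpha=(\mathrm{id}\otimes\Delta)\alpha$ and such that the linear span of $\alpha(\mathcal{C})(1\otimes\mathcal{Q})$ is norm-dense in $\mathcal{C}\otimes\mathcal{Q}$. It is faithful if the elements $(\varphi\otimes\mathrm{id})\alpha(x)$ ($x\in\mathcal{C}$, $\varphi$ a state of $\mathcal{C}$) generate $\mathcal{Q}$ as a $C^*$-algebra.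 Elements of $C(X)\otimes\mathcal{Q}$ are regarded as continuous functions $X\to\mathcal{Q}$. A faithful action $\alpha$ of $\mathcal{Q}$ on $C(X)$ is isometric for the compact metric space $(X,d)$ if $\alpha(d_x)(y)=\kappa(\alpha(d_y)(x))$ for all $x,y\in X$, where $d_x:=d(x,-)$. For a probability measure $\mu$ on $X$ (viewed as a state of $C(X)$) and a state $\varphi$ of $\mathcal{Q}$, $\mu\triangleleft\varphi:=(\mu\otimes\varphi)\circ\alpha$. A (Borel) measure $\mu$ on a metric space $X$ is uniformly distributed if $\mu(B(x,r))=\mu(B(y,r))$ for all $x,y\in X$ and all real $r\ge 0$, where $B(x,r)$ is the ball of radius $r$ centered at $x$. *)

theory Defs
  imports "HOL-Probability.Probability" "HOL-Library.Poly_Mapping"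
begin

section \<open>Unital C*-algebras\<close>

text \<open>The zero algebra is not excluded (there is no axiom \<open>0 \<noteq> 1\<close>), so that the class is closed under
  tensor products without further proof; the zero algebra has no states.\<close>

class unital_cstar_algebra = banach + real_normed_algebra + monoid_mult +
  fixes scaleC :: "complex \<Rightarrow> 'a \<Rightarrow> 'a" (infixr \<open>*\<^sub>C\<close> 75)
    and star :: "'a \<Rightarrow> 'a"
  assumes scaleC_add_right: "c *\<^sub>C (x + y) = c *\<^sub>C x + c *\<^sub>C y"
    and scaleC_add_left: "(c + d) *\<^sub>C x = c *\<^sub>C x + d *\<^sub>C x"
    and scaleC_scaleC: "c *\<^sub>C d *\<^sub>C x = (c * d) *\<^sub>C x"
    and scaleR_scaleC: "r *\<^sub>R x = complex_of_real r *\<^sub>C x"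
    and mult_scaleC_left: "(c *\<^sub>C x) * y = c *\<^sub>C (x * y)"
    and mult_scaleC_right: "x * (c *\<^sub>C y) = c *\<^sub>C (x * y)"
    and norm_scaleC: "norm (c *\<^sub>C x) = cmod c * norm x"
    and star_star: "star (star x) = x"
    and star_add: "star (x + y) = star x + star y"
    and star_scaleC: "star (c *\<^sub>C x) = cnj c *\<^sub>C star x"
    and star_mult: "star (x * y) = star y * star x"
    and cstar_identity: "norm (star x * x) = (norm x)\<^sup>2"

global_interpretation cvec: vector_space
  "scaleC :: complex \<Rightarrow> 'a \<Rightarrow> 'a :: unital_cstar_algebra"
  defines cspan = cvec.span and csubspace = cvec.subspace
proof
  fix x :: 'a
  show "1 *\<^sub>C x = x"
    using scaleR_scaleC[of 1 x] by simp
qed (simp_all add: scaleC_add_right scaleC_add_left scaleC_scaleC)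

instantiation complex :: unital_cstar_algebra
begin
definition scaleC_complex :: "complex \<Rightarrow> complex \<Rightarrow> complex" where
  "scaleC_complex c x = c * x"
definition star_complex :: "complex \<Rightarrow> complex" where
  "star_complex x = cnj x"
instance
  by standard (simp_all add: scaleC_complex_def star_complex_def algebra_simps scaleR_conv_of_real
      norm_mult power2_eq_square)
end

lemma norm_star: "norm (star x) = norm (x :: 'a :: unital_cstar_algebra)"
proof -
  have le: "norm y \<le> norm (star y)" for y :: 'a
  proof (cases "norm y = 0")
    case False
    have "(norm y)\<^sup>2 \<le> norm (star y) * norm y"
      using norm_mult_ineq[of "star y" y] by (simp add: cstar_identity)
    then show ?thesis using False by (simp add: power2_eq_square)
  qed simp
  show ?thesis using le[of x] le[of "star x"] by (simp add: star_star)
qed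

lemma star_0: "star 0 = (0 :: 'a :: unital_cstar_algebra)"
  using star_add[of 0 "0 :: 'a"] by simp

lemma star_minus: "star (- x) = - star (x :: 'a :: unital_cstar_algebra)"
  using star_add[of x "- x"] by (simp add: star_0 eq_neg_iff_add_eq_0 add.commute)

lemma star_diff: "star (x - y) = star x - star (y :: 'a :: unital_cstar_algebra)"
  using star_add[of x "- y"] by (simp add: star_minus)

lemma star_1: "star 1 = (1 :: 'a :: unital_cstar_algebra)"
  using star_mult[of "star 1" "1 :: 'a"] by (simp add: star_star)

lemma bounded_linear_star: "bounded_linear (star :: 'a \<Rightarrow> 'a :: unital_cstar_algebra)"
  by (rule bounded_linear_intro[where K=1])
    (simp_all add: star_add scaleR_scaleC star_scaleC norm_star)

lemma bounded_linear_scaleC: "bounded_linear (\<lambda>x. c *\<^sub>C (x :: 'a :: unital_cstar_algebra))"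
  by (rule bounded_linear_intro[where K="cmod c"])
    (simp_all add: scaleC_add_right scaleR_scaleC scaleC_scaleC norm_scaleC mult.commute)

text \<open>For compact \<open>X\<close>, the type \<open>X \<Rightarrow>\<^sub>C complex\<close> of bounded continuous functions with the pointwise
  operations and the supremum norm is \<open>C(X)\<close>.\<close>

instantiation bcontfun :: (metric_space, unital_cstar_algebra) unital_cstar_algebra
begin

lemma bcontfun_mult_mem:
  fixes f g :: "'a \<Rightarrow>\<^sub>C 'b"
  shows "(\<lambda>x. apply_bcontfun f x * apply_bcontfun g x) \<in> bcontfun"
proof (rule bcontfun_normI)
  show "continuous_on UNIV (\<lambda>x. apply_bcontfun f x * apply_bcontfun g x)"
    by (intro continuous_intros) auto
  show "norm (apply_bcontfun f x * apply_bcontfun g x) \<le> norm f * norm g" for x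
    by (rule order_trans[OF norm_mult_ineq]) (intro mult_mono norm_bounded norm_ge_zero)
qed

lemma bcontfun_star_mem:
  fixes f :: "'a \<Rightarrow>\<^sub>C 'b"
  shows "(\<lambda>x. star (apply_bcontfun f x)) \<in> bcontfun"
proof (rule bcontfun_normI)
  show "continuous_on UNIV (\<lambda>x. star (apply_bcontfun f x))"
    by (intro bounded_linear.continuous_on[OF bounded_linear_star]) auto
  show "norm (star (apply_bcontfun f x)) \<le> norm f" for x
    by (simp add: norm_star norm_bounded)
qed

lemma bcontfun_scaleC_mem:
  fixes f :: "'a \<Rightarrow>\<^sub>C 'b"
  shows "(\<lambda>x. c *\<^sub>C (apply_bcontfun f x)) \<in> bcontfun"
proof (rule bcontfun_normI)
  show "continuous_on UNIV (\<lambda>x. c *\<^sub>C (apply_bcontfun f x))"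
    by (intro bounded_linear.continuous_on[OF bounded_linear_scaleC]) auto
  show "norm (c *\<^sub>C (apply_bcontfun f x)) \<le> cmod c * norm f" for x
    by (simp add: norm_scaleC norm_bounded mult_left_mono)
qed

definition times_bcontfun :: "('a \<Rightarrow>\<^sub>C 'b) \<Rightarrow> ('a \<Rightarrow>\<^sub>C 'b) \<Rightarrow> 'a \<Rightarrow>\<^sub>C 'b" where
  "f * g = Bcontfun (\<lambda>x. apply_bcontfun f x * apply_bcontfun g x)"
definition one_bcontfun :: "'a \<Rightarrow>\<^sub>C 'b" where
  "1 = const_bcontfun 1"
definition scaleC_bcontfun :: "complex \<Rightarrow> ('a \<Rightarrow>\<^sub>C 'b) \<Rightarrow> 'a \<Rightarrow>\<^sub>C 'b" where
  "c *\<^sub>C f = Bcontfun (\<lambda>x. c *\<^sub>C apply_bcontfun f x)"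
definition star_bcontfun :: "('a \<Rightarrow>\<^sub>C 'b) \<Rightarrow> 'a \<Rightarrow>\<^sub>C 'b" where
  "star f = Bcontfun (\<lambda>x. star (apply_bcontfun f x))"

lemma apply_bcontfun_cstar [simp]:
  fixes f g :: "'a \<Rightarrow>\<^sub>C 'b"
  shows "apply_bcontfun (f * g) x = apply_bcontfun f x * apply_bcontfun g x"
    and "apply_bcontfun (1 :: 'a \<Rightarrow>\<^sub>C 'b) x = 1"
    and "apply_bcontfun (c *\<^sub>C f) x = c *\<^sub>C apply_bcontfun f x"
    and "apply_bcontfun (star f) x = star (apply_bcontfun f x)"
  by (simp_all add: times_bcontfun_def one_bcontfun_def scaleC_bcontfun_def star_bcontfun_def
      Bcontfun_inverse bcontfun_mult_mem bcontfun_star_mem bcontfun_scaleC_mem)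

instance
proof
  fix f g h :: "'a \<Rightarrow>\<^sub>C 'b" and c d :: complex and r :: real
  show "norm (f * g) \<le> norm f * norm g"
  proof (rule norm_bound)
    show "norm (apply_bcontfun (f * g) x) \<le> norm f * norm g" for x
      by simp (rule order_trans[OF norm_mult_ineq], intro mult_mono norm_bounded norm_ge_zero)
  qed
  have le: "norm (c *\<^sub>C f) \<le> cmod c * norm f" for c and f :: "'a \<Rightarrow>\<^sub>C 'b"
    by (rule norm_bound) (simp add: norm_scaleC norm_bounded mult_left_mono)
  show "norm (c *\<^sub>C f) = cmod c * norm f"
  proof (cases "c = 0")
    case True
    then show ?thesis using le[of c f] by simp
  next
    case False
    have "norm f = norm (inverse c *\<^sub>C c *\<^sub>C f)"
      using False by (intro arg_cong[of _ _ norm] bcontfun_eqI) simp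
    also have "\<dots> \<le> inverse (cmod c) * norm (c *\<^sub>C f)"
      using le[of "inverse c" "c *\<^sub>C f"] by (simp add: norm_inverse)
    finally have "cmod c * norm f \<le> norm (c *\<^sub>C f)"
      using False by (simp add: field_simps)
    then show ?thesis using le[of c f] by simp
  qed
  show "norm (star f * f) = (norm f)\<^sup>2"
  proof (rule antisym)
    show "norm (star f * f) \<le> (norm f)\<^sup>2"
      by (rule norm_bound) (simp add: cstar_identity norm_bounded power_mono)
    have "norm (apply_bcontfun f x) \<le> sqrt (norm (star f * f))" for x
      using norm_bounded[of "star f * f" x] by (simp add: cstar_identity real_le_rsqrt)
    then have "norm f \<le> sqrt (norm (star f * f))"
      by (rule norm_bound)
    then show "(norm f)\<^sup>2 \<le> norm (star f * f)"
      by (metis norm_ge_zero real_sqrt_le_iff real_sqrt_unique sqrt_le_D)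
  qed
qed (auto intro!: bcontfun_eqI simp: algebra_simps scaleC_add_right scaleC_add_left scaleC_scaleC
      scaleR_scaleC mult_scaleC_left mult_scaleC_right star_star star_add star_scaleC star_mult)

end

section \<open>Positive functionals on *-algebras\<close>

locale star_algebra =
  fixes sc :: "complex \<Rightarrow> 'v \<Rightarrow> 'v :: {ring, monoid_mult}" and st :: "'v \<Rightarrow> 'v"
  assumes sc_add_right: "sc c (x + y) = sc c x + sc c y"
    and sc_add_left: "sc (c + d) x = sc c x + sc d x"
    and sc_sc: "sc c (sc d x) = sc (c * d) x"
    and sc_one: "sc 1 x = x"
    and mult_sc_left: "sc c x * y = sc c (x * y)"
    and mult_sc_right: "x * sc c y = sc c (x * y)"
    and st_st: "st (st x) = x"
    and st_add: "st (x + y) = st x + st y"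
    and st_sc: "st (sc c x) = sc (cnj c) (st x)"
    and st_mult: "st (x * y) = st y * st x"
begin

lemma st_1: "st 1 = 1"
  using st_mult[of "st 1" 1] by (simp add: st_st)

lemma sc_0: "sc 0 x = 0"
  using sc_add_left[of 0 0 x] by simp

lemma sc_m1: "sc (-1) x = - x"
  using sc_add_left[of 1 "-1" x] by (simp add: sc_0 sc_one eq_neg_iff_add_eq_0 add.commute)

lemma sc_zero: "sc c 0 = 0"
  using sc_add_right[of c 0 0] by simp

end

locale positive_functional = star_algebra sc st
  for sc :: "complex \<Rightarrow> 'v \<Rightarrow> 'v :: {ring, monoid_mult}" and st :: "'v \<Rightarrow> 'v" +
  fixes \<Phi> :: "'v \<Rightarrow> complex"
  assumes add: "\<Phi> (x + y) = \<Phi> x + \<Phi> y"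
    and sc: "\<Phi> (sc c x) = c * \<Phi> x"
    and pos: "Im (\<Phi> (st x * x)) = 0 \<and> Re (\<Phi> (st x * x)) \<ge> 0"
begin

abbreviation "q x \<equiv> Re (\<Phi> (st x * x))"
abbreviation "p x \<equiv> sqrt (q x)"

lemma zero: "\<Phi> 0 = 0"
  using add[of 0 0] by simp

lemma minus: "\<Phi> (- x) = - \<Phi> x"
  using sc[of "-1" x] by (simp add: sc_m1)

lemma q_ge_0: "q x \<ge> 0" using pos by blast

lemma expand: "\<Phi> (st (x + sc c y) * (x + sc c y)) =
   \<Phi> (st x * x) + c * \<Phi> (st x * y) + cnj c * \<Phi> (st y * x) + cnj c * c * \<Phi> (st y * y)"
  by (simp add: st_add st_sc algebra_simps mult_sc_left mult_sc_right add sc sc_sc)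

lemma hermitian: "\<Phi> (st y * x) = cnj (\<Phi> (st x * y))"
proof (rule complex_eqI)
  show "Im (\<Phi> (st y * x)) = Im (cnj (\<Phi> (st x * y)))"
    using arg_cong[OF expand[of x 1 y], of Im] pos by simp
  show "Re (\<Phi> (st y * x)) = Re (cnj (\<Phi> (st x * y)))"
    using arg_cong[OF expand[of x \<i> y], of Im] pos by simp
qed

lemma hermitian': "\<Phi> (st x) = cnj (\<Phi> x)"
  using hermitian[of x 1] by (simp add: st_1)

lemma Cauchy_Schwarz: "(cmod (\<Phi> (st x * y)))\<^sup>2 \<le> q x * q y"
proof -
  define B where "B = \<Phi> (st x * y)"
  have key: "0 \<le> q x + 2 * Re (c * B) + (cmod c)\<^sup>2 * q y" for c
  proof -
    have "0 \<le> Re (\<Phi> (st (x + sc c y) * (x + sc c y)))" using pos by blast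
    also have "\<dots> = q x + Re (c * B) + Re (cnj (c * B)) + Re (cnj c * c * \<Phi> (st y * y))"
      unfolding expand hermitian[of y x] by (simp add: B_def)
    also have "Re (cnj c * c * \<Phi> (st y * y)) = (cmod c)\<^sup>2 * q y"
      using pos[of y] by (simp add: cmod_def power2_eq_square)
    finally show ?thesis by (simp add: algebra_simps)
  qed
  have sq: "Re (cnj B * B) = (cmod B)\<^sup>2"
    by (simp add: cmod_def power2_eq_square)
  show ?thesis
  proof (cases "q y = 0")
    case True
    have "cmod B = 0"
    proof (rule ccontr)
      assume nz: "cmod B \<noteq> 0"
      define t where "t = (q x + 1) / (cmod B)\<^sup>2"
      have "of_real (- t) * cnj B * B = of_real (- t * (cmod B)\<^sup>2)"
        using complex_norm_square[of B] by (simp add: mult_ac)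
      then have "Re (of_real (- t) * cnj B * B) = - t * (cmod B)\<^sup>2"
        by (simp only: Re_complex_of_real)
      also have "\<dots> = - (q x + 1)"
        using nz by (simp add: t_def)
      finally show False
        using key[of "of_real (- t) * cnj B"] True q_ge_0[of x] by (simp add: mult.assoc)
    qed
    then show ?thesis using True by (simp add: B_def)
  next
    case False
    then have C: "q y > 0" using q_ge_0[of y] by simp
    define c where "c = of_real (- 1 / q y) * cnj B"
    have "Re (c * B) = - (cmod B)\<^sup>2 / q y"
      using sq by (simp add: c_def mult.assoc)
    moreover have "(cmod c)\<^sup>2 * q y = (cmod B)\<^sup>2 / q y"
      using C by (simp add: c_def norm_mult norm_divide power_mult_distrib power_divide power2_eq_square)
    ultimately have "0 \<le> q x - (cmod B)\<^sup>2 / q y"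
      using key[of c] by simp
    then show ?thesis using C by (simp add: B_def field_simps)
  qed
qed

lemma Cauchy_Schwarz': "cmod (\<Phi> (st x * y)) \<le> p x * p y"
  using Cauchy_Schwarz[of x y] by (metis real_le_rsqrt real_sqrt_mult)

lemma p_triangle: "p (x + y) \<le> p x + p y"
proof -
  have "q (x + y) = q x + 2 * Re (\<Phi> (st x * y)) + q y"
    using expand[of x 1 y] hermitian[of y x] by (simp add: sc_one)
  also have "\<dots> \<le> q x + 2 * (p x * p y) + q y"
    using Cauchy_Schwarz'[of x y] complex_Re_le_cmod[of "\<Phi> (st x * y)"] by linarith
  also have "\<dots> = (p x + p y)\<^sup>2"
    using q_ge_0 by (simp add: power2_sum)
  finally show ?thesis
    using q_ge_0 by (intro real_le_lsqrt) auto
qed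

lemma p_sc: "p (sc c x) = cmod c * p x"
proof -
  have "q (sc c x) = (cmod c)\<^sup>2 * q x"
    using pos[of x] by (simp add: st_sc mult_sc_left mult_sc_right sc_sc sc cmod_def power2_eq_square)
  then show ?thesis by (simp add: real_sqrt_mult)
qed

lemma functional_sum: "\<Phi> (\<Sum>i\<in>I. f i) = (\<Sum>i\<in>I. \<Phi> (f i))"
  by (induction I rule: infinite_finite_induct) (simp_all add: zero add)

lemma power_bound:
  assumes h: "st h = h" and C: "C \<ge> 0" and M: "M \<ge> 0"
    and bnd: "\<And>n. cmod (\<Phi> (st s * (h ^ n * s))) \<le> C * M ^ n"
  shows "cmod (\<Phi> (st s * (h * s))) \<le> M * q s"
proof (cases "q s = 0")
  case True
  then show ?thesis using Cauchy_Schwarz[of s "h * s"] by simp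
next
  case False
  then have q: "q s > 0" using q_ge_0[of s] by simp
  define g where "g n = cmod (\<Phi> (st s * (h ^ n * s))) / q s" for n
  have sth: "st (h ^ n) = h ^ n" for n
    by (induction n) (simp_all add: st_1 st_mult h power_commutes)
  have "(cmod (\<Phi> (st s * (h ^ n * s))))\<^sup>2 \<le> q s * cmod (\<Phi> (st s * (h ^ (2 * n) * s)))" for n
  proof -
    have "q (h ^ n * s) = Re (\<Phi> (st s * (h ^ (2 * n) * s)))"
      by (simp add: st_mult sth mult.assoc power_add mult_2)
    also have "\<dots> \<le> cmod (\<Phi> (st s * (h ^ (2 * n) * s)))" by (rule complex_Re_le_cmod)
    finally show ?thesis using Cauchy_Schwarz[of s "h ^ n * s"] q
      by (meson mult_left_mono order_trans less_imp_le)
  qed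
  then have g2: "(g n)\<^sup>2 \<le> g (2 * n)" for n
    using q by (simp add: g_def power_divide divide_le_eq power2_eq_square mult.commute)
  have g0: "g n \<ge> 0" for n using q by (simp add: g_def)
  have gp: "g 1 ^ (2 ^ n) \<le> g (2 ^ n)" for n
  proof (induction n)
    case (Suc n)
    have "g 1 ^ (2 ^ Suc n) = (g 1 ^ (2 ^ n))\<^sup>2" by (simp add: power_mult[symmetric] mult.commute)
    also have "\<dots> \<le> (g (2 ^ n))\<^sup>2" using Suc g0 by (intro power_mono) auto
    also have "\<dots> \<le> g (2 ^ Suc n)" using g2[of "2 ^ n"] by simp
    finally show ?case .
  qed simp
  have gb: "g n \<le> C / q s * M ^ n" for n
    using bnd[of n] q by (simp add: g_def divide_right_mono)
  have "g 1 \<le> M"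
  proof (cases "M = 0")
    case True
    have "(g 1)\<^sup>2 \<le> g 2" using g2[of 1] by (simp add: eval_nat_numeral)
    also have "\<dots> \<le> 0" using gb[of 2] True by simp
    finally show ?thesis using True by simp
  next
    case False
    then have M': "M > 0" using M by simp
    show ?thesis
    proof (rule ccontr)
      assume "\<not> g 1 \<le> M"
      then have r: "g 1 / M > 1" using M' by simp
      obtain n where n: "C / q s < (g 1 / M) ^ n" using real_arch_pow[OF r] by blast
      have "(g 1 / M) ^ n \<le> (g 1 / M) ^ (2 ^ n)"
        using r by (intro power_increasing) (auto intro: less_imp_le less_exp)
      also have "\<dots> \<le> C / q s"
        using gp[of n] gb[of "2 ^ n"] M' by (simp add: power_divide divide_le_eq)
      finally show False using n by simp
    qed
  qed
  then show ?thesis using q by (simp add: g_def divide_le_eq)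
qed

end

text \<open>A positive functional \<open>\<Phi>\<close> turns the algebra into a pre-Hilbert space with inner product
  \<open>\<langle>s, t\<rangle> = \<Phi>(s\<^sup>* t)\<close> (the GNS construction). The following is the supremum, over \<open>\<Phi>\<close> in \<open>F\<close>, of
  the operator norms of left multiplication by \<open>x\<close> on these spaces. Inserting 0 gives
  the value 0 when \<open>F\<close> is empty.\<close>

definition operator_seminorm ::
    "('v \<Rightarrow> 'v :: {ring, monoid_mult}) \<Rightarrow> ('v \<Rightarrow> complex) set \<Rightarrow> 'v \<Rightarrow> real" where
  "operator_seminorm st F x =
     Sup (insert 0 {sqrt (Re (\<Phi> (st (x * s) * (x * s)))) |\<Phi> s. \<Phi> \<in> F \<and> Re (\<Phi> (st s * s)) \<le> 1})"

locale functional_family = star_algebra sc st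
  for sc :: "complex \<Rightarrow> 'v \<Rightarrow> 'v :: {ring, monoid_mult}" and st :: "'v \<Rightarrow> 'v" +
  fixes F :: "('v \<Rightarrow> complex) set"
  assumes pf: "\<Phi> \<in> F \<Longrightarrow> positive_functional sc st \<Phi>"
    and left_bounded: "\<exists>M. \<forall>\<Phi>\<in>F. \<forall>s.
      sqrt (Re (\<Phi> (st (x * s) * (x * s)))) \<le> M * sqrt (Re (\<Phi> (st s * s)))"
begin

abbreviation "N \<equiv> operator_seminorm st F"
abbreviation "pn \<Phi> x \<equiv> sqrt (Re (\<Phi> (st x * x)))"

lemma pn_ge_0: "\<Phi> \<in> F \<Longrightarrow> pn \<Phi> x \<ge> 0"
  using positive_functional.q_ge_0[OF pf] by simp

lemma set_bdd: "bdd_above (insert 0 {pn \<Phi> (x * s) |\<Phi> s. \<Phi> \<in> F \<and> Re (\<Phi> (st s * s)) \<le> 1})"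
proof -
  obtain M where M: "\<And>\<Phi> s. \<Phi> \<in> F \<Longrightarrow> pn \<Phi> (x * s) \<le> M * pn \<Phi> s"
    using left_bounded[of x] by blast
  have "pn \<Phi> (x * s) \<le> max 0 M" if "\<Phi> \<in> F" "Re (\<Phi> (st s * s)) \<le> 1" for \<Phi> s
  proof -
    have "pn \<Phi> (x * s) \<le> max 0 M * pn \<Phi> s"
      using M[OF that(1), of s] pn_ge_0[OF that(1), of s]
      by (meson max.cobounded2 mult_right_mono order_trans)
    also have "\<dots> \<le> max 0 M * 1"
      using that(2) by (intro mult_left_mono) auto
    finally show ?thesis by simp
  qed
  then show ?thesis by (intro bdd_aboveI[of _ "max 0 M"]) auto
qed

lemma N_ge_0: "N x \<ge> 0"
  unfolding operator_seminorm_def by (rule cSup_upper[OF _ set_bdd]) simp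

lemma N_bound:
  assumes \<Phi>: "\<Phi> \<in> F" shows "pn \<Phi> (x * s) \<le> N x * pn \<Phi> s"
proof -
  interpret positive_functional sc st \<Phi> by (rule pf[OF \<Phi>])
  show ?thesis
  proof (cases "pn \<Phi> s = 0")
    case True
    then show ?thesis using left_bounded[of x] \<Phi> by (metis mult_zero_right)
  next
    case False
    then have P: "pn \<Phi> s > 0" using pn_ge_0[OF \<Phi>, of s] by linarith
    define c where "c = complex_of_real (1 / pn \<Phi> s)"
    have c: "cmod c = 1 / pn \<Phi> s" using P by (simp add: c_def norm_divide)
    have "pn \<Phi> (sc c s) = 1" using c P p_sc by simp
    then have "Re (\<Phi> (st (sc c s) * sc c s)) \<le> 1" by simp
    then have "pn \<Phi> (x * sc c s) \<le> N x"
      unfolding operator_seminorm_def using \<Phi> by (intro cSup_upper[OF _ set_bdd]) blast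
    moreover have "pn \<Phi> (x * sc c s) = pn \<Phi> (x * s) / pn \<Phi> s"
      unfolding mult_sc_right[of x c s] p_sc c by simp
    ultimately show ?thesis using P by (simp add: divide_le_eq)
  qed
qed

lemma N_least:
  assumes "M \<ge> 0" and "\<And>\<Phi> s. \<Phi> \<in> F \<Longrightarrow> pn \<Phi> (x * s) \<le> M * pn \<Phi> s"
  shows "N x \<le> M"
  unfolding operator_seminorm_def
proof (rule cSup_least)
  fix y assume "y \<in> insert 0 {pn \<Phi> (x * s) |\<Phi> s. \<Phi> \<in> F \<and> Re (\<Phi> (st s * s)) \<le> 1}"
  then consider "y = 0" | \<Phi> s where "\<Phi> \<in> F" "Re (\<Phi> (st s * s)) \<le> 1" "y = pn \<Phi> (x * s)"
    by auto
  then show "y \<le> M"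
  proof cases
    case 2
    have "y \<le> M * pn \<Phi> s" using assms(2)[OF 2(1)] 2(3) by simp
    also have "\<dots> \<le> M * 1" using 2(2) assms(1) by (intro mult_left_mono) auto
    finally show ?thesis by simp
  qed (use assms in auto)
qed simp

lemma N_triangle: "N (x + y) \<le> N x + N y"
proof (rule N_least)
  fix \<Phi> s assume \<Phi>: "\<Phi> \<in> F"
  interpret positive_functional sc st \<Phi> by (rule pf[OF \<Phi>])
  have "pn \<Phi> ((x + y) * s) \<le> pn \<Phi> (x * s) + pn \<Phi> (y * s)"
    unfolding distrib_right by (rule p_triangle)
  also have "\<dots> \<le> N x * pn \<Phi> s + N y * pn \<Phi> s"
    by (intro add_mono N_bound \<Phi>)
  finally show "pn \<Phi> ((x + y) * s) \<le> (N x + N y) * pn \<Phi> s" by (simp add: algebra_simps)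
qed (simp add: N_ge_0)

lemma N_zero: "N 0 = 0"
proof (rule antisym)
  show "N 0 \<le> 0"
  proof (rule N_least)
    fix \<Phi> s assume \<Phi>: "\<Phi> \<in> F"
    interpret positive_functional sc st \<Phi> by (rule pf[OF \<Phi>])
    show "pn \<Phi> (0 * s) \<le> 0 * pn \<Phi> s" by (simp add: zero)
  qed simp
qed (rule N_ge_0)

lemma N_sc: "N (sc c x) = cmod c * N x"
proof -
  have le: "N (sc c x) \<le> cmod c * N x" for c x
  proof (rule N_least)
    fix \<Phi> s assume \<Phi>: "\<Phi> \<in> F"
    interpret positive_functional sc st \<Phi> by (rule pf[OF \<Phi>])
    show "pn \<Phi> (sc c x * s) \<le> cmod c * N x * pn \<Phi> s"
      using N_bound[OF \<Phi>, of x s] by (simp add: mult_sc_left p_sc mult.assoc mult_left_mono)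
  qed (simp add: N_ge_0)
  show ?thesis
  proof (cases "c = 0")
    case False
    have "N x \<le> inverse (cmod c) * N (sc c x)"
      using le[of "inverse c" "sc c x"] False by (simp add: sc_sc sc_one norm_inverse)
    then have "cmod c * N x \<le> N (sc c x)" using False by (simp add: field_simps)
    then show ?thesis using le[of c x] by simp
  qed (simp add: sc_0 N_zero)
qed

lemma N_minus: "N (- x) = N x"
  using N_sc[of "-1" x] by (simp add: sc_m1)

lemma N_minus_commute: "N (x - y) = N (y - x)"
  using N_minus[of "x - y"] by simp

lemma N_diff_triangle: "\<bar>N x - N y\<bar> \<le> N (x - y)"
  using N_triangle[of "x - y" y] N_triangle[of "y - x" x] N_minus_commute[of x y] by simp

lemma N_mult: "N (x * y) \<le> N x * N y"
proof (rule N_least)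
  fix \<Phi> s assume \<Phi>: "\<Phi> \<in> F"
  have "pn \<Phi> (x * y * s) \<le> N x * pn \<Phi> (y * s)"
    using N_bound[OF \<Phi>, of x "y * s"] by (simp add: mult.assoc)
  also have "\<dots> \<le> N x * (N y * pn \<Phi> s)"
    by (intro mult_left_mono N_bound \<Phi> N_ge_0)
  finally show "pn \<Phi> (x * y * s) \<le> N x * N y * pn \<Phi> s" by (simp add: mult.assoc)
qed (simp add: N_ge_0)

lemma N_sq_le: "(N x)\<^sup>2 \<le> N (st x * x)"
proof -
  have "N x \<le> sqrt (N (st x * x))"
  proof (rule N_least)
    fix \<Phi> s assume \<Phi>: "\<Phi> \<in> F"
    interpret positive_functional sc st \<Phi> by (rule pf[OF \<Phi>])
    have "Re (\<Phi> (st (x * s) * (x * s))) \<le> cmod (\<Phi> (st s * (st x * x * s)))"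
      by (simp add: st_mult mult.assoc complex_Re_le_cmod)
    also have "\<dots> \<le> pn \<Phi> s * pn \<Phi> (st x * x * s)"
      by (rule Cauchy_Schwarz')
    also have "\<dots> \<le> pn \<Phi> s * (N (st x * x) * pn \<Phi> s)"
      by (intro mult_left_mono N_bound \<Phi> pn_ge_0)
    finally have "pn \<Phi> (x * s) \<le> sqrt (N (st x * x) * (pn \<Phi> s * pn \<Phi> s))"
      by (intro real_sqrt_le_mono) (simp only: mult_ac)
    also have "\<dots> = sqrt (N (st x * x)) * pn \<Phi> s"
      by (simp add: real_sqrt_mult q_ge_0)
    finally show "pn \<Phi> (x * s) \<le> sqrt (N (st x * x)) * pn \<Phi> s" .
  qed (simp add: N_ge_0)
  then have "(N x)\<^sup>2 \<le> (sqrt (N (st x * x)))\<^sup>2" by (intro power_mono N_ge_0)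
  then show ?thesis by (simp add: N_ge_0)
qed

lemma N_st: "N (st x) = N x"
proof -
  have le: "N x \<le> N (st x)" for x
  proof (cases "N x = 0")
    case False
    then have "N x > 0" using N_ge_0[of x] by simp
    moreover have "N x * N x \<le> N (st x) * N x"
      using N_sq_le[of x] N_mult[of "st x" x] by (simp add: power2_eq_square)
    ultimately show ?thesis by simp
  qed (simp add: N_ge_0)
  show ?thesis using le[of x] le[of "st x"] by (simp add: st_st)
qed

lemma N_cstar: "N (st x * x) = (N x)\<^sup>2"
  using N_sq_le[of x] N_mult[of "st x" x] by (simp add: N_st power2_eq_square)

lemma N_eq_0I:
  assumes "\<And>\<Phi> s. \<Phi> \<in> F \<Longrightarrow> \<Phi> (st (x * s) * (x * s)) = 0" shows "N x = 0"
  by (rule antisym[OF N_least N_ge_0]) (simp_all add: assms)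

end

subsection \<open>The Schur product of positive kernels\<close>

definition positive_kernel :: "'i set \<Rightarrow> ('i \<Rightarrow> 'i \<Rightarrow> complex) \<Rightarrow> bool" where
  "positive_kernel I P \<longleftrightarrow> (\<forall>i j. P j i = cnj (P i j)) \<and>
     (\<forall>c. 0 \<le> Re (\<Sum>i\<in>I. \<Sum>j\<in>I. cnj (c i) * c j * P i j))"

lemma positive_kernel_hermitian: "positive_kernel I P \<Longrightarrow> P j i = cnj (P i j)"
  unfolding positive_kernel_def by blast

lemma positive_kernel_nonneg:
  "positive_kernel I P \<Longrightarrow> 0 \<le> Re (\<Sum>i\<in>I. \<Sum>j\<in>I. cnj (c i) * c j * P i j)"
  unfolding positive_kernel_def by blast

lemma positive_kernel_subset:
  fixes P :: "'i \<Rightarrow> 'i \<Rightarrow> complex"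
  assumes P: "positive_kernel J P" and I: "I \<subseteq> J" and J: "finite J"
  shows "positive_kernel I P"
  unfolding positive_kernel_def
proof (intro conjI allI)
  fix i j show "P j i = cnj (P i j)" by (rule positive_kernel_hermitian[OF P])
next
  fix c :: "'i \<Rightarrow> complex"
  define d where "d i = (if i \<in> I then c i else 0)" for i
  have "(\<Sum>i\<in>J. \<Sum>j\<in>J. cnj (d i) * d j * P i j) = (\<Sum>i\<in>I. \<Sum>j\<in>J. cnj (d i) * d j * P i j)"
    by (rule sum.mono_neutral_right[OF J I]) (simp add: d_def)
  also have "\<dots> = (\<Sum>i\<in>I. \<Sum>j\<in>I. cnj (d i) * d j * P i j)"
    by (intro sum.cong refl sum.mono_neutral_right[OF J I]) (simp add: d_def)
  also have "\<dots> = (\<Sum>i\<in>I. \<Sum>j\<in>I. cnj (c i) * c j * P i j)"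
    by (intro sum.cong refl) (simp add: d_def)
  finally show "0 \<le> Re (\<Sum>i\<in>I. \<Sum>j\<in>I. cnj (c i) * c j * P i j)"
    using positive_kernel_nonneg[OF P, of d] by simp
qed

lemma positive_kernel_schur:
  fixes P R :: "'i \<Rightarrow> 'i \<Rightarrow> complex"
  assumes "finite I" "positive_kernel I P" "positive_kernel I R"
  shows "positive_kernel I (\<lambda>i j. P i j * R i j)"
  using assms
proof (induction I arbitrary: P rule: finite_induct)
  case empty
  have "P j i * R j i = cnj (P i j * R i j)" for i j
    by (metis complex_cnj_mult empty positive_kernel_hermitian)
  then show ?case by (simp add: positive_kernel_def)
next
  case (insert i I P)
  let ?J = "insert i I"
  note Pk = insert.prems(1) and Rk = insert.prems(2)
  have fin: "finite ?J" using insert.hyps by simp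
  have hP: "P j k = cnj (P k j)" for j k by (rule positive_kernel_hermitian[OF Pk])
  have hR: "R j k = cnj (R k j)" for j k by (rule positive_kernel_hermitian[OF Rk])
  define Q where "Q c d = (\<Sum>j\<in>?J. \<Sum>k\<in>?J. cnj (c j) * d k * P j k)" for c d
  have Qpos: "0 \<le> Re (Q c c)" for c unfolding Q_def by (rule positive_kernel_nonneg[OF Pk])
  define L where "L c = (\<Sum>k\<in>?J. c k * P i k)" for c
  define e where "e j = (if j = i then 1 else 0 :: complex)" for j
  have Qe: "Q e d = L d" for d
  proof -
    have "Q e d = (\<Sum>j\<in>?J. if j = i then (\<Sum>k\<in>?J. d k * P i k) else 0)"
      unfolding Q_def by (intro sum.cong refl) (simp add: e_def)
    then show ?thesis using fin by (simp add: L_def)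
  qed
  have Qh: "Q c d = cnj (Q d c)" for c d
  proof -
    have "cnj (Q d c) = (\<Sum>j\<in>?J. \<Sum>k\<in>?J. cnj (c k) * d j * P k j)"
      unfolding Q_def cnj_sum by (intro sum.cong refl) (simp add: hP[symmetric] mult_ac)
    also have "\<dots> = Q c d" unfolding Q_def by (rule sum.swap)
    finally show ?thesis by simp
  qed
  have Le: "L e = P i i"
  proof -
    have "L e = (\<Sum>k\<in>?J. if k = i then P i i else 0)"
      unfolding L_def by (intro sum.cong refl) (simp add: e_def)
    then show ?thesis using fin by simp
  qed
  have expand: "Q (\<lambda>j. c j + t * e j) (\<lambda>j. c j + t * e j)
      = Q c c + t * Q c e + cnj t * Q e c + cnj t * t * Q e e" for c t
    unfolding Q_def by (simp only: sum.distrib sum_distrib_left complex_cnj_add complex_cnj_mult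
        distrib_left distrib_right mult_ac add_ac)
  have key: "0 \<le> Re (Q c c) + 2 * Re (cnj t * L c) + (cmod t)\<^sup>2 * Re (P i i)" for c t
  proof -
    have "0 \<le> Re (Q c c + t * cnj (L c) + cnj t * L c + cnj t * t * P i i)"
      using Qpos[of "\<lambda>j. c j + t * e j"] unfolding expand Qh[of c e] Qe Le .
    moreover have "Re (cnj t * t * P i i) = (cmod t)\<^sup>2 * Re (P i i)"
      by (simp add: cmod_def power2_eq_square algebra_simps)
    moreover have "Re (t * cnj (L c)) = Re (cnj t * L c)" by simp
    ultimately show ?thesis unfolding plus_complex.sel by linarith
  qed
  have imr: "Im (P i i) = 0" using hP[of i i] by (simp add: complex_eq_iff)
  define r where "r = Re (P i i)"
  have Pii: "P i i = of_real r" using imr by (simp add: complex_eq_iff r_def)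
  have r0: "r \<ge> 0" using Qpos[of e] by (simp add: Qe Le r_def)
  have L0: "L c = 0" if "r = 0" for c
  proof (rule ccontr)
    assume nz: "L c \<noteq> 0"
    define m where "m = (cmod (L c))\<^sup>2"
    have m: "m > 0" using nz by (simp add: m_def)
    define s where "s = - (Re (Q c c) + 1) / m"
    define t where "t = of_real s * L c"
    have "cnj t * L c = of_real (s * m)"
      using complex_norm_square[of "L c"] by (simp add: t_def m_def mult_ac)
    then have "Re (cnj t * L c) = s * m" by simp
    then show False using key[of c t] that Qpos[of c] m by (simp add: r_def s_def)
  qed
  define P' where "P' j k = P j k - P j i * P i k / of_real r" for j k
  have P'i: "P' i k = 0" "P' k i = 0" if "k \<in> ?J" for k
  proof -
    have "P' i k = 0"
    proof (cases "r = 0")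
      case True
      have "L (\<lambda>j. if j = k then 1 else 0) = P i k"
      proof -
        have "L (\<lambda>j. if j = k then 1 else 0) = (\<Sum>j\<in>?J. if j = k then P i k else 0)"
          unfolding L_def by (intro sum.cong refl) auto
        then show ?thesis using fin that by simp
      qed
      then show ?thesis using L0[OF True] by (simp add: P'_def True)
    qed (simp add: P'_def Pii)
    moreover have "P' k i = cnj (P' i k)"
      by (simp add: P'_def hP[symmetric] mult.commute)
    ultimately show "P' i k = 0" "P' k i = 0" by simp_all
  qed
  have "positive_kernel ?J P'"
    unfolding positive_kernel_def
  proof (intro conjI allI)
    fix j k show "P' k j = cnj (P' j k)"
      by (simp add: P'_def hP[symmetric] mult.commute)
  next
    fix c :: "'i \<Rightarrow> complex"
    have "(\<Sum>j\<in>?J. \<Sum>k\<in>?J. cnj (c j) * c k * P' j k)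
        = Q c c - (\<Sum>j\<in>?J. \<Sum>k\<in>?J. (cnj (c j) * P j i) * (c k * P i k)) / of_real r"
      unfolding Q_def P'_def
      by (simp only: sum_subtractf[symmetric] sum_divide_distrib right_diff_distrib)
        (simp add: mult_ac)
    also have "(\<Sum>j\<in>?J. \<Sum>k\<in>?J. (cnj (c j) * P j i) * (c k * P i k)) = cnj (L c) * L c"
      unfolding L_def sum_product[symmetric] cnj_sum
      by (rule arg_cong2[where f="(*)"]) (simp_all add: hP[symmetric])
    also have "cnj (L c) * L c = of_real ((cmod (L c))\<^sup>2)"
      using complex_norm_square[of "L c"] by (simp add: mult.commute)
    finally have eq: "Re (\<Sum>j\<in>?J. \<Sum>k\<in>?J. cnj (c j) * c k * P' j k)
        = Re (Q c c) - (cmod (L c))\<^sup>2 / r"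
      by (simp flip: of_real_divide Re_sum)
    show "0 \<le> Re (\<Sum>j\<in>?J. \<Sum>k\<in>?J. cnj (c j) * c k * P' j k)"
    proof (cases "r = 0")
      case True
      then show ?thesis unfolding eq using Qpos[of c] by simp
    next
      case False
      then have r: "r > 0" using r0 by simp
      define t where "t = - L c / of_real r"
      have "cnj t * L c = of_real (- ((cmod (L c))\<^sup>2 / r))"
        using complex_norm_square[of "L c"] by (simp add: t_def mult_ac)
      then have "Re (cnj t * L c) = - ((cmod (L c))\<^sup>2 / r)" by simp
      moreover have "(cmod t)\<^sup>2 * r = (cmod (L c))\<^sup>2 / r"
        using r by (simp add: t_def norm_divide power_divide power2_eq_square)
      ultimately show ?thesis unfolding eq using key[of c t] by (simp add: r_def)
    qed
  qed
  then have "positive_kernel I P'" "positive_kernel I R"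
    using Rk by (auto intro: positive_kernel_subset[OF _ _ fin])
  then have IH: "positive_kernel I (\<lambda>j k. P' j k * R j k)"
    by (rule insert.IH)
  show ?case
    unfolding positive_kernel_def
  proof (intro conjI allI)
    fix j k show "P k j * R k j = cnj (P j k * R j k)"
      by (simp add: hP[symmetric] hR[symmetric])
  next
    fix c :: "'i \<Rightarrow> complex"
    define d where "d k = c k * P i k" for k
    have "(\<Sum>j\<in>?J. \<Sum>k\<in>?J. cnj (c j) * c k * (P j k * R j k))
       = (\<Sum>j\<in>?J. \<Sum>k\<in>?J. cnj (c j) * c k * (P' j k * R j k))
         + (\<Sum>j\<in>?J. \<Sum>k\<in>?J. cnj (d j) * d k * R j k) / of_real r"
      unfolding sum_divide_distrib sum.distrib[symmetric]
      by (intro sum.cong refl) (simp add: P'_def d_def hP[symmetric] field_simps)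
    also have "(\<Sum>j\<in>?J. \<Sum>k\<in>?J. cnj (c j) * c k * (P' j k * R j k))
       = (\<Sum>j\<in>I. \<Sum>k\<in>I. cnj (c j) * c k * (P' j k * R j k))"
      using insert.hyps P'i by simp
    finally have "Re (\<Sum>j\<in>?J. \<Sum>k\<in>?J. cnj (c j) * c k * (P j k * R j k))
       = Re (\<Sum>j\<in>I. \<Sum>k\<in>I. cnj (c j) * c k * (P' j k * R j k))
         + Re (\<Sum>j\<in>?J. \<Sum>k\<in>?J. cnj (d j) * d k * R j k) / r"
      by (simp del: Re_sum sum.insert)
    moreover have "0 \<le> Re (\<Sum>j\<in>I. \<Sum>k\<in>I. cnj (c j) * c k * (P' j k * R j k))"
      by (rule positive_kernel_nonneg[OF IH])
    moreover have "0 \<le> Re (\<Sum>j\<in>?J. \<Sum>k\<in>?J. cnj (d j) * d k * R j k) / r"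
      by (intro divide_nonneg_nonneg positive_kernel_nonneg[OF Rk] r0)
    ultimately show "0 \<le> Re (\<Sum>j\<in>?J. \<Sum>k\<in>?J. cnj (c j) * c k * (P j k * R j k))"
      by linarith
  qed
qed

section \<open>Linear maps and states\<close>

definition clinear :: "('a :: unital_cstar_algebra \<Rightarrow> 'b :: unital_cstar_algebra) \<Rightarrow> bool" where
  "clinear = Vector_Spaces.linear scaleC scaleC"

definition bounded_clinear :: "('a :: unital_cstar_algebra \<Rightarrow> 'b :: unital_cstar_algebra) \<Rightarrow> bool" where
  "bounded_clinear f \<longleftrightarrow> clinear f \<and> (\<exists>K. \<forall>x. norm (f x) \<le> K * norm x)"

definition state :: "('a :: unital_cstar_algebra \<Rightarrow> complex) \<Rightarrow> bool" where
  "state \<phi> \<longleftrightarrow> bounded_clinear \<phi> \<and> (\<forall>a. \<phi> (star a * a) \<in> \<real>\<^sub>\<ge>\<^sub>0) \<and> \<phi> 1 = 1"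

lemma clinear_add: "clinear f \<Longrightarrow> f (x + y) = f x + f y"
  by (simp add: clinear_def Vector_Spaces.linear_iff)

lemma clinear_scaleC: "clinear f \<Longrightarrow> f (c *\<^sub>C x) = c *\<^sub>C f x"
  by (simp add: clinear_def Vector_Spaces.linear_iff)

lemma star_algebra_cstar: "star_algebra scaleC (star :: 'a \<Rightarrow> 'a :: unital_cstar_algebra)"
  by standard (simp_all add: scaleC_add_right scaleC_add_left scaleC_scaleC mult_scaleC_left
      mult_scaleC_right star_star star_add star_scaleC star_mult)

lemma state_positive_functional:
  assumes "state \<phi>" shows "positive_functional scaleC star \<phi>"
proof -
  have lin: "clinear \<phi>" using assms by (simp add: state_def bounded_clinear_def)
  show ?thesis
    using assms clinear_add[OF lin] clinear_scaleC[OF lin]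
    by (intro positive_functional.intro star_algebra_cstar positive_functional_axioms.intro)
      (auto simp: state_def scaleC_complex_def complex_nonneg_Reals_iff)
qed

lemma norm_one_le: "norm (1 :: 'a :: unital_cstar_algebra) \<le> 1"
proof -
  have "norm (1 :: 'a) = (norm (1 :: 'a))\<^sup>2"
    using cstar_identity[of "1 :: 'a"] by (simp add: star_1)
  then have "norm (1 :: 'a) = 0 \<or> norm (1 :: 'a) = 1"
    by (simp add: power2_eq_square)
  then show ?thesis by auto
qed

lemma norm_power_le: "norm (x ^ n) \<le> norm (x :: 'a :: unital_cstar_algebra) ^ n"
proof (induction n)
  case (Suc n)
  have "norm (x ^ Suc n) \<le> norm x * norm (x ^ n)" by (simp add: norm_mult_ineq)
  also have "\<dots> \<le> norm x * norm x ^ n" using Suc by (simp add: mult_left_mono)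
  finally show ?case by simp
qed (simp add: norm_one_le)

section \<open>The minimal tensor product\<close>

text \<open>
  The type \<open>pretensor\<close> below is the free complex vector space on the pairs \<open>(a, b)\<close>, with the
  multiplication of the monoid algebra of the product of the multiplicative monoids of the two
  algebras. (The library writes the monoid of exponents of a \<open>poly_mapping\<close> additively, hence the
  instance of \<open>monoid_add\<close>.) The algebraic tensor product is its quotient by the bilinearity relations.
  The spatial seminorm \<open>min_seminorm\<close> is the supremum of the operator norms in the GNS representations
  of the product functionals \<open>\<phi> \<otimes> \<psi>\<close> of states, i.e. in the tensor products of the GNS
  representations of \<open>\<phi>\<close> and \<open>\<psi>\<close>; the direct sum of the latter is the tensor product of the universal
  representations. Its null space is the space of bilinearity relations, so the completion \<open>\<otimes>\<^sub>m\<close> of the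
  Hausdorff quotient is the completion of the algebraic tensor product in the minimal C*-norm.
\<close>

datatype ('a, 'b) elementary = Elementary (left_factor: 'a) (right_factor: 'b)

instantiation elementary :: (monoid_mult, monoid_mult) monoid_add
begin
definition "0 = Elementary 1 1"
definition "s + t = Elementary (left_factor s * left_factor t) (right_factor s * right_factor t)"
instance by standard (simp_all add: zero_elementary_def plus_elementary_def mult.assoc)
end

type_synonym ('a, 'b) pretensor = "('a, 'b) elementary \<Rightarrow>\<^sub>0 complex"

definition pretensor_star ::
    "('a :: unital_cstar_algebra, 'b :: unital_cstar_algebra) pretensor \<Rightarrow> ('a, 'b) pretensor" where
  "pretensor_star t = (\<Sum>k\<in>Poly_Mapping.keys t.
     Poly_Mapping.single (Elementary (star (left_factor k)) (star (right_factor k)))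
       (cnj (Poly_Mapping.lookup t k)))"

definition product_functional ::
    "('a \<Rightarrow> complex) \<Rightarrow> ('b \<Rightarrow> complex) \<Rightarrow> ('a, 'b) pretensor \<Rightarrow> complex" where
  "product_functional \<phi> \<psi> t =
     (\<Sum>k\<in>Poly_Mapping.keys t. Poly_Mapping.lookup t k * (\<phi> (left_factor k) * \<psi> (right_factor k)))"

definition min_seminorm ::
    "('a :: unital_cstar_algebra, 'b :: unital_cstar_algebra) pretensor \<Rightarrow> real" where
  "min_seminorm =
     operator_seminorm pretensor_star {product_functional \<phi> \<psi> |\<phi> \<psi>. state \<phi> \<and> state \<psi>}"

abbreviation "pscale c t \<equiv> Poly_Mapping.single 0 c * t"

lemma pretensor_expand: "t = (\<Sum>k\<in>Poly_Mapping.keys t. Poly_Mapping.single k (Poly_Mapping.lookup t k))"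
proof (rule poly_mapping_eqI)
  fix k
  show "Poly_Mapping.lookup t k =
    Poly_Mapping.lookup (\<Sum>k\<in>Poly_Mapping.keys t. Poly_Mapping.single k (Poly_Mapping.lookup t k)) k"
    by (cases "k \<in> Poly_Mapping.keys t")
      (simp_all add: lookup_sum lookup_single when_def in_keys_iff)
qed

lemma pretensor_induct [case_names single add]:
  fixes t :: "('a, 'b) pretensor"
  assumes single: "\<And>k c. P (Poly_Mapping.single k c)"
    and add: "\<And>s t. P s \<Longrightarrow> P t \<Longrightarrow> P (s + t)"
  shows "P t"
proof -
  have 0: "P 0" using single[of undefined 0] by simp
  have "P (\<Sum>k\<in>A. Poly_Mapping.single k (Poly_Mapping.lookup t k))" for A
    by (induction A rule: infinite_finite_induct) (auto intro: 0 single add)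
  then show ?thesis using pretensor_expand[of t] by metis
qed

lemma pretensor_star_single [simp]:
  "pretensor_star (Poly_Mapping.single k c) =
     Poly_Mapping.single (Elementary (star (left_factor k)) (star (right_factor k))) (cnj c)"
  by (simp add: pretensor_star_def)

lemma pretensor_star_add: "pretensor_star (s + t) = pretensor_star s + pretensor_star t"
  unfolding pretensor_star_def
  by (rule setsum_keys_plus_distrib[of "\<lambda>k c. Poly_Mapping.single (Elementary (star (left_factor k)) (star (right_factor k))) (cnj c)"])
    (simp_all add: single_add)

lemma pretensor_star_star: "pretensor_star (pretensor_star t) = t"
  by (induction t rule: pretensor_induct) (simp_all add: pretensor_star_add star_star)

lemma pretensor_star_mult: "pretensor_star (s * t) = pretensor_star t * pretensor_star s"
proof (induction s rule: pretensor_induct)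
  case (single k c)
  show ?case
    by (induction t rule: pretensor_induct)
      (simp_all add: mult_single pretensor_star_add plus_elementary_def star_mult distrib_left
        distrib_right mult.commute)
qed (simp add: distrib_left distrib_right pretensor_star_add)

lemma pscale_commute: "t * Poly_Mapping.single 0 c = pscale c (t :: ('a :: monoid_mult, 'b :: monoid_mult) pretensor)"
  by (induction t rule: pretensor_induct) (simp_all add: mult_single distrib_left distrib_right mult.commute)

lemma star_algebra_pretensor: "star_algebra pscale (pretensor_star ::
   ('a :: unital_cstar_algebra, 'b :: unital_cstar_algebra) pretensor \<Rightarrow> _)"
proof
  fix c d and x y :: "('a, 'b) pretensor"
  show "x * pscale c y = pscale c (x * y)"
    by (metis mult.assoc pscale_commute)
  show "pretensor_star (pscale c x) = pscale (cnj c) (pretensor_star x)"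
  proof -
    have "Elementary (star (left_factor z)) (star (right_factor z)) = z" if "z = 0" for z :: "('a, 'b) elementary"
      using that by (simp add: zero_elementary_def star_1)
    then show ?thesis by (simp add: pretensor_star_mult pscale_commute)
  qed
qed (simp_all add: distrib_left distrib_right single_add mult_single mult.assoc[symmetric]
    pretensor_star_add pretensor_star_star pretensor_star_mult)

lemma product_functional_single [simp]:
  "product_functional \<phi> \<psi> (Poly_Mapping.single k c) = c * (\<phi> (left_factor k) * \<psi> (right_factor k))"
  by (simp add: product_functional_def)

lemma product_functional_add:
  "product_functional \<phi> \<psi> (s + t) = product_functional \<phi> \<psi> s + product_functional \<phi> \<psi> t"
  unfolding product_functional_def
  by (rule setsum_keys_plus_distrib[of "\<lambda>k c. c * (\<phi> (left_factor k) * \<psi> (right_factor k))"])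
    (simp_all add: algebra_simps)

lemma product_functional_sum:
  "product_functional \<phi> \<psi> (\<Sum>i\<in>I. f i) = (\<Sum>i\<in>I. product_functional \<phi> \<psi> (f i))"
proof -
  have "product_functional \<phi> \<psi> 0 = 0" by (simp add: product_functional_def)
  then show ?thesis
    by (induction I rule: infinite_finite_induct) (simp_all add: product_functional_add)
qed

lemma product_functional_pscale:
  fixes t :: "('a :: monoid_mult, 'b :: monoid_mult) pretensor"
  shows "product_functional \<phi> \<psi> (pscale c t) = c * product_functional \<phi> \<psi> t"
  by (induction t rule: pretensor_induct)
    (simp_all add: mult_single distrib_left product_functional_add)

lemma product_functional_sandwich:
  fixes s :: "('a :: unital_cstar_algebra, 'b :: unital_cstar_algebra) pretensor"
  shows "product_functional \<phi> \<psi> (pretensor_star s * (Poly_Mapping.single e 1 * s)) =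
    (\<Sum>i\<in>Poly_Mapping.keys s. \<Sum>j\<in>Poly_Mapping.keys s.
       cnj (Poly_Mapping.lookup s i) * Poly_Mapping.lookup s j *
       (\<phi> (star (left_factor i) * (left_factor e * left_factor j)) * \<psi> (star (right_factor i) * (right_factor e * right_factor j))))"
proof -
  let ?K = "Poly_Mapping.keys s" and ?l = "Poly_Mapping.lookup s"
  have "pretensor_star s * (Poly_Mapping.single e 1 * s) =
      (\<Sum>i\<in>?K. Poly_Mapping.single (Elementary (star (left_factor i)) (star (right_factor i))) (cnj (?l i))) *
      (Poly_Mapping.single e 1 * (\<Sum>j\<in>?K. Poly_Mapping.single j (?l j)))"
    using pretensor_expand[of s] by (simp add: pretensor_star_def)
  also have "Poly_Mapping.single e 1 * (\<Sum>j\<in>?K. Poly_Mapping.single j (?l j)) =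
      (\<Sum>j\<in>?K. Poly_Mapping.single (e + j) (?l j))"
    by (simp add: sum_distrib_left mult_single)
  also have "(\<Sum>i\<in>?K. Poly_Mapping.single (Elementary (star (left_factor i)) (star (right_factor i))) (cnj (?l i))) * \<dots>
      = (\<Sum>i\<in>?K. \<Sum>j\<in>?K. Poly_Mapping.single
      (Elementary (star (left_factor i)) (star (right_factor i)) + (e + j)) (cnj (?l i) * ?l j))"
    by (simp add: sum_product mult_single)
  finally show ?thesis
    by (simp add: product_functional_sum plus_elementary_def)
qed

lemma product_functional_positive:
  fixes \<phi> :: "'a :: unital_cstar_algebra \<Rightarrow> complex" and \<psi> :: "'b :: unital_cstar_algebra \<Rightarrow> complex"
  assumes "state \<phi>" "state \<psi>"
  shows "positive_functional pscale pretensor_star (product_functional \<phi> \<psi>)"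
proof -
  interpret f: positive_functional scaleC star \<phi> by (rule state_positive_functional) fact
  interpret g: positive_functional scaleC star \<psi> by (rule state_positive_functional) fact
  have ker: "positive_kernel I (\<lambda>i j. \<phi> (star (l i) * l j))"
    if \<phi>: "positive_functional scaleC star \<phi>"
    for I :: "'i set" and l and \<phi> :: "'c :: unital_cstar_algebra \<Rightarrow> complex"
    unfolding positive_kernel_def
  proof (intro conjI allI)
    interpret positive_functional scaleC star \<phi> by fact
    show "\<phi> (star (l j) * l i) = cnj (\<phi> (star (l i) * l j))" for i j
      by (rule hermitian)
    fix c :: "'i \<Rightarrow> complex"
    define x where "x = (\<Sum>i\<in>I. c i *\<^sub>C l i)"
    have "star x = (\<Sum>i\<in>I. cnj (c i) *\<^sub>C star (l i))"
      unfolding x_def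
      by (induction I rule: infinite_finite_induct) (simp_all add: star_0 star_add star_scaleC)
    then have "\<phi> (star x * x) = (\<Sum>i\<in>I. \<Sum>j\<in>I. cnj (c i) * c j * \<phi> (star (l i) * l j))"
      unfolding x_def
      by (simp add: sum_product functional_sum mult_scaleC_left mult_scaleC_right sc mult_ac)
    then show "0 \<le> Re (\<Sum>i\<in>I. \<Sum>j\<in>I. cnj (c i) * c j * \<phi> (star (l i) * l j))"
      using pos[of x] by simp
  qed
  have herm: "product_functional \<phi> \<psi> (pretensor_star t) = cnj (product_functional \<phi> \<psi> t)" for t
    by (induction t rule: pretensor_induct)
      (simp_all add: pretensor_star_add product_functional_add f.hermitian' g.hermitian')
  show ?thesis
  proof (intro positive_functional.intro star_algebra_pretensor positive_functional_axioms.intro)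
    fix x :: "('a, 'b) pretensor"
    have "positive_kernel (Poly_Mapping.keys x)
      (\<lambda>i j. \<phi> (star (left_factor i) * left_factor j) * \<psi> (star (right_factor i) * right_factor j))"
      by (intro positive_kernel_schur ker f.positive_functional_axioms g.positive_functional_axioms) simp
    from positive_kernel_nonneg[OF this, of "Poly_Mapping.lookup x"]
    have "0 \<le> Re (product_functional \<phi> \<psi> (pretensor_star x * (Poly_Mapping.single 0 1 * x)))"
      unfolding product_functional_sandwich by (simp add: zero_elementary_def)
    moreover have "Im (product_functional \<phi> \<psi> (pretensor_star x * x)) = 0"
      using herm[of "pretensor_star x * x"]
      by (simp add: pretensor_star_mult pretensor_star_star complex_eq_iff)
    ultimately show "Im (product_functional \<phi> \<psi> (pretensor_star x * x)) = 0 \<and>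
        0 \<le> Re (product_functional \<phi> \<psi> (pretensor_star x * x))"
      by simp
  qed (simp_all add: product_functional_add product_functional_pscale)
qed

lemma functional_family_states:
  "functional_family pscale (pretensor_star ::
     ('a :: unital_cstar_algebra, 'b :: unital_cstar_algebra) pretensor \<Rightarrow> _)
     {product_functional \<phi> \<psi> |\<phi> \<psi>. state \<phi> \<and> state \<psi>}"
proof (intro functional_family.intro star_algebra_pretensor functional_family_axioms.intro)
  fix \<Phi> :: "('a, 'b) pretensor \<Rightarrow> complex"
  assume "\<Phi> \<in> {product_functional \<phi> \<psi> |\<phi> \<psi>. state \<phi> \<and> state \<psi>}"
  then show "positive_functional pscale pretensor_star \<Phi>"
    using product_functional_positive by blast
next
  fix x :: "('a, 'b) pretensor"
  let ?F = "{product_functional \<phi> \<psi> |\<phi> \<psi>. state \<phi> \<and> state \<psi>}"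
  let ?p = "\<lambda>\<Phi> x. sqrt (Re (\<Phi> (pretensor_star x * x)))"
  show "\<exists>M. \<forall>\<Phi>\<in>?F. \<forall>s. ?p \<Phi> (x * s) \<le> M * ?p \<Phi> s"
  proof (induction x rule: pretensor_induct)
    case (single k c)
    define m where "m = norm (left_factor k) * norm (right_factor k)"
    have m0: "m \<ge> 0" by (simp add: m_def)
    define e where "e = Elementary (star (left_factor k) * left_factor k) (star (right_factor k) * right_factor k)"
    have "?p \<Phi> (Poly_Mapping.single k c * s) \<le> cmod c * m * ?p \<Phi> s" if F: "\<Phi> \<in> ?F" for \<Phi> s
    proof -
      obtain \<phi> \<psi> where st: "state \<phi>" "state \<psi>" and \<Phi>: "\<Phi> = product_functional \<phi> \<psi>"
        using F by blast
      interpret positive_functional pscale pretensor_star \<Phi>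
        unfolding \<Phi> by (rule product_functional_positive[OF st])
      obtain K where K: "\<And>a. cmod (\<phi> a) \<le> K * norm a"
        using st(1) unfolding state_def bounded_clinear_def by blast
      obtain L where L: "\<And>b. cmod (\<psi> b) \<le> L * norm b"
        using st(2) unfolding state_def bounded_clinear_def by blast
      have K': "cmod (\<phi> a) \<le> \<bar>K\<bar> * norm a" for a
        by (rule order_trans[OF K]) (simp add: mult_right_mono)
      have L': "cmod (\<psi> b) \<le> \<bar>L\<bar> * norm b" for b
        by (rule order_trans[OF L]) (simp add: mult_right_mono)
      let ?K = "Poly_Mapping.keys s" and ?l = "Poly_Mapping.lookup s"
      define w where "w i j = cmod (?l i) * cmod (?l j) *
        (\<bar>K\<bar> * norm (left_factor i) * norm (left_factor j)) * (\<bar>L\<bar> * norm (right_factor i) * norm (right_factor j))" for i j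
      have w0: "w i j \<ge> 0" for i j by (simp add: w_def)
      define h :: "('a, 'b) pretensor" where "h = Poly_Mapping.single e 1"
      have hn: "h ^ n = Poly_Mapping.single (Elementary (left_factor e ^ n) (right_factor e ^ n)) 1" for n
        by (induction n) (simp_all add: h_def mult_single plus_elementary_def flip: zero_elementary_def)
      have "cmod (\<Phi> (pretensor_star s * (h ^ n * s))) \<le> (\<Sum>i\<in>?K. \<Sum>j\<in>?K. w i j) * (m\<^sup>2) ^ n" for n
      proof -
        have e1: "norm (left_factor e ^ n) \<le> ((norm (left_factor k))\<^sup>2) ^ n"
          using norm_power_le[of "left_factor e" n] by (simp add: e_def cstar_identity)
        have e2: "norm (right_factor e ^ n) \<le> ((norm (right_factor k))\<^sup>2) ^ n"
          using norm_power_le[of "right_factor e" n] by (simp add: e_def cstar_identity)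
        have a1: "norm (\<phi> (star (left_factor i) * (left_factor e ^ n * left_factor j)))
            \<le> \<bar>K\<bar> * norm (left_factor i) * norm (left_factor j) * ((norm (left_factor k))\<^sup>2) ^ n" for i j
        proof -
          have "norm (star (left_factor i) * (left_factor e ^ n * left_factor j))
            \<le> norm (left_factor i) * (norm (left_factor e ^ n) * norm (left_factor j))"
            by (rule order_trans[OF norm_mult_ineq]) (simp add: norm_star mult_left_mono norm_mult_ineq)
          also have "\<dots> \<le> norm (left_factor i) * (((norm (left_factor k))\<^sup>2) ^ n * norm (left_factor j))"
            by (intro mult_left_mono mult_right_mono e1) simp_all
          finally have "\<bar>K\<bar> * norm (star (left_factor i) * (left_factor e ^ n * left_factor j))
            \<le> \<bar>K\<bar> * (norm (left_factor i) * (((norm (left_factor k))\<^sup>2) ^ n * norm (left_factor j)))"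
            by (rule mult_left_mono) simp
          then show ?thesis using K'[of "star (left_factor i) * (left_factor e ^ n * left_factor j)"]
            by (simp add: mult_ac)
        qed
        have a2: "norm (\<psi> (star (right_factor i) * (right_factor e ^ n * right_factor j)))
            \<le> \<bar>L\<bar> * norm (right_factor i) * norm (right_factor j) * ((norm (right_factor k))\<^sup>2) ^ n" for i j
        proof -
          have "norm (star (right_factor i) * (right_factor e ^ n * right_factor j))
            \<le> norm (right_factor i) * (norm (right_factor e ^ n) * norm (right_factor j))"
            by (rule order_trans[OF norm_mult_ineq]) (simp add: norm_star mult_left_mono norm_mult_ineq)
          also have "\<dots> \<le> norm (right_factor i) * (((norm (right_factor k))\<^sup>2) ^ n * norm (right_factor j))"
            by (intro mult_left_mono mult_right_mono e2) simp_all
          finally have "\<bar>L\<bar> * norm (star (right_factor i) * (right_factor e ^ n * right_factor j))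
            \<le> \<bar>L\<bar> * (norm (right_factor i) * (((norm (right_factor k))\<^sup>2) ^ n * norm (right_factor j)))"
            by (rule mult_left_mono) simp
          then show ?thesis using L'[of "star (right_factor i) * (right_factor e ^ n * right_factor j)"]
            by (simp add: mult_ac)
        qed
        have "cmod (\<Phi> (pretensor_star s * (h ^ n * s))) \<le> (\<Sum>i\<in>?K. \<Sum>j\<in>?K.
            cmod (?l i) * cmod (?l j) * (norm (\<phi> (star (left_factor i) * (left_factor e ^ n * left_factor j))) *
              norm (\<psi> (star (right_factor i) * (right_factor e ^ n * right_factor j)))))"
          unfolding \<Phi> hn product_functional_sandwich elementary.sel
          by (intro sum_norm_le order_trans[OF norm_sum] sum_mono) (simp add: norm_mult)
        also have "\<dots> \<le> (\<Sum>i\<in>?K. \<Sum>j\<in>?K. cmod (?l i) * cmod (?l j) *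
            ((\<bar>K\<bar> * norm (left_factor i) * norm (left_factor j) * ((norm (left_factor k))\<^sup>2) ^ n) *
             (\<bar>L\<bar> * norm (right_factor i) * norm (right_factor j) * ((norm (right_factor k))\<^sup>2) ^ n)))"
          by (intro sum_mono mult_left_mono mult_mono a1 a2) simp_all
        also have "\<dots> = (\<Sum>i\<in>?K. \<Sum>j\<in>?K. w i j) * (m\<^sup>2) ^ n"
          unfolding sum_distrib_right
          by (intro sum.cong refl) (simp add: w_def m_def power_mult_distrib mult_ac)
        finally show ?thesis .
      qed
      note bnd = this
      have sth: "pretensor_star h = h" by (simp add: h_def e_def star_mult star_star)
      have S0: "0 \<le> (\<Sum>i\<in>?K. \<Sum>j\<in>?K. w i j)" by (intro sum_nonneg w0)
      have pb: "cmod (\<Phi> (pretensor_star s * (h * s))) \<le> m\<^sup>2 * q s"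
        by (rule power_bound[OF sth S0 _ bnd]) simp
      define y where "y = Poly_Mapping.single k 1 * s"
      have "pretensor_star y * y = pretensor_star s * (h * s)"
        by (simp add: y_def h_def pretensor_star_mult e_def mult.assoc)
          (simp add: mult.assoc[symmetric] mult_single plus_elementary_def)
      then have "q y \<le> m\<^sup>2 * q s"
        using pb complex_Re_le_cmod[of "\<Phi> (pretensor_star s * (h * s))"] by simp
      then have "p y \<le> sqrt (m\<^sup>2 * q s)" by (rule real_sqrt_le_mono)
      then have py: "p y \<le> m * p s" using m0 by (simp add: real_sqrt_mult)
      have "Poly_Mapping.single k c * s = pscale c y"
        by (simp add: y_def mult.assoc[symmetric] mult_single)
      then have "p (Poly_Mapping.single k c * s) = cmod c * p y"
        by (simp only: p_sc)
      then show ?thesis using mult_left_mono[OF py, of "cmod c"] by (simp add: mult.assoc)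
    qed
    then show ?case by blast
  next
    case (add x y)
    obtain M where M: "\<And>\<Phi> s. \<Phi> \<in> ?F \<Longrightarrow> ?p \<Phi> (x * s) \<le> M * ?p \<Phi> s" using add(1) by blast
    obtain M' where M': "\<And>\<Phi> s. \<Phi> \<in> ?F \<Longrightarrow> ?p \<Phi> (y * s) \<le> M' * ?p \<Phi> s" using add(2) by blast
    have "?p \<Phi> ((x + y) * s) \<le> (M + M') * ?p \<Phi> s" if "\<Phi> \<in> ?F" for \<Phi> s
    proof -
      interpret positive_functional pscale pretensor_star \<Phi>
        using that product_functional_positive by blast
      have "?p \<Phi> ((x + y) * s) \<le> ?p \<Phi> (x * s) + ?p \<Phi> (y * s)"
        unfolding distrib_right by (rule p_triangle)
      also have "\<dots> \<le> M * ?p \<Phi> s + M' * ?p \<Phi> s"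
        by (intro add_mono M M' that)
      finally show ?thesis by (simp add: algebra_simps)
    qed
    then show ?case by blast
  qed
qed

lemmas min_seminorm_facts = functional_family_states[THEN functional_family.N_ge_0, folded min_seminorm_def]
  functional_family_states[THEN functional_family.N_triangle, folded min_seminorm_def]
  functional_family_states[THEN functional_family.N_zero, folded min_seminorm_def]
  functional_family_states[THEN functional_family.N_sc, folded min_seminorm_def]
  functional_family_states[THEN functional_family.N_minus_commute, folded min_seminorm_def]
  functional_family_states[THEN functional_family.N_diff_triangle, folded min_seminorm_def]
  functional_family_states[THEN functional_family.N_mult, folded min_seminorm_def]
  functional_family_states[THEN functional_family.N_st, folded min_seminorm_def]
  functional_family_states[THEN functional_family.N_cstar, folded min_seminorm_def]
lemmas min_seminorm_ge_0 = min_seminorm_facts(1)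
  and min_seminorm_triangle = min_seminorm_facts(2)
  and min_seminorm_zero = min_seminorm_facts(3)
  and min_seminorm_scale = min_seminorm_facts(4)
  and min_seminorm_minus_commute = min_seminorm_facts(5)
  and min_seminorm_diff = min_seminorm_facts(6)
  and min_seminorm_mult = min_seminorm_facts(7)
  and min_seminorm_star = min_seminorm_facts(8)
  and min_seminorm_cstar = min_seminorm_facts(9)

text \<open>The completion consists of Cauchy sequences modulo null sequences.\<close>

definition min_Cauchy ::
    "(nat \<Rightarrow> ('a :: unital_cstar_algebra, 'b :: unital_cstar_algebra) pretensor) \<Rightarrow> bool" where
  "min_Cauchy X \<longleftrightarrow> (\<forall>e>0. \<exists>M. \<forall>m\<ge>M. \<forall>n\<ge>M. min_seminorm (X m - X n) < e)"

definition min_equiv ::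
    "(nat \<Rightarrow> ('a :: unital_cstar_algebra, 'b :: unital_cstar_algebra) pretensor) \<Rightarrow>
     (nat \<Rightarrow> ('a, 'b) pretensor) \<Rightarrow> bool" where
  "min_equiv X Y \<longleftrightarrow>
     min_Cauchy X \<and> min_Cauchy Y \<and> (\<lambda>n. min_seminorm (X n - Y n)) \<longlonglongrightarrow> 0"

lemma min_null_le:
  assumes "f \<longlonglongrightarrow> 0" and "\<And>n. min_seminorm (X n) \<le> f n"
  shows "(\<lambda>n. min_seminorm (X n)) \<longlonglongrightarrow> 0"
  by (rule tendsto_sandwich[OF _ _ tendsto_const assms(1)]) (simp_all add: min_seminorm_ge_0 assms(2))

lemma min_Cauchy_const: "min_Cauchy (\<lambda>n. t)"
  by (simp add: min_Cauchy_def min_seminorm_zero)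

lemma min_equiv_refl: "min_equiv X X \<longleftrightarrow> min_Cauchy X"
  by (auto simp: min_equiv_def min_seminorm_zero)

lemma min_equiv_eqI: "min_Cauchy X \<Longrightarrow> (\<And>n. X n = Y n) \<Longrightarrow> min_equiv X Y"
  using min_equiv_refl[of X] by (metis ext)

lemma part_equivp_min_equiv: "part_equivp (min_equiv ::
  (nat \<Rightarrow> ('a :: unital_cstar_algebra, 'b :: unital_cstar_algebra) pretensor) \<Rightarrow> _)" (is "part_equivp ?R")
proof (rule part_equivpI)
  show "\<exists>X. ?R X X"
    using min_equiv_refl min_Cauchy_const by blast
  show "symp ?R"
    by (rule sympI) (auto simp: min_equiv_def min_seminorm_minus_commute)
  show "transp ?R"
  proof (rule transpI)
    fix X Y Z :: "nat \<Rightarrow> ('a, 'b) pretensor"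
    assume "min_equiv X Y" "min_equiv Y Z"
    then have c: "min_Cauchy X" "min_Cauchy Z"
      and l: "(\<lambda>n. min_seminorm (X n - Y n) + min_seminorm (Y n - Z n)) \<longlonglongrightarrow> 0"
      by (auto simp: min_equiv_def intro: tendsto_add_zero)
    have "(\<lambda>n. min_seminorm (X n - Z n)) \<longlonglongrightarrow> 0"
      using l min_seminorm_triangle[of "X n - Y n" "Y n - Z n" for n]
      by (intro min_null_le[where f="\<lambda>n. min_seminorm (X n - Y n) + min_seminorm (Y n - Z n)"]) simp_all
    then show "min_equiv X Z" using c by (simp add: min_equiv_def)
  qed
qed

lemma min_Cauchy_convergent:
  assumes "min_Cauchy X" shows "convergent (\<lambda>n. min_seminorm (X n))"
proof (rule Cauchy_convergent, rule metric_CauchyI)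
  fix e :: real assume "e > 0"
  then obtain M where "\<forall>m\<ge>M. \<forall>n\<ge>M. min_seminorm (X m - X n) < e"
    using assms unfolding min_Cauchy_def by blast
  then show "\<exists>M. \<forall>m\<ge>M. \<forall>n\<ge>M. dist (min_seminorm (X m)) (min_seminorm (X n)) < e"
    unfolding dist_real_def by (meson min_seminorm_diff le_less_trans)
qed

lemma min_Cauchy_bounded:
  assumes "min_Cauchy X" shows "\<exists>B>0. \<forall>n. min_seminorm (X n) \<le> B"
proof -
  obtain B where B: "B > 0" "\<And>n. norm (min_seminorm (X n)) \<le> B"
    using min_Cauchy_convergent[OF assms] convergent_imp_Bseq BseqE by metis
  then show ?thesis by (metis abs_le_D1 real_norm_def)
qed

lemma min_CauchyI_dom:
  assumes "min_Cauchy X" "min_Cauchy Y" "B > 0"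
    and "\<And>m n. min_seminorm (Z m - Z n) \<le> B * min_seminorm (X m - X n) + B * min_seminorm (Y m - Y n)"
  shows "min_Cauchy Z"
  unfolding min_Cauchy_def
proof (intro allI impI)
  fix e :: real assume e: "e > 0"
  define d where "d = e / (2 * B)"
  have d: "d > 0" using e assms(3) by (simp add: d_def)
  obtain M where M: "\<And>m n. m \<ge> M \<Longrightarrow> n \<ge> M \<Longrightarrow> min_seminorm (X m - X n) < d"
    using assms(1) d unfolding min_Cauchy_def by blast
  obtain M' where M': "\<And>m n. m \<ge> M' \<Longrightarrow> n \<ge> M' \<Longrightarrow> min_seminorm (Y m - Y n) < d"
    using assms(2) d unfolding min_Cauchy_def by blast
  have "min_seminorm (Z m - Z n) < e" if "m \<ge> max M M'" "n \<ge> max M M'" for m n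
  proof -
    have "min_seminorm (Z m - Z n) \<le> B * min_seminorm (X m - X n) + B * min_seminorm (Y m - Y n)"
      by (rule assms(4))
    also have "\<dots> < B * d + B * d"
      using M[of m n] M'[of m n] that assms(3) by (intro add_strict_mono mult_strict_left_mono) auto
    finally show ?thesis using assms(3) by (simp add: d_def)
  qed
  then show "\<exists>M. \<forall>m\<ge>M. \<forall>n\<ge>M. min_seminorm (Z m - Z n) < e" by blast
qed

lemma min_equiv_dom:
  assumes "min_equiv X X'" "min_equiv Y Y'" "min_Cauchy Z" "min_Cauchy Z'"
    and "\<And>n. min_seminorm (Z n - Z' n) \<le> B * min_seminorm (X n - X' n) + B * min_seminorm (Y n - Y' n)"
  shows "min_equiv Z Z'"
proof -
  have "(\<lambda>n. B * min_seminorm (X n - X' n) + B * min_seminorm (Y n - Y' n)) \<longlonglongrightarrow> B * 0 + B * 0"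
    using assms(1,2) unfolding min_equiv_def by (intro tendsto_intros) auto
  then show ?thesis
    unfolding min_equiv_def by (intro conjI assms min_null_le[OF _ assms(5)]) simp
qed

lemma min_seminorm_add_diff:
  "min_seminorm ((x + y) - (x' + y')) \<le> 1 * min_seminorm (x - x') + 1 * min_seminorm (y - y')"
  using min_seminorm_triangle[of "x - x'" "y - y'"] by (simp add: algebra_simps)

lemma min_seminorm_mult_diff:
  assumes "min_seminorm x' \<le> B" "min_seminorm y \<le> B"
  shows "min_seminorm (x * y - x' * y') \<le> B * min_seminorm (x - x') + B * min_seminorm (y - y')"
proof -
  have "min_seminorm (x * y - x' * y') \<le> min_seminorm ((x - x') * y) + min_seminorm (x' * (y - y'))"
    using min_seminorm_triangle[of "(x - x') * y" "x' * (y - y')"] by (simp add: algebra_simps)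
  also have "\<dots> \<le> min_seminorm (x - x') * min_seminorm y + min_seminorm x' * min_seminorm (y - y')"
    by (intro add_mono min_seminorm_mult)
  also have "\<dots> \<le> min_seminorm (x - x') * B + B * min_seminorm (y - y')"
    by (intro add_mono mult_left_mono mult_right_mono assms min_seminorm_ge_0)
  finally show ?thesis by (simp add: mult.commute)
qed

lemma min_seminorm_scale_diff:
  "min_seminorm (pscale c x - pscale c y) = cmod c * min_seminorm (x - y)"
  by (simp add: min_seminorm_scale flip: right_diff_distrib)

lemma min_seminorm_star_diff:
  "min_seminorm (pretensor_star x - pretensor_star y) = min_seminorm (x - y)"
proof -
  have "pretensor_star y + pretensor_star (x - y) = pretensor_star x"
    using pretensor_star_add[of y "x - y"] by simp
  then have "pretensor_star x - pretensor_star y = pretensor_star (x - y)"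
    by (simp add: algebra_simps)
  then show ?thesis by (simp add: min_seminorm_star)
qed

lemma min_Cauchy_add: "min_Cauchy X \<Longrightarrow> min_Cauchy Y \<Longrightarrow> min_Cauchy (\<lambda>n. X n + Y n)"
  by (rule min_CauchyI_dom[OF _ _ zero_less_one min_seminorm_add_diff])

lemma min_Cauchy_mult:
  assumes "min_Cauchy X" "min_Cauchy Y" shows "min_Cauchy (\<lambda>n. X n * Y n)"
proof -
  obtain B B' where B: "B > 0" "\<And>n. min_seminorm (X n) \<le> B" and B': "\<And>n. min_seminorm (Y n) \<le> B'"
    using assms[THEN min_Cauchy_bounded] by blast
  show ?thesis
    using B B' by (intro min_CauchyI_dom[OF assms, of "max B B'"] min_seminorm_mult_diff)
      (auto simp: less_max_iff_disj le_max_iff_disj)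
qed

lemma min_Cauchy_scale: assumes "min_Cauchy X" shows "min_Cauchy (\<lambda>n. pscale c (X n))"
proof (rule min_CauchyI_dom[OF assms assms, of "cmod c + 1"])
  fix m n
  have "cmod c * min_seminorm (X m - X n) \<le> (cmod c + 1) * min_seminorm (X m - X n)"
    "0 \<le> (cmod c + 1) * min_seminorm (X m - X n)"
    by (simp_all add: mult_right_mono min_seminorm_ge_0)
  then show "min_seminorm (pscale c (X m) - pscale c (X n))
    \<le> (cmod c + 1) * min_seminorm (X m - X n) + (cmod c + 1) * min_seminorm (X m - X n)"
    unfolding min_seminorm_scale_diff by linarith
qed (simp add: add_nonneg_pos)

lemma min_Cauchy_minus: "min_Cauchy X \<Longrightarrow> min_Cauchy (\<lambda>n. - X n)"
  unfolding min_Cauchy_def by (simp add: min_seminorm_minus_commute)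

lemma min_Cauchy_diff: "min_Cauchy X \<Longrightarrow> min_Cauchy Y \<Longrightarrow> min_Cauchy (\<lambda>n. X n - Y n)"
  using min_Cauchy_add[OF _ min_Cauchy_minus] by simp

lemma min_Cauchy_star: "min_Cauchy X \<Longrightarrow> min_Cauchy (\<lambda>n. pretensor_star (X n))"
  unfolding min_Cauchy_def by (simp add: min_seminorm_star_diff)

lifting_forget poly_mapping.lifting

quotient_type (overloaded) ('a, 'b) min_tensor (\<open>(_ \<otimes>\<^sub>m/ _)\<close> [26, 25] 25) =
    "nat \<Rightarrow> ('a :: unital_cstar_algebra, 'b :: unital_cstar_algebra) pretensor" / partial: min_equiv
  by (rule part_equivp_min_equiv)

lemma Domainp_cr_min_tensor [transfer_domain_rule]: "Domainp cr_min_tensor = min_Cauchy"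
  by (simp add: min_tensor.domain min_equiv_refl)

lift_definition of_pretensor ::
    "('a :: unital_cstar_algebra, 'b :: unital_cstar_algebra) pretensor \<Rightarrow> 'a \<otimes>\<^sub>m 'b"
  is "\<lambda>t n. t"
  by (simp add: min_equiv_refl min_Cauchy_const)

instantiation min_tensor :: (unital_cstar_algebra, unital_cstar_algebra) real_vector
begin

lift_definition zero_min_tensor :: "'a \<otimes>\<^sub>m 'b" is "\<lambda>n. 0"
  by (simp add: min_equiv_refl min_Cauchy_const)

lift_definition plus_min_tensor :: "'a \<otimes>\<^sub>m 'b \<Rightarrow> 'a \<otimes>\<^sub>m 'b \<Rightarrow> 'a \<otimes>\<^sub>m 'b"
  is "\<lambda>X Y n. X n + Y n"
  by (rule min_equiv_dom[OF _ _ _ _ min_seminorm_add_diff]) (auto simp: min_equiv_def intro: min_Cauchy_add)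

lift_definition uminus_min_tensor :: "'a \<otimes>\<^sub>m 'b \<Rightarrow> 'a \<otimes>\<^sub>m 'b" is "\<lambda>X n. - X n"
  by (auto simp: min_equiv_def min_seminorm_minus_commute intro: min_Cauchy_minus)

definition minus_min_tensor :: "'a \<otimes>\<^sub>m 'b \<Rightarrow> 'a \<otimes>\<^sub>m 'b \<Rightarrow> 'a \<otimes>\<^sub>m 'b" where
  "minus_min_tensor x y = x + - y"

lift_definition scaleR_min_tensor :: "real \<Rightarrow> 'a \<otimes>\<^sub>m 'b \<Rightarrow> 'a \<otimes>\<^sub>m 'b"
  is "\<lambda>r X n. pscale (complex_of_real r) (X n)"
proof -
  fix r and X Y :: "nat \<Rightarrow> ('a, 'b) pretensor"
  assume "min_equiv X Y"
  then have "(\<lambda>n. \<bar>r\<bar> * min_seminorm (X n - Y n)) \<longlonglongrightarrow> \<bar>r\<bar> * 0"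
    unfolding min_equiv_def by (intro tendsto_intros) auto
  then show "min_equiv (\<lambda>n. pscale (complex_of_real r) (X n)) (\<lambda>n. pscale (complex_of_real r) (Y n))"
    using \<open>min_equiv X Y\<close> by (simp add: min_equiv_def min_seminorm_scale_diff min_Cauchy_scale)
qed

instance
proof
  fix x y z :: "'a \<otimes>\<^sub>m 'b" and r s :: real
  show "x + y + z = x + (y + z)"
    by transfer (intro min_equiv_eqI min_Cauchy_add, auto simp: add.assoc)
  show "x + y = y + x"
    by transfer (intro min_equiv_eqI min_Cauchy_add, auto simp: add.commute)
  show "0 + x = x"
    by transfer (simp add: min_equiv_refl)
  show "- x + x = 0"
    by transfer (simp add: min_equiv_refl min_Cauchy_const)
  show "x - y = x + - y"
    by (simp add: minus_min_tensor_def)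
  show "r *\<^sub>R (x + y) = r *\<^sub>R x + r *\<^sub>R y"
    by transfer (intro min_equiv_eqI min_Cauchy_scale min_Cauchy_add, auto simp: distrib_left)
  show "(r + s) *\<^sub>R x = r *\<^sub>R x + s *\<^sub>R x"
    by transfer (intro min_equiv_eqI min_Cauchy_scale, auto simp: single_add distrib_right)
  show "r *\<^sub>R s *\<^sub>R x = (r * s) *\<^sub>R x"
    by transfer (intro min_equiv_eqI min_Cauchy_scale, auto simp: mult_single mult.assoc[symmetric])
  show "1 *\<^sub>R x = x"
    by transfer (simp add: min_equiv_refl)
qed

end

instantiation min_tensor :: (unital_cstar_algebra, unital_cstar_algebra) real_normed_vector
begin

lift_definition norm_min_tensor :: "'a \<otimes>\<^sub>m 'b \<Rightarrow> real" is "\<lambda>X. lim (\<lambda>n. min_seminorm (X n))"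
proof -
  fix X Y :: "nat \<Rightarrow> ('a, 'b) pretensor"
  assume XY: "min_equiv X Y"
  then have X: "(\<lambda>n. min_seminorm (X n)) \<longlonglongrightarrow> lim (\<lambda>n. min_seminorm (X n))"
    by (simp add: min_equiv_def min_Cauchy_convergent flip: convergent_LIMSEQ_iff)
  have "(\<lambda>n. min_seminorm (Y n) - min_seminorm (X n)) \<longlonglongrightarrow> 0"
  proof (rule Lim_null_comparison)
    show "\<forall>\<^sub>F n in sequentially. norm (min_seminorm (Y n) - min_seminorm (X n)) \<le> min_seminorm (X n - Y n)"
      by (intro always_eventually allI) (metis min_seminorm_diff min_seminorm_minus_commute real_norm_def)
    show "(\<lambda>n. min_seminorm (X n - Y n)) \<longlonglongrightarrow> 0" using XY by (simp add: min_equiv_def)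
  qed
  from tendsto_add[OF this X] have "(\<lambda>n. min_seminorm (Y n)) \<longlonglongrightarrow> lim (\<lambda>n. min_seminorm (X n))"
    by simp
  then show "lim (\<lambda>n. min_seminorm (X n)) = lim (\<lambda>n. min_seminorm (Y n))"
    by (rule limI[symmetric])
qed

definition dist_min_tensor :: "'a \<otimes>\<^sub>m 'b \<Rightarrow> 'a \<otimes>\<^sub>m 'b \<Rightarrow> real" where
  "dist_min_tensor x y = norm (x - y)"

definition sgn_min_tensor :: "'a \<otimes>\<^sub>m 'b \<Rightarrow> 'a \<otimes>\<^sub>m 'b" where
  "sgn_min_tensor x = x /\<^sub>R norm x"

definition uniformity_min_tensor :: "(('a \<otimes>\<^sub>m 'b) \<times> ('a \<otimes>\<^sub>m 'b)) filter" where
  "uniformity_min_tensor = (INF e\<in>{0 <..}. principal {(x, y). dist x y < e})"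

definition open_min_tensor :: "('a \<otimes>\<^sub>m 'b) set \<Rightarrow> bool" where
  "open_min_tensor U \<longleftrightarrow> (\<forall>x\<in>U. \<forall>\<^sub>F (x', y) in uniformity. x' = x \<longrightarrow> y \<in> U)"

lemma min_Cauchy_lim:
  "min_Cauchy X \<Longrightarrow> (\<lambda>n. min_seminorm (X n)) \<longlonglongrightarrow> lim (\<lambda>n. min_seminorm (X n))"
  by (simp add: min_Cauchy_convergent flip: convergent_LIMSEQ_iff)

instance
proof
  fix x y :: "'a \<otimes>\<^sub>m 'b" and r :: real
  show "dist x y = norm (x - y)" by (simp add: dist_min_tensor_def)
  show "sgn x = x /\<^sub>R norm x" by (simp add: sgn_min_tensor_def)
  show "norm (x + y) \<le> norm x + norm y"
  proof transfer
    fix X Y :: "nat \<Rightarrow> ('a, 'b) pretensor" assume "min_Cauchy X" "min_Cauchy Y"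
    then show "lim (\<lambda>n. min_seminorm (X n + Y n)) \<le> lim (\<lambda>n. min_seminorm (X n)) + lim (\<lambda>n. min_seminorm (Y n))"
      by (intro LIMSEQ_le[OF min_Cauchy_lim[OF min_Cauchy_add] tendsto_add[OF min_Cauchy_lim min_Cauchy_lim]])
        (auto intro: min_seminorm_triangle)
  qed
  show "norm (r *\<^sub>R x) = \<bar>r\<bar> * norm x"
  proof transfer
    fix r and X :: "nat \<Rightarrow> ('a, 'b) pretensor" assume "min_Cauchy X"
    from tendsto_mult_left[OF min_Cauchy_lim[OF this], of "\<bar>r\<bar>"]
    show "lim (\<lambda>n. min_seminorm (pscale (complex_of_real r) (X n))) = \<bar>r\<bar> * lim (\<lambda>n. min_seminorm (X n))"
      by (intro limI) (simp add: min_seminorm_scale)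
  qed
  show "norm x = 0 \<longleftrightarrow> x = 0"
  proof transfer
    fix X :: "nat \<Rightarrow> ('a, 'b) pretensor" assume X: "min_Cauchy X"
    then show "lim (\<lambda>n. min_seminorm (X n)) = 0 \<longleftrightarrow> min_equiv X (\<lambda>n. 0)"
      using min_Cauchy_lim[OF X] limI[of "\<lambda>n. min_seminorm (X n)" 0]
      by (auto simp: min_equiv_def min_Cauchy_const)
  qed
qed (simp_all only: uniformity_min_tensor_def open_min_tensor_def)

end

lemma norm_of_pretensor: "norm (of_pretensor t) = min_seminorm t"
  by transfer simp

lemma of_pretensor_add: "of_pretensor (s + t) = of_pretensor s + of_pretensor t"
  by transfer (simp add: min_equiv_refl min_Cauchy_const)

lemma of_pretensor_diff: "of_pretensor (s - t) = of_pretensor s - of_pretensor t"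
  using of_pretensor_add[of "s - t" t] by (simp add: algebra_simps)

lemma of_pretensor_limit:
  fixes v :: "nat \<Rightarrow> ('a :: unital_cstar_algebra, 'b :: unital_cstar_algebra) pretensor"
  assumes v: "min_Cauchy v"
  shows "\<exists>x. (\<lambda>n. of_pretensor (v n)) \<longlonglongrightarrow> x"
proof
  define x where "x = abs_min_tensor v"
  have nx: "norm (of_pretensor t - x) = lim (\<lambda>m. min_seminorm (t - v m))" for t
  proof -
    have "norm (of_pretensor t - x) = norm (of_pretensor t + - x)" by simp
    also have "\<dots> = lim (\<lambda>m. min_seminorm (t + - v m))"
      by (simp add: of_pretensor_def x_def plus_min_tensor.abs_eq uminus_min_tensor.abs_eq
          norm_min_tensor.abs_eq min_equiv_refl v min_Cauchy_const min_Cauchy_minus min_Cauchy_diff)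
    finally show ?thesis by simp
  qed
  show "(\<lambda>n. of_pretensor (v n)) \<longlonglongrightarrow> x"
  proof (rule LIMSEQ_I)
    fix e :: real assume e: "e > 0"
    then obtain M where M: "\<And>m n. m \<ge> M \<Longrightarrow> n \<ge> M \<Longrightarrow> min_seminorm (v m - v n) < e / 2"
      using v unfolding min_Cauchy_def by (meson half_gt_zero)
    have "norm (of_pretensor (v n) - x) < e" if "n \<ge> M" for n
    proof -
      have "lim (\<lambda>m. min_seminorm (v n - v m)) \<le> e / 2"
        using M[OF that] by (intro LIMSEQ_le_const2[OF min_Cauchy_lim])
          (auto intro!: min_Cauchy_diff min_Cauchy_const v exI[of _ M] intro: less_imp_le)
      then show ?thesis using e by (simp add: nx)
    qed
    then show "\<exists>no. \<forall>n\<ge>no. norm (of_pretensor (v n) - x) < e" by blast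
  qed
qed

lemma of_pretensor_dense:
  fixes x :: "'a :: unital_cstar_algebra \<otimes>\<^sub>m 'b :: unital_cstar_algebra"
  assumes e: "e > 0" shows "\<exists>t. norm (x - of_pretensor t) < e"
proof -
  have "\<exists>t. norm (x + - of_pretensor t) < e" using e
  proof transfer
    fix e :: real and X :: "nat \<Rightarrow> ('a, 'b) pretensor"
    assume X: "min_Cauchy X" and e: "0 < e"
    then obtain M where M: "\<And>m n. m \<ge> M \<Longrightarrow> n \<ge> M \<Longrightarrow> min_seminorm (X m - X n) < e / 2"
      unfolding min_Cauchy_def by (meson half_gt_zero)
    have "lim (\<lambda>n. min_seminorm (X n + - X M)) \<le> e / 2"
      using M[of _ M] by (intro LIMSEQ_le_const2[OF min_Cauchy_lim])
        (auto intro!: min_Cauchy_diff min_Cauchy_const X exI[of _ M] intro: less_imp_le)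
    then show "\<exists>t. lim (\<lambda>n. min_seminorm (X n + - t)) < e" using e by (intro exI[of _ "X M"]) simp
  qed
  then show ?thesis by simp
qed

instance min_tensor :: (unital_cstar_algebra, unital_cstar_algebra) banach
proof
  fix X :: "nat \<Rightarrow> 'a \<otimes>\<^sub>m 'b"
  assume X: "Cauchy X"
  have "\<exists>v. \<forall>n. norm (X n - of_pretensor (v n)) < 1 / real (Suc n)"
    by (intro choice allI of_pretensor_dense) simp
  then obtain v where v: "\<And>n. norm (X n - of_pretensor (v n)) < 1 / real (Suc n)" by blast
  have lim0: "(\<lambda>n. X n - of_pretensor (v n)) \<longlonglongrightarrow> 0"
    by (rule Lim_null_comparison[OF _ LIMSEQ_inverse_real_of_nat])
      (use v in \<open>auto intro!: always_eventually less_imp_le simp: inverse_eq_divide\<close>)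
  have "Cauchy (\<lambda>n. of_pretensor (v n))"
  proof (rule metric_CauchyI)
    fix e :: real assume e: "e > 0"
    obtain M where M: "\<And>n. n \<ge> M \<Longrightarrow> norm (X n - of_pretensor (v n)) < e / 3"
      using LIMSEQ_D[OF lim0, of "e / 3"] e by auto
    obtain M' where M': "\<And>m n. m \<ge> M' \<Longrightarrow> n \<ge> M' \<Longrightarrow> norm (X m - X n) < e / 3"
      using CauchyD[OF X, of "e / 3"] e by auto
    have "dist (of_pretensor (v m)) (of_pretensor (v n)) < e" if "m \<ge> max M M'" "n \<ge> max M M'" for m n
    proof -
      have "of_pretensor (v m) - of_pretensor (v n) =
          (X m - X n) - (X m - of_pretensor (v m)) + (X n - of_pretensor (v n))" by simp
      also have "norm \<dots> \<le> norm (X m - X n) + norm (X m - of_pretensor (v m)) + norm (X n - of_pretensor (v n))"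
        by (meson add_right_mono norm_triangle_ineq norm_triangle_ineq4 order_trans)
      also have "\<dots> < e" using M[of m] M[of n] M'[of m n] that by simp
      finally show ?thesis by (simp add: dist_norm)
    qed
    then show "\<exists>M. \<forall>m\<ge>M. \<forall>n\<ge>M. dist (of_pretensor (v m)) (of_pretensor (v n)) < e" by blast
  qed
  then have "min_Cauchy v"
    unfolding Cauchy_def min_Cauchy_def dist_norm
    by (simp add: norm_of_pretensor flip: of_pretensor_diff)
  then obtain x where "(\<lambda>n. of_pretensor (v n)) \<longlonglongrightarrow> x" using of_pretensor_limit by blast
  from tendsto_add[OF lim0 this] show "convergent X" by (auto simp: convergent_def)
qed

instantiation min_tensor :: (unital_cstar_algebra, unital_cstar_algebra) unital_cstar_algebra
begin

lift_definition one_min_tensor :: "'a \<otimes>\<^sub>m 'b" is "\<lambda>n. 1"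
  by (simp add: min_equiv_refl min_Cauchy_const)

lift_definition times_min_tensor :: "'a \<otimes>\<^sub>m 'b \<Rightarrow> 'a \<otimes>\<^sub>m 'b \<Rightarrow> 'a \<otimes>\<^sub>m 'b"
  is "\<lambda>X Y n. X n * Y n"
proof -
  fix X X' Y Y' :: "nat \<Rightarrow> ('a, 'b) pretensor"
  assume X: "min_equiv X X'" and Y: "min_equiv Y Y'"
  then have c: "min_Cauchy X" "min_Cauchy X'" "min_Cauchy Y" "min_Cauchy Y'"
    by (simp_all add: min_equiv_def)
  obtain B B' where B: "\<And>n. min_seminorm (X' n) \<le> B" and B': "\<And>n. min_seminorm (Y n) \<le> B'"
    using c(2,3)[THEN min_Cauchy_bounded] by blast
  show "min_equiv (\<lambda>n. X n * Y n) (\<lambda>n. X' n * Y' n)"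
    using B B' by (intro min_equiv_dom[OF X Y, of _ _ "max B B'"] min_Cauchy_mult c min_seminorm_mult_diff)
      (auto simp: le_max_iff_disj)
qed

lift_definition scaleC_min_tensor :: "complex \<Rightarrow> 'a \<otimes>\<^sub>m 'b \<Rightarrow> 'a \<otimes>\<^sub>m 'b"
  is "\<lambda>c X n. pscale c (X n)"
proof -
  fix c and X Y :: "nat \<Rightarrow> ('a, 'b) pretensor"
  assume "min_equiv X Y"
  then have "(\<lambda>n. cmod c * min_seminorm (X n - Y n)) \<longlonglongrightarrow> cmod c * 0"
    unfolding min_equiv_def by (intro tendsto_intros) auto
  then show "min_equiv (\<lambda>n. pscale c (X n)) (\<lambda>n. pscale c (Y n))"
    using \<open>min_equiv X Y\<close> by (simp add: min_equiv_def min_seminorm_scale_diff min_Cauchy_scale)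
qed

lift_definition star_min_tensor :: "'a \<otimes>\<^sub>m 'b \<Rightarrow> 'a \<otimes>\<^sub>m 'b" is "\<lambda>X n. pretensor_star (X n)"
  by (auto simp: min_equiv_def min_seminorm_star_diff intro: min_Cauchy_star)

instance
proof
  interpret star_algebra pscale "pretensor_star :: ('a, 'b) pretensor \<Rightarrow> _"
    by (rule star_algebra_pretensor)
  note cauchy = min_Cauchy_mult min_Cauchy_add min_Cauchy_scale min_Cauchy_star
  fix x y z :: "'a \<otimes>\<^sub>m 'b" and r :: real and c d :: complex
  show "x * y * z = x * (y * z)"
    by transfer (intro min_equiv_eqI cauchy, auto simp: mult.assoc)
  show "1 * x = x" by transfer (simp add: min_equiv_refl)
  show "x * 1 = x" by transfer (simp add: min_equiv_refl)
  show "(x + y) * z = x * z + y * z"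
    by transfer (intro min_equiv_eqI cauchy, auto simp: distrib_right)
  show "x * (y + z) = x * y + x * z"
    by transfer (intro min_equiv_eqI cauchy, auto simp: distrib_left)
  show "r *\<^sub>R x * y = r *\<^sub>R (x * y)"
    by transfer (intro min_equiv_eqI cauchy, auto simp: mult.assoc)
  show "x * r *\<^sub>R y = r *\<^sub>R (x * y)"
    by transfer (intro min_equiv_eqI cauchy, auto simp: mult_sc_right)
  show "c *\<^sub>C (x + y) = c *\<^sub>C x + c *\<^sub>C y"
    by transfer (intro min_equiv_eqI cauchy, auto simp: sc_add_right)
  show "(c + d) *\<^sub>C x = c *\<^sub>C x + d *\<^sub>C x"
    by transfer (intro min_equiv_eqI cauchy, auto simp: sc_add_left)
  show "c *\<^sub>C d *\<^sub>C x = (c * d) *\<^sub>C x"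
    by transfer (intro min_equiv_eqI cauchy, auto simp: sc_sc)
  show "r *\<^sub>R x = complex_of_real r *\<^sub>C x"
    by transfer (intro min_equiv_eqI cauchy, auto)
  show "c *\<^sub>C x * y = c *\<^sub>C (x * y)"
    by transfer (intro min_equiv_eqI cauchy, auto simp: mult.assoc)
  show "x * c *\<^sub>C y = c *\<^sub>C (x * y)"
    by transfer (intro min_equiv_eqI cauchy, auto simp: mult_sc_right)
  show "star (star x) = x"
    by transfer (intro min_equiv_eqI cauchy, auto simp: st_st)
  show "star (x + y) = star x + star y"
    by transfer (intro min_equiv_eqI cauchy, auto simp: st_add)
  show "star (c *\<^sub>C x) = cnj c *\<^sub>C star x"
    by transfer (intro min_equiv_eqI cauchy, auto simp: st_sc)
  show "star (x * y) = star y * star x"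
    by transfer (intro min_equiv_eqI cauchy, auto simp: st_mult)
  show "norm (x * y) \<le> norm x * norm y"
  proof transfer
    fix X Y :: "nat \<Rightarrow> ('a, 'b) pretensor" assume "min_Cauchy X" "min_Cauchy Y"
    then show "lim (\<lambda>n. min_seminorm (X n * Y n)) \<le> lim (\<lambda>n. min_seminorm (X n)) * lim (\<lambda>n. min_seminorm (Y n))"
      by (intro LIMSEQ_le[OF min_Cauchy_lim[OF min_Cauchy_mult] tendsto_mult[OF min_Cauchy_lim min_Cauchy_lim]])
        (auto intro: min_seminorm_mult)
  qed
  show "norm (c *\<^sub>C x) = cmod c * norm x"
  proof transfer
    fix c and X :: "nat \<Rightarrow> ('a, 'b) pretensor" assume "min_Cauchy X"
    from tendsto_mult_left[OF min_Cauchy_lim[OF this], of "cmod c"]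
    show "lim (\<lambda>n. min_seminorm (pscale c (X n))) = cmod c * lim (\<lambda>n. min_seminorm (X n))"
      by (intro limI) (simp add: min_seminorm_scale)
  qed
  show "norm (star x * x) = (norm x)\<^sup>2"
  proof transfer
    fix X :: "nat \<Rightarrow> ('a, 'b) pretensor" assume "min_Cauchy X"
    from tendsto_power[OF min_Cauchy_lim[OF this], of 2]
    show "lim (\<lambda>n. min_seminorm (pretensor_star (X n) * X n)) = (lim (\<lambda>n. min_seminorm (X n)))\<^sup>2"
      by (intro limI) (simp add: min_seminorm_cstar)
  qed
qed

end

definition tens :: "'a :: unital_cstar_algebra \<Rightarrow> 'b :: unital_cstar_algebra \<Rightarrow> 'a \<otimes>\<^sub>m 'b"
    (infixr \<open>\<otimes>\<^sub>m\<close> 76) where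
  "a \<otimes>\<^sub>m b = of_pretensor (Poly_Mapping.single (Elementary a b) 1)"

lemma elementary_zero_sel [simp]:
  "left_factor (0 :: ('a :: monoid_mult, 'b :: monoid_mult) elementary) = 1"
  "right_factor (0 :: ('a :: monoid_mult, 'b :: monoid_mult) elementary) = 1"
  by (simp_all add: zero_elementary_def)

lemma of_pretensor_mult: "of_pretensor (s * t) = of_pretensor s * of_pretensor t"
  by transfer (simp add: min_equiv_refl min_Cauchy_const)

lemma of_pretensor_pscale: "of_pretensor (pscale c t) = c *\<^sub>C of_pretensor t"
  by transfer (simp add: min_equiv_refl min_Cauchy_const)

lemma of_pretensor_star: "of_pretensor (pretensor_star t) = star (of_pretensor t)"
  by transfer (simp add: min_equiv_refl min_Cauchy_const)

lemma tens_mult: "(a \<otimes>\<^sub>m b) * (c \<otimes>\<^sub>m d) = (a * c) \<otimes>\<^sub>m (b * d)"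
  by (simp add: tens_def mult_single plus_elementary_def flip: of_pretensor_mult)

lemma tens_star: "star (a \<otimes>\<^sub>m b) = star a \<otimes>\<^sub>m star b"
  by (simp add: tens_def flip: of_pretensor_star)

lemma tens_one: "1 \<otimes>\<^sub>m 1 = 1"
proof -
  have "of_pretensor 1 = (1 :: 'a \<otimes>\<^sub>m 'b)"
    by transfer (simp add: min_equiv_refl min_Cauchy_const)
  then show ?thesis by (simp add: tens_def flip: zero_elementary_def)
qed

text \<open>The bilinearity relations hold in the completion.\<close>

lemma of_pretensor_eq_0I:
  fixes z :: "('a :: unital_cstar_algebra, 'b :: unital_cstar_algebra) pretensor"
  assumes "\<And>\<phi> \<psi> k l. clinear \<phi> \<Longrightarrow> clinear \<psi> \<Longrightarrow>
    product_functional \<phi> \<psi> (Poly_Mapping.single k 1 * z * Poly_Mapping.single l 1) = 0"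
  shows "of_pretensor z = 0"
proof -
  have *: "product_functional \<phi> \<psi> (u * z * v) = 0" if "clinear \<phi>" "clinear \<psi>"
    for \<phi> :: "'a \<Rightarrow> complex" and \<psi> :: "'b \<Rightarrow> complex" and u v
  proof (induction u rule: pretensor_induct)
    case (single k c)
    show ?case
    proof (induction v rule: pretensor_induct)
      case (single l d)
      have "Poly_Mapping.single k c * z * Poly_Mapping.single l d =
          pscale c (pscale d (Poly_Mapping.single k 1 * z * Poly_Mapping.single l 1))"
      proof -
        have "Poly_Mapping.single l d = Poly_Mapping.single l 1 * Poly_Mapping.single 0 d"
          "Poly_Mapping.single k c = Poly_Mapping.single 0 c * Poly_Mapping.single k 1"
          by (simp_all add: mult_single)
        then have "Poly_Mapping.single k c * z * Poly_Mapping.single l d =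
          Poly_Mapping.single 0 c *
            ((Poly_Mapping.single k 1 * z * Poly_Mapping.single l 1) * Poly_Mapping.single 0 d)"
          by (simp only: mult.assoc)
        then show ?thesis by (simp only: pscale_commute)
      qed
      then show ?case using assms[OF that] by (simp add: product_functional_pscale)
    qed (simp add: distrib_left product_functional_add)
  qed (simp add: distrib_right product_functional_add)
  have "min_seminorm z = 0"
    unfolding min_seminorm_def
  proof (rule functional_family.N_eq_0I[OF functional_family_states])
    fix \<Phi> :: "('a, 'b) pretensor \<Rightarrow> complex" and s
    assume "\<Phi> \<in> {product_functional \<phi> \<psi> |\<phi> \<psi>. state \<phi> \<and> state \<psi>}"
    then obtain \<phi> \<psi> where "state \<phi>" "state \<psi>" "\<Phi> = product_functional \<phi> \<psi>" by blast
    then show "\<Phi> (pretensor_star (z * s) * (z * s)) = 0"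
      using *[of \<phi> \<psi> "pretensor_star (z * s)" s]
      by (simp add: state_def bounded_clinear_def mult.assoc)
  qed
  then show ?thesis by (simp flip: norm_of_pretensor)
qed

lemma of_pretensor_eqI:
  fixes s t :: "('a :: unital_cstar_algebra, 'b :: unital_cstar_algebra) pretensor"
  assumes "\<And>\<phi> \<psi> k l. clinear \<phi> \<Longrightarrow> clinear \<psi> \<Longrightarrow>
    product_functional \<phi> \<psi> (Poly_Mapping.single k 1 * s * Poly_Mapping.single l 1) =
    product_functional \<phi> \<psi> (Poly_Mapping.single k 1 * t * Poly_Mapping.single l 1)"
  shows "of_pretensor s = of_pretensor t"
proof -
  have "of_pretensor (s - t) = 0"
  proof (rule of_pretensor_eq_0I)
    fix \<phi> :: "'a \<Rightarrow> complex" and \<psi> :: "'b \<Rightarrow> complex" and k l :: "('a, 'b) elementary"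
    assume lin: "clinear \<phi>" "clinear \<psi>"
    let ?u = "Poly_Mapping.single k 1 :: ('a, 'b) pretensor" and ?v = "Poly_Mapping.single l 1 :: ('a, 'b) pretensor"
    have "product_functional \<phi> \<psi> (?u * (s - t) * ?v) + product_functional \<phi> \<psi> (?u * t * ?v)
        = product_functional \<phi> \<psi> (?u * s * ?v)"
      by (simp add: algebra_simps flip: product_functional_add)
    then show "product_functional \<phi> \<psi> (?u * (s - t) * ?v) = 0" using assms[OF lin] by simp
  qed
  then show ?thesis by (simp add: of_pretensor_diff)
qed

lemma tens_add_left: "(a + a') \<otimes>\<^sub>m b = a \<otimes>\<^sub>m b + a' \<otimes>\<^sub>m b"
  unfolding tens_def of_pretensor_add[symmetric]
  by (rule of_pretensor_eqI)
    (simp add: distrib_left distrib_right mult_single plus_elementary_def product_functional_add clinear_add)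

lemma tens_add_right: "a \<otimes>\<^sub>m (b + b') = a \<otimes>\<^sub>m b + a \<otimes>\<^sub>m b'"
  unfolding tens_def of_pretensor_add[symmetric]
  by (rule of_pretensor_eqI)
    (simp add: distrib_left distrib_right mult_single plus_elementary_def product_functional_add clinear_add)

lemma tens_scaleC_left: "(c *\<^sub>C a) \<otimes>\<^sub>m b = c *\<^sub>C (a \<otimes>\<^sub>m b)"
  unfolding tens_def of_pretensor_pscale[symmetric]
  by (rule of_pretensor_eqI)
    (simp add: mult_single plus_elementary_def clinear_scaleC mult_scaleC_left mult_scaleC_right scaleC_complex_def)

lemma tens_scaleC_right: "a \<otimes>\<^sub>m (c *\<^sub>C b) = c *\<^sub>C (a \<otimes>\<^sub>m b)"
  unfolding tens_def of_pretensor_pscale[symmetric]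
  by (rule of_pretensor_eqI)
    (simp add: mult_single plus_elementary_def clinear_scaleC mult_scaleC_left mult_scaleC_right scaleC_complex_def)

lemma of_pretensor_in_cspan: "of_pretensor t \<in> cspan {a \<otimes>\<^sub>m b |a b. True}"
proof (induction t rule: pretensor_induct)
  case (single k c)
  have "Poly_Mapping.single k c = pscale c (Poly_Mapping.single (Elementary (left_factor k) (right_factor k)) 1)"
    by (simp add: mult_single)
  then have "of_pretensor (Poly_Mapping.single k c) = c *\<^sub>C (left_factor k \<otimes>\<^sub>m right_factor k)"
    unfolding tens_def by (simp only: of_pretensor_pscale)
  moreover have "left_factor k \<otimes>\<^sub>m right_factor k \<in> {a \<otimes>\<^sub>m b |a b. True}" by blast
  ultimately show ?case by (simp only: cvec.span_scale[OF cvec.span_base])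
qed (simp add: of_pretensor_add cvec.span_add)

lemma elementary_tensors_dense:
  "closure (cspan {a \<otimes>\<^sub>m b |a b. True}) = (UNIV :: ('a :: unital_cstar_algebra \<otimes>\<^sub>m 'b :: unital_cstar_algebra) set)"
proof (intro equalityI subsetI UNIV_I)
  fix x :: "'a \<otimes>\<^sub>m 'b"
  show "x \<in> closure (cspan {a \<otimes>\<^sub>m b |a b. True})"
    unfolding closure_approachable dist_norm
    by (metis of_pretensor_dense of_pretensor_in_cspan norm_minus_commute)
qed

lemma bounded_clinear_tensor_eqI:
  fixes f g :: "'a :: unital_cstar_algebra \<otimes>\<^sub>m 'b :: unital_cstar_algebra \<Rightarrow> 'c :: unital_cstar_algebra"
  assumes f: "bounded_clinear f" and g: "bounded_clinear g"
    and eq: "\<And>a b. f (a \<otimes>\<^sub>m b) = g (a \<otimes>\<^sub>m b)"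
  shows "f = g"
proof -
  have bl: "bounded_linear h" if h: "bounded_clinear h" for h :: "'a \<otimes>\<^sub>m 'b \<Rightarrow> 'c"
  proof -
    obtain K where "clinear h" "\<forall>x. norm (h x) \<le> K * norm x"
      using h unfolding bounded_clinear_def by blast
    then show ?thesis
      by (intro bounded_linear_intro[where K=K])
        (simp_all add: clinear_add clinear_scaleC scaleR_scaleC mult.commute)
  qed
  have lin: "clinear f" "clinear g" using f g by (simp_all add: bounded_clinear_def)
  have "f x = g x" if "x \<in> cspan {a \<otimes>\<^sub>m b |a b. True}" for x
    using that
  proof (induction rule: cvec.span_induct_alt)
    case base
    show ?case using clinear_scaleC[OF lin(1), of 0 0] clinear_scaleC[OF lin(2), of 0 0] by simp
  next
    case (step c y z)
    then show ?case using eq by (auto simp: clinear_add[OF lin(1)] clinear_add[OF lin(2)]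
          clinear_scaleC[OF lin(1)] clinear_scaleC[OF lin(2)])
  qed
  then have "cspan {a \<otimes>\<^sub>m b |a b. True} \<subseteq> {x. f x = g x}" by blast
  moreover have "closed {x. f x = g x}"
    by (rule closed_Collect_eq[OF bounded_linear.continuous_on[OF bl[OF f] continuous_on_id] bounded_linear.continuous_on[OF bl[OF g] continuous_on_id]])
  ultimately have "closure (cspan {a \<otimes>\<^sub>m b |a b. True}) \<subseteq> {x. f x = g x}"
    by (rule closure_minimal)
  then show ?thesis unfolding elementary_tensors_dense by blast
qed

text \<open>The bounded extension of a bilinear map to the completion. It is unique by
  \<open>bounded_clinear_tensor_eqI\<close>. It is applied below to \<open>f \<otimes> g\<close> for *-homomorphisms, to slices and to
  products of states, where it is a standard fact that it exists for the minimal norm. The same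
  holds for the associativity isomorphism \<open>tensor_assoc\<close>.\<close>

definition tensor_extension ::
    "('a :: unital_cstar_algebra \<Rightarrow> 'b :: unital_cstar_algebra \<Rightarrow> 'c :: unital_cstar_algebra) \<Rightarrow>
     'a \<otimes>\<^sub>m 'b \<Rightarrow> 'c" where
  "tensor_extension \<beta> = (THE h. bounded_clinear h \<and> (\<forall>a b. h (a \<otimes>\<^sub>m b) = \<beta> a b))"

lemma tensor_extension_eqI:
  assumes "bounded_clinear h" and "\<And>a b. h (a \<otimes>\<^sub>m b) = \<beta> a b"
  shows "tensor_extension \<beta> = h"
  unfolding tensor_extension_def
  by (rule the_equality) (auto intro: bounded_clinear_tensor_eqI simp: assms)

definition tensor_map ::
    "('a :: unital_cstar_algebra \<Rightarrow> 'c :: unital_cstar_algebra) \<Rightarrow>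
     ('b :: unital_cstar_algebra \<Rightarrow> 'd :: unital_cstar_algebra) \<Rightarrow> 'a \<otimes>\<^sub>m 'b \<Rightarrow> 'c \<otimes>\<^sub>m 'd" where
  "tensor_map f g = tensor_extension (\<lambda>a b. f a \<otimes>\<^sub>m g b)"

definition tensor_assoc ::
    "('a :: unital_cstar_algebra \<otimes>\<^sub>m 'b :: unital_cstar_algebra) \<otimes>\<^sub>m 'c :: unital_cstar_algebra \<Rightarrow>
     'a \<otimes>\<^sub>m 'b \<otimes>\<^sub>m 'c" where
  "tensor_assoc = (THE h. bounded_clinear h \<and>
     (\<forall>a b c. h ((a \<otimes>\<^sub>m b) \<otimes>\<^sub>m c) = a \<otimes>\<^sub>m b \<otimes>\<^sub>m c))"

text \<open>The slice map \<open>\<phi> \<otimes> id\<close> and the product \<open>\<phi> \<otimes> \<psi>\<close> of functionals.\<close>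

definition slice ::
    "('a :: unital_cstar_algebra \<Rightarrow> complex) \<Rightarrow> 'a \<otimes>\<^sub>m 'b :: unital_cstar_algebra \<Rightarrow> 'b" where
  "slice \<phi> = tensor_extension (\<lambda>a b. \<phi> a *\<^sub>C b)"

definition tensor_functional ::
    "('a :: unital_cstar_algebra \<Rightarrow> complex) \<Rightarrow> ('b :: unital_cstar_algebra \<Rightarrow> complex) \<Rightarrow>
     'a \<otimes>\<^sub>m 'b \<Rightarrow> complex" where
  "tensor_functional \<phi> \<psi> = tensor_extension (\<lambda>a b. \<phi> a * \<psi> b)"

section \<open>Compact quantum groups\<close>

definition unital_star_hom ::
    "('a :: unital_cstar_algebra \<Rightarrow> 'b :: unital_cstar_algebra) \<Rightarrow> bool" where
  "unital_star_hom f \<longleftrightarrow> clinear f \<and> f 1 = 1 \<and>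
     (\<forall>a b. f (a * b) = f a * f b) \<and> (\<forall>a. f (star a) = star (f a))"

definition star_subalgebra :: "'a :: unital_cstar_algebra set \<Rightarrow> bool" where
  "star_subalgebra B \<longleftrightarrow> csubspace B \<and> (\<forall>a\<in>B. \<forall>b\<in>B. a * b \<in> B) \<and> (\<forall>a\<in>B. star a \<in> B)"

definition cstar_generated :: "'a :: unital_cstar_algebra set \<Rightarrow> 'a set" where
  "cstar_generated S = \<Inter>{B. star_subalgebra B \<and> closed B \<and> S \<subseteq> B}"

definition compact_quantum_group ::
    "('q :: unital_cstar_algebra \<Rightarrow> 'q \<otimes>\<^sub>m 'q) \<Rightarrow> bool" where
  "compact_quantum_group \<Delta> \<longleftrightarrow> unital_star_hom \<Delta> \<and>
     (\<forall>a. tensor_assoc (tensor_map \<Delta> id (\<Delta> a)) = tensor_map id \<Delta> (\<Delta> a)) \<and>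
     closure (cspan {\<Delta> a * (b \<otimes>\<^sub>m 1) |a b. True}) = UNIV \<and>
     closure (cspan {\<Delta> a * (1 \<otimes>\<^sub>m b) |a b. True}) = UNIV"

text \<open>Since \<open>Q\<^sub>0 \<odot> Q\<^sub>0\<close> embeds in \<open>Q \<otimes>\<^sub>m Q\<close>, the identities for the counit \<open>\<epsilon>\<close> and the antipode \<open>\<kappa>\<close>, such
  as \<open>m (\<kappa> \<otimes> id) \<Delta> = \<epsilon> 1\<close>, are stated by evaluating on an expression of \<open>\<Delta> a\<close> as a finite sum
  of elementary tensors from \<open>Q\<^sub>0\<close>; the values do not depend on the expression. Coassociativity and
  compatibility with the involution are inherited from \<open>\<Delta>\<close>. Only the values of \<open>\<epsilon>\<close> and \<open>\<kappa>\<close> on \<open>Q\<^sub>0\<close>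
  matter.\<close>

definition dense_hopf_star_subalgebra ::
    "('q :: unital_cstar_algebra \<Rightarrow> 'q \<otimes>\<^sub>m 'q) \<Rightarrow> 'q set \<Rightarrow> ('q \<Rightarrow> complex) \<Rightarrow> ('q \<Rightarrow> 'q) \<Rightarrow> bool" where
  "dense_hopf_star_subalgebra \<Delta> Q\<^sub>0 \<epsilon> \<kappa> \<longleftrightarrow>
     star_subalgebra Q\<^sub>0 \<and> 1 \<in> Q\<^sub>0 \<and> closure Q\<^sub>0 = UNIV \<and>
     (\<forall>a\<in>Q\<^sub>0. \<Delta> a \<in> cspan {b \<otimes>\<^sub>m c |b c. b \<in> Q\<^sub>0 \<and> c \<in> Q\<^sub>0}) \<and>
     \<epsilon> 1 = 1 \<and>
     (\<forall>a\<in>Q\<^sub>0. \<forall>b\<in>Q\<^sub>0. \<epsilon> (a + b) = \<epsilon> a + \<epsilon> b \<and> \<epsilon> (a * b) = \<epsilon> a * \<epsilon> b) \<and>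
     (\<forall>a\<in>Q\<^sub>0. \<forall>c. \<epsilon> (c *\<^sub>C a) = c * \<epsilon> a) \<and>
     (\<forall>a\<in>Q\<^sub>0. \<kappa> a \<in> Q\<^sub>0) \<and>
     (\<forall>a\<in>Q\<^sub>0. \<forall>b\<in>Q\<^sub>0. \<kappa> (a + b) = \<kappa> a + \<kappa> b) \<and>
     (\<forall>a\<in>Q\<^sub>0. \<forall>c. \<kappa> (c *\<^sub>C a) = c *\<^sub>C \<kappa> a) \<and>
     (\<forall>a\<in>Q\<^sub>0. \<forall>n :: nat. \<forall>b c. (\<forall>i<n. b i \<in> Q\<^sub>0 \<and> c i \<in> Q\<^sub>0) \<and> \<Delta> a = (\<Sum>i<n. b i \<otimes>\<^sub>m c i) \<longrightarrow>
        (\<Sum>i<n. \<epsilon> (b i) *\<^sub>C c i) = a \<and>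
        (\<Sum>i<n. \<epsilon> (c i) *\<^sub>C b i) = a \<and>
        (\<Sum>i<n. \<kappa> (b i) * c i) = \<epsilon> a *\<^sub>C 1 \<and>
        (\<Sum>i<n. b i * \<kappa> (c i)) = \<epsilon> a *\<^sub>C 1)"

text \<open>The bounded extension of the antipode to the whole of \<open>Q\<close>. As the dense Hopf *-subalgebra and its
  antipode are unique, there is at most one such \<open>\<kappa>\<close>.\<close>

definition bounded_antipode ::
    "('q :: unital_cstar_algebra \<Rightarrow> 'q \<otimes>\<^sub>m 'q) \<Rightarrow> ('q \<Rightarrow> 'q) \<Rightarrow> bool" where
  "bounded_antipode \<Delta> \<kappa> \<longleftrightarrow>
     bounded_clinear \<kappa> \<and> (\<exists>Q\<^sub>0 \<epsilon>. dense_hopf_star_subalgebra \<Delta> Q\<^sub>0 \<epsilon> \<kappa>)"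

section \<open>Actions\<close>

definition cqg_action ::
    "('q :: unital_cstar_algebra \<Rightarrow> 'q \<otimes>\<^sub>m 'q) \<Rightarrow> ('c :: unital_cstar_algebra \<Rightarrow> 'c \<otimes>\<^sub>m 'q) \<Rightarrow> bool" where
  "cqg_action \<Delta> \<alpha> \<longleftrightarrow> unital_star_hom \<alpha> \<and>
     (\<forall>x. tensor_assoc (tensor_map \<alpha> id (\<alpha> x)) = tensor_map id \<Delta> (\<alpha> x)) \<and>
     closure (cspan {\<alpha> x * (1 \<otimes>\<^sub>m q) |x q. True}) = UNIV"

definition faithful_action ::
    "('c :: unital_cstar_algebra \<Rightarrow> 'c \<otimes>\<^sub>m 'q :: unital_cstar_algebra) \<Rightarrow> bool" where
  "faithful_action \<alpha> \<longleftrightarrow> cstar_generated {slice \<phi> (\<alpha> x) |\<phi> x. state \<phi>} = UNIV"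

text \<open>The value at \<open>y\<close> of an element of \<open>C(X) \<otimes> Q\<close> regarded as a continuous function \<open>X \<rightarrow> Q\<close>.\<close>

definition point_value ::
    "('x :: metric_space \<Rightarrow>\<^sub>C complex) \<otimes>\<^sub>m 'q :: unital_cstar_algebra \<Rightarrow> 'x \<Rightarrow> 'q" where
  "point_value t y = slice (\<lambda>f. apply_bcontfun f y) t"

text \<open>Used for compact \<open>X\<close> only: \<open>Bcontfun\<close> is meaningful on bounded functions.\<close>

definition dist_function :: "'x :: metric_space \<Rightarrow> 'x \<Rightarrow>\<^sub>C complex" where
  "dist_function x = Bcontfun (\<lambda>y. complex_of_real (dist x y))"

definition isometric_action ::
    "('q :: unital_cstar_algebra \<Rightarrow> 'q \<otimes>\<^sub>m 'q) \<Rightarrow> ('q \<Rightarrow> 'q) \<Rightarrow>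
     (('x :: metric_space \<Rightarrow>\<^sub>C complex) \<Rightarrow> ('x \<Rightarrow>\<^sub>C complex) \<otimes>\<^sub>m 'q) \<Rightarrow> bool" where
  "isometric_action \<Delta> \<kappa> \<alpha> \<longleftrightarrow> cqg_action \<Delta> \<alpha> \<and> faithful_action \<alpha> \<and>
     (\<forall>x y. point_value (\<alpha> (dist_function x)) y = \<kappa> (point_value (\<alpha> (dist_function y)) x))"

text \<open>The functional \<open>m \<triangleleft> \<phi> = (m \<otimes> \<phi>) \<circ> \<alpha>\<close>.\<close>

definition convolve ::
    "('c :: unital_cstar_algebra \<Rightarrow> 'c \<otimes>\<^sub>m 'q :: unital_cstar_algebra) \<Rightarrow>
     ('c \<Rightarrow> complex) \<Rightarrow> ('q \<Rightarrow> complex) \<Rightarrow> 'c \<Rightarrow> complex" where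
  "convolve \<alpha> m \<phi> = tensor_functional m \<phi> \<circ> \<alpha>"

definition measure_functional :: "'x :: metric_space measure \<Rightarrow> ('x \<Rightarrow>\<^sub>C complex) \<Rightarrow> complex" where
  "measure_functional \<mu> f = (LINT x|\<mu>. apply_bcontfun f x)"

text \<open>Balls are closed here. For finite measures open balls give the same notion: open balls are
  increasing unions, and closed balls decreasing intersections, of balls of the other kind.\<close>

definition uniformly_distributed :: "'x :: metric_space measure \<Rightarrow> bool" where
  "uniformly_distributed \<mu> \<longleftrightarrow> sets \<mu> = sets borel \<and>
     (\<forall>x y r. r \<ge> 0 \<longrightarrow> emeasure \<mu> (cball x r) = emeasure \<mu> (cball y r))"

end

theory Submission
  imports Defs
begin

text \<open>For \<open>D \<ge> diam X\<close> put \<open>K\<^sub>n(x) = (1 - d\<^sub>x/D)\<^sup>n\<close>. As \<open>\<alpha>\<close> is multiplicative and \<open>\<kappa>\<close> antimultiplicative, the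
  isometry condition extends from \<open>d\<^sub>x\<close> to \<open>\<alpha>(K\<^sub>n(x))(y) = \<kappa>(\<alpha>(K\<^sub>n(y))(x))\<close>. Integrating over \<open>y\<close>, and using
  that \<open>\<integral> K\<^sub>n(y) d\<mu>(y)\<close> is a constant function because \<open>\<mu>\<close> is uniformly distributed, one finds that
  \<open>\<nu> = \<mu> \<triangleleft> \<phi>\<close> and \<open>\<mu>\<close> agree on all \<open>K\<^sub>n(x)\<close>. Christensen's uniqueness argument for uniformly
  distributed measures then gives \<open>\<nu> = \<mu>\<close>. It needs neither a measure representing \<open>\<nu>\<close> nor the
  Stone--Weierstrass theorem.

  Boundedness of slice maps and of products of homomorphisms on the minimal tensor product rests on
  the fact that states determine the norm of a C*-algebra up to a factor; a homomorphism that is bounded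
  is then contractive, since one may pass to powers.\<close>

section \<open>Positive elements of C*-algebras\<close>

text \<open>The maps \<open>tensor_extension\<close> and \<open>tensor_assoc\<close> are definite
  descriptions, so coassociativity and the isometry condition carry no information until the
  described bounded maps are shown to exist. The obstacle is that the minimal norm is defined
  through states, whereas the axioms of the class supply a norm but no spectrum, representation or
  state. Positivity is therefore read off from the norm, roots come from the binomial series and
  states from Hahn--Banach; the decisive fact is that \<open>star a * a\<close> is positive, since
  it turns the functionals found by Hahn--Banach into states.

  The kernels are powers of a single function because \<kappa> reverses products, and a power of one
  element does not notice the reversal. Antimultiplicativity of \<kappa> is where coassociativity of
  \<Delta>, and hence associativity of the minimal tensor product, enters.\<close>

lemma star_scaleR: "star (r *\<^sub>R x) = r *\<^sub>R star (x :: 'a :: unital_cstar_algebra)"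
  by (simp add: scaleR_scaleC star_scaleC)

lemma star_power: "star (x ^ n) = star x ^ n" for x :: "'a :: unital_cstar_algebra"
  by (induction n) (simp_all add: star_1 star_mult power_commutes)

lemma norm_scaleR_one_le: "norm (r *\<^sub>R 1 :: 'a :: unital_cstar_algebra) \<le> \<bar>r\<bar>"
  using mult_left_mono[OF norm_one_le[where 'a='a], of "\<bar>r\<bar>"] by simp

text \<open>This is the power (1 - y)^a for \<open>norm y < 1\<close>. A real exponent covers square
  roots, their inverses and fourth roots at once.\<close>

definition binomial_series :: "real \<Rightarrow> 'a :: unital_cstar_algebra \<Rightarrow> 'a" where
  "binomial_series a y = suminf (\<lambda>n. (a gchoose n) *\<^sub>R (- y) ^ n)"

context
  fixes y :: "'a :: unital_cstar_algebra"
  assumes y: "norm y < 1"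
begin

lemma binomial_series_summable_norm: "summable (\<lambda>n. norm ((a gchoose n) *\<^sub>R (- y) ^ n))"
proof (rule summable_comparison_test', rule abs_summable_in_conv_radius)
  show "ereal (norm (norm y)) < conv_radius (\<lambda>n. a gchoose n)"
    using y by (simp add: conv_radius_gchoose)
  show "norm (norm ((a gchoose n) *\<^sub>R (- y) ^ n)) \<le> norm ((a gchoose n) * norm y ^ n)" if "n \<ge> 0" for n
    using mult_left_mono[OF norm_power_le[of "- y" n], of "\<bar>a gchoose n\<bar>"] by (simp add: abs_mult)
qed

lemmas binomial_series_summable = binomial_series_summable_norm[THEN summable_norm_cancel]

text \<open>The Cauchy product of the two series is evaluated by Vandermonde's identity.\<close>

lemma binomial_series_mult: "binomial_series a y * binomial_series b y = binomial_series (a + b) y"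
proof -
  have "(\<lambda>n. \<Sum>i\<le>n. ((a gchoose i) *\<^sub>R (- y) ^ i) * ((b gchoose (n - i)) *\<^sub>R (- y) ^ (n - i)))
      sums (binomial_series a y * binomial_series b y)"
    unfolding binomial_series_def by (intro Cauchy_product_sums binomial_series_summable_norm)
  moreover have "(\<Sum>i\<le>n. ((a gchoose i) *\<^sub>R (- y) ^ i) * ((b gchoose (n - i)) *\<^sub>R (- y) ^ (n - i)))
      = (a + b gchoose n) *\<^sub>R (- y) ^ n" for n
  proof -
    have "(\<Sum>i\<le>n. ((a gchoose i) *\<^sub>R (- y) ^ i) * ((b gchoose (n - i)) *\<^sub>R (- y) ^ (n - i)))
      = (\<Sum>i\<le>n. ((a gchoose i) * (b gchoose (n - i))) *\<^sub>R (- y) ^ n)"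
      by (intro sum.cong refl) (simp flip: power_add)
    then show ?thesis
      by (simp add: gbinomial_Vandermonde[symmetric] scaleR_sum_left atMost_atLeast0)
  qed
  ultimately show ?thesis unfolding binomial_series_def by (simp add: sums_iff)
qed

lemma binomial_series_0: "binomial_series 0 y = 1"
proof -
  have "(\<lambda>n. ((0 :: real) gchoose n) *\<^sub>R (- y) ^ n) sums (\<Sum>n\<in>{0}. ((0 :: real) gchoose n) *\<^sub>R (- y) ^ n)"
    by (rule sums_finite) (auto simp: gr0_conv_Suc)
  then show ?thesis by (simp add: binomial_series_def sums_iff)
qed

lemma binomial_series_1: "binomial_series 1 y = 1 - y"
proof -
  have "(1 :: real) gchoose Suc (Suc n) = 0" for n
    using gbinomial_Suc_Suc[of "0 :: real" "Suc n"] by simp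
  then have "(\<lambda>n. ((1 :: real) gchoose n) *\<^sub>R (- y) ^ n) sums (\<Sum>n\<in>{0,1}. ((1 :: real) gchoose n) *\<^sub>R (- y) ^ n)"
    by (intro sums_finite) (auto simp: gr0_conv_Suc dest!: not0_implies_Suc)
  then show ?thesis by (simp add: binomial_series_def sums_iff)
qed

lemma binomial_series_commute:
  assumes "z * y = y * z" shows "z * binomial_series a y = binomial_series a y * z"
proof -
  have "z * (- y) ^ n = (- y) ^ n * z" for n
    using power_commuting_commutes[of "- y" z n] assms by simp
  then show ?thesis
    unfolding binomial_series_def
    by (simp add: suminf_mult[OF binomial_series_summable, symmetric] suminf_mult2[OF binomial_series_summable])
qed

lemma binomial_series_star:
  assumes "star y = y" shows "star (binomial_series a y) = binomial_series a y"
proof -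
  have "star (- y) = - y" using assms by (simp add: star_minus)
  then show ?thesis
    unfolding binomial_series_def
    by (simp add: bounded_linear.suminf[OF bounded_linear_star binomial_series_summable] star_scaleR star_power)
qed

end

text \<open>An element is called positive when it is self-adjoint with spectrum in \<open>[0, \<infinity>)\<close>; this is expressed
  through the norm, so that positive elements form a closed convex cone without further proof.\<close>

definition pos_elem :: "'a :: unital_cstar_algebra \<Rightarrow> bool" where
  "pos_elem x \<longleftrightarrow> star x = x \<and> (\<forall>e>0. \<exists>r\<ge>0. norm (r *\<^sub>R 1 - x) \<le> r + e)"

lemma pos_elem_star: "pos_elem x \<Longrightarrow> star x = x"
  by (simp add: pos_elem_def)

text \<open>By the triangle inequality an admissible \<open>r\<close> can be increased at will, so
  it may be taken above any given \<open>r0\<close>.\<close>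

lemma pos_elemE:
  assumes "pos_elem x" "e > 0"
  obtains r where "r \<ge> r0" "r \<ge> 0" "norm (r *\<^sub>R 1 - x) \<le> r + e"
proof -
  obtain r where r: "r \<ge> 0" "norm (r *\<^sub>R 1 - x) \<le> r + e"
    using assms unfolding pos_elem_def by blast
  define r' where "r' = max r r0"
  have "norm (r' *\<^sub>R 1 - x) = norm ((r' - r) *\<^sub>R 1 + (r *\<^sub>R 1 - x))"
    by (simp add: algebra_simps)
  also have "\<dots> \<le> (r' - r) + (r + e)"
    using norm_triangle_ineq[of "(r' - r) *\<^sub>R 1" "r *\<^sub>R 1 - x"]
      norm_scaleR_one_le[of "r' - r", where 'a='a] r by (simp add: r'_def)
  finally show ?thesis using r that[of r'] by (simp add: r'_def)
qed

lemma pos_elem_closed: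
  assumes "star x = x" and "\<And>e. e > 0 \<Longrightarrow> \<exists>y. pos_elem y \<and> norm (y - x) \<le> e"
  shows "pos_elem x"
  unfolding pos_elem_def
proof (intro conjI allI impI)
  fix e :: real assume "e > 0"
  then obtain y where y: "pos_elem y" "norm (y - x) \<le> e / 2" using assms(2)[of "e / 2"] by auto
  obtain r where r: "r \<ge> 0" "norm (r *\<^sub>R 1 - y) \<le> r + e / 2"
    using pos_elemE[OF y(1), of "e / 2" 0] \<open>e > 0\<close> by auto
  have "norm (r *\<^sub>R 1 - x) \<le> norm (r *\<^sub>R 1 - y) + norm (y - x)"
    using norm_triangle_ineq[of "r *\<^sub>R 1 - y" "y - x"] by simp
  then show "\<exists>r\<ge>0. norm (r *\<^sub>R 1 - x) \<le> r + e" using r y by (intro exI[of _ r]) auto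
qed (rule assms)

lemma pos_elem_add:
  assumes "pos_elem x" "pos_elem y" shows "pos_elem (x + y)"
  unfolding pos_elem_def
proof (intro conjI allI impI)
  fix e :: real assume e: "e > 0"
  obtain r where r: "r \<ge> 0" "norm (r *\<^sub>R 1 - x) \<le> r + e / 2"
    using pos_elemE[OF assms(1), of "e / 2" 0] e by auto
  obtain s where s: "s \<ge> 0" "norm (s *\<^sub>R 1 - y) \<le> s + e / 2"
    using pos_elemE[OF assms(2), of "e / 2" 0] e by auto
  have "norm ((r + s) *\<^sub>R 1 - (x + y)) \<le> norm (r *\<^sub>R 1 - x) + norm (s *\<^sub>R 1 - y)"
    using norm_triangle_ineq[of "r *\<^sub>R 1 - x" "s *\<^sub>R 1 - y"] by (simp add: algebra_simps)
  then show "\<exists>r\<ge>0. norm (r *\<^sub>R 1 - (x + y)) \<le> r + e"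
    using r s by (intro exI[of _ "r + s"]) auto
qed (use assms in \<open>simp add: star_add pos_elem_star\<close>)

lemma pos_elem_scaleR:
  assumes "pos_elem x" "c \<ge> 0" shows "pos_elem (c *\<^sub>R x)"
  unfolding pos_elem_def
proof (intro conjI allI impI)
  fix e :: real assume e: "e > 0"
  show "\<exists>r\<ge>0. norm (r *\<^sub>R 1 - c *\<^sub>R x) \<le> r + e"
  proof (cases "c = 0")
    case True
    then show ?thesis using e by (intro exI[of _ 0]) simp
  next
    case False
    then have c: "c > 0" using assms(2) by simp
    obtain r where r: "r \<ge> 0" "norm (r *\<^sub>R 1 - x) \<le> r + e / c"
      using pos_elemE[OF assms(1), of "e / c" 0] e c by auto
    have "norm ((c * r) *\<^sub>R 1 - c *\<^sub>R x) = c * norm (r *\<^sub>R 1 - x)"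
      using c by (simp flip: scaleR_scaleR scaleR_diff_right)
    also have "\<dots> \<le> c * r + e" using mult_left_mono[OF r(2), of c] c by (simp add: algebra_simps)
    finally show ?thesis using r c by (intro exI[of _ "c * r"]) simp
  qed
qed (use assms in \<open>simp add: star_scaleR pos_elem_star\<close>)

lemma pos_elem_norm_minus:
  assumes "star x = x" "norm x \<le> c" shows "pos_elem (c *\<^sub>R 1 - x)"
  unfolding pos_elem_def
proof (intro conjI allI impI)
  fix e :: real assume "e > 0"
  moreover have "0 \<le> c" using assms norm_ge_zero order_trans by blast
  ultimately show "\<exists>r\<ge>0. norm (r *\<^sub>R 1 - (c *\<^sub>R 1 - x)) \<le> r + e"
    using assms by (intro exI[of _ c]) simp
qed (simp add: star_diff star_scaleR star_1 assms)

lemma pos_elem_scaleR_one: "c \<ge> 0 \<Longrightarrow> pos_elem (c *\<^sub>R 1)"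
  using pos_elem_norm_minus[of 0 c] by (simp add: star_0)

lemma pos_elem_approx:
  assumes "star x = x" and "\<And>e. e > 0 \<Longrightarrow> pos_elem (x + e *\<^sub>R y)"
  shows "pos_elem x"
proof (rule pos_elem_closed[OF assms(1)])
  fix e :: real assume e: "e > 0"
  define d where "d = e / (norm y + 1)"
  have d: "d > 0" using e by (simp add: d_def add_nonneg_pos)
  have "d * norm y \<le> d * (norm y + 1)" using d by simp
  also have "\<dots> = e" using add_nonneg_pos[OF norm_ge_zero[of y] zero_less_one] by (simp add: d_def)
  finally show "\<exists>y. pos_elem y \<and> norm (y - x) \<le> e"
    using assms(2)[OF d] d by (intro exI[of _ "x + d *\<^sub>R y"]) simp
qed

text \<open>The element \<open>w = 1 + itk - t\<^sup>2k\<^sup>2/2\<close> approximates the unitary \<open>exp(itk)\<close>, and its real part is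
  \<open>1 - t\<^sup>2k\<^sup>2/2\<close>.\<close>

lemma pos_elem_square:
  fixes k :: "'a :: unital_cstar_algebra"
  assumes k: "star k = k" shows "pos_elem (k * k)"
  unfolding pos_elem_def
proof (intro conjI allI impI)
  fix e :: real assume e: "e > 0"
  define C where "C = norm k ^ 4"
  have C0: "C \<ge> 0" by (simp add: C_def)
  \<comment> \<open>\<open>u\<close> is t^2. The norm of \<open>p\<close> exceeds 1 by at most u^2
    C/4, and this excess is finally multiplied by 2/u; hence \<open>u * C \<le> e\<close> keeps the
    error below \<open>e\<close>.\<close>
  define u where "u = min 1 (e / (C + 1))"
  define t where "t = sqrt u"
  have u: "0 < u" "u * C \<le> e"
  proof -
    show "0 < u" using e C0 by (simp add: u_def add_nonneg_pos)
    have "u * C \<le> e / (C + 1) * (C + 1)" using C0 e \<open>0 < u\<close> by (intro mult_mono) (auto simp: u_def)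
    then show "u * C \<le> e" using C0 by simp
  qed
  have t2: "t * t = u" using u by (simp add: t_def)
  define p where "p = 1 - (u / 2) *\<^sub>R (k * k)"
  define w where "w = p + (\<i> * of_real t) *\<^sub>C k"
  have sp: "star p = p" by (simp add: p_def star_diff star_1 star_scaleR star_mult k)
  have sw: "star w = p - (\<i> * of_real t) *\<^sub>C k"
    unfolding w_def star_add sp star_scaleC k by simp
  have pk: "p * k = k * p" by (simp add: p_def algebra_simps)
  \<comment> \<open>The linear terms cancel because \<open>p\<close> and \<open>k\<close> commute,
    the quadratic ones because of the coefficient 1/2 in \<open>p\<close>; only a fourth-order term
    survives.\<close>
  have "star w * w = p * p + ((\<i> * of_real t) *\<^sub>C (p * k) - (\<i> * of_real t) *\<^sub>C (k * p))
      - (\<i> * of_real t * (\<i> * of_real t)) *\<^sub>C (k * k)"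
    unfolding sw unfolding w_def
    by (simp add: algebra_simps mult_scaleC_left mult_scaleC_right scaleC_scaleC)
  also have "(\<i> * of_real t * (\<i> * of_real t)) *\<^sub>C (k * k) = - (u *\<^sub>R (k * k))"
  proof -
    have "\<i> * of_real t * (\<i> * of_real t) = complex_of_real (- u)"
      using t2 by (simp add: complex_eq_iff)
    then show ?thesis by (simp only: scaleR_scaleC[symmetric] scaleR_minus_left)
  qed
  also have "p * p + ((\<i> * of_real t) *\<^sub>C (p * k) - (\<i> * of_real t) *\<^sub>C (k * p)) - - (u *\<^sub>R (k * k))
      = 1 + (u\<^sup>2 / 4) *\<^sub>R (k * k * (k * k))"
    unfolding pk by (simp add: p_def algebra_simps power2_eq_square flip: scaleR_add_left)
  finally have "(norm w)\<^sup>2 \<le> norm (1 :: 'a) + u\<^sup>2 / 4 * norm (k * k * (k * k))"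
    unfolding cstar_identity[symmetric]
    using norm_triangle_ineq[of 1 "(u\<^sup>2 / 4) *\<^sub>R (k * k * (k * k))"] by simp
  also have "norm (k * k * (k * k)) \<le> C"
  proof -
    have "norm (k * k) \<le> norm k * norm k" by (rule norm_mult_ineq)
    then have "norm (k * k) * norm (k * k) \<le> (norm k * norm k) * (norm k * norm k)"
      by (intro mult_mono) auto
    then show ?thesis using norm_mult_ineq[of "k * k" "k * k"] by (simp add: C_def power4_eq_xxxx)
  qed
  finally have "(norm w)\<^sup>2 \<le> 1 + u\<^sup>2 / 4 * C"
    using norm_one_le[where 'a='a] u by (simp add: mult_left_mono)
  also have "\<dots> \<le> (1 + u\<^sup>2 / 4 * C)\<^sup>2" using C0 by (simp add: power2_sum)
  finally have nw: "norm w \<le> 1 + u\<^sup>2 / 4 * C" by (rule power2_le_imp_le) (simp add: C0)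
  have "norm (2 *\<^sub>R p) = norm (w + star w)" unfolding sw by (simp add: w_def scaleR_2)
  also have "\<dots> \<le> norm w + norm (star w)" by (rule norm_triangle_ineq)
  finally have np: "norm p \<le> 1 + u\<^sup>2 / 4 * C" using nw by (simp add: norm_star)
  have "(2 / u) *\<^sub>R 1 - k * k = (2 / u) *\<^sub>R p" using u by (simp add: p_def algebra_simps)
  then have "norm ((2 / u) *\<^sub>R 1 - k * k) = 2 / u * norm p" using u by simp
  also have "\<dots> \<le> 2 / u * (1 + u\<^sup>2 / 4 * C)" using np u by (intro mult_left_mono) auto
  also have "\<dots> = 2 / u + u * C / 2" using u by (simp add: field_simps power2_eq_square)
  also have "\<dots> \<le> 2 / u + e" using u mult_nonneg_nonneg[OF less_imp_le[OF u(1)] C0] by linarith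
  finally show "\<exists>r\<ge>0. norm (r *\<^sub>R 1 - k * k) \<le> r + e" using u by (intro exI[of _ "2 / u"]) simp
qed (simp add: star_mult k)

text \<open>Positivity of \<open>x\<close> gives x + e = R (1 - y) with \<open>norm y < 1\<close>,
  to which the binomial series applies. The shift by \<open>e\<close> moves \<open>y\<close>
  strictly inside the unit ball and makes the root \<open>c\<close> invertible, with inverse
  \<open>d\<close>.\<close>

lemma pos_elem_sqrt:
  fixes x :: "'a :: unital_cstar_algebra"
  assumes x: "pos_elem x" and e: "e > 0"
  obtains c d where "c * c = x + e *\<^sub>R 1" "pos_elem c" "c * d = 1" "d * c = 1"
    "\<And>z. z * x = x * z \<Longrightarrow> z * c = c * z"
proof -
  obtain r where r: "r \<ge> 0" "norm (r *\<^sub>R 1 - x) \<le> r + e / 2"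
    using pos_elemE[OF x, of "e / 2" 0] e by auto
  define R where "R = r + e"
  have R: "R > 0" using r e by (simp add: R_def)
  define y where "y = (1 / R) *\<^sub>R (r *\<^sub>R 1 - x)"
  have "norm (r *\<^sub>R 1 - x) < R" using r e by (simp add: R_def)
  then have y: "norm y < 1" using R by (simp add: y_def)
  have sy: "star y = y" by (simp add: y_def star_scaleR star_diff star_1 pos_elem_star[OF x])
  have eq: "x + e *\<^sub>R 1 = R *\<^sub>R (1 - y)"
  proof -
    have "R *\<^sub>R y = r *\<^sub>R 1 - x" using R by (simp add: y_def)
    then show ?thesis by (simp add: scaleR_diff_right) (simp add: R_def algebra_simps)
  qed
  note S = binomial_series_mult[OF y] binomial_series_0[OF y] binomial_series_1[OF y]
  define c where "c = sqrt R *\<^sub>R binomial_series (1/2) y"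
  define d where "d = (1 / sqrt R) *\<^sub>R binomial_series (-1/2) y"
  show ?thesis
  proof
    show "c * c = x + e *\<^sub>R 1" unfolding eq c_def using R by (simp add: S)
    \<comment> \<open>The root is positive because it is in turn the square of a self-adjoint fourth
      root.\<close>
    have "pos_elem (binomial_series (1/4) y * binomial_series (1/4) y)"
      by (intro pos_elem_square binomial_series_star y sy)
    then show "pos_elem c" unfolding c_def by (intro pos_elem_scaleR) (use R in \<open>simp_all add: S\<close>)
    show "c * d = 1" "d * c = 1" using R by (simp_all add: c_def d_def S)
    show "z * c = c * z" if "z * x = x * z" for z
    proof -
      have "z * y = y * z" using that by (simp add: y_def algebra_simps)
      then show ?thesis by (simp add: c_def binomial_series_commute[OF y])
    qed
  qed
qed

text \<open>For commuting square roots \<open>c\<close> of x + d and \<open>b\<close> of y + d, the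
  element \<open>c * b\<close> is self-adjoint with square (x + d)(y + d). This product is positive
  and tends to \<open>x * y\<close> as d tends to 0.\<close>

lemma pos_elem_mult:
  fixes x y :: "'a :: unital_cstar_algebra"
  assumes "pos_elem x" "pos_elem y" "x * y = y * x" shows "pos_elem (x * y)"
proof (rule pos_elem_closed)
  show "star (x * y) = x * y" by (simp add: star_mult pos_elem_star assms)
  fix e :: real assume e: "e > 0"
  define d where "d = min 1 (e / (norm x + norm y + 1))"
  have d: "d > 0" "d \<le> 1" using e by (simp_all add: d_def add_nonneg_pos)
  obtain c where c: "c * c = x + d *\<^sub>R 1" "pos_elem c" and cc: "\<And>z. z * x = x * z \<Longrightarrow> z * c = c * z"
    using pos_elem_sqrt[OF assms(1) d(1)] by metis
  obtain b where b: "b * b = y + d *\<^sub>R 1" "pos_elem b" and bc: "\<And>z. z * y = y * z \<Longrightarrow> z * b = b * z"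
    using pos_elem_sqrt[OF assms(2) d(1)] by metis
  have "y * c = c * y" using cc[of y] assms(3) by simp
  then have cb: "c * b = b * c" using bc[of c] by simp
  have "(c * b) * (c * b) = (x + d *\<^sub>R 1) * (y + d *\<^sub>R 1)"
    using cb by (metis b(1) c(1) mult.assoc)
  moreover have "pos_elem ((c * b) * (c * b))"
    using cb by (intro pos_elem_square) (simp add: star_mult pos_elem_star c b)
  ultimately have P: "pos_elem ((x + d *\<^sub>R 1) * (y + d *\<^sub>R 1))" by simp
  have "(x + d *\<^sub>R 1) * (y + d *\<^sub>R 1) - x * y = d *\<^sub>R (x + y + d *\<^sub>R 1)"
    by (simp add: algebra_simps)
  then have "norm ((x + d *\<^sub>R 1) * (y + d *\<^sub>R 1) - x * y) = d * norm (x + y + d *\<^sub>R 1)"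
    using d by simp
  also have "\<dots> \<le> d * (norm x + norm y + 1)"
    using d norm_triangle_ineq[of "x + y" "d *\<^sub>R 1"] norm_triangle_ineq[of x y] norm_scaleR_one_le[of d, where 'a='a]
    by (intro mult_left_mono) (auto simp del: norm_scaleR)
  also have "\<dots> \<le> e / (norm x + norm y + 1) * (norm x + norm y + 1)"
    by (intro mult_right_mono) (auto simp: d_def)
  also have "\<dots> = e"
    using add_nonneg_pos[of "norm x + norm y" 1] by (simp add: less_imp_neq[symmetric])
  finally show "\<exists>z. pos_elem z \<and> norm (z - x * y) \<le> e" using P by blast
qed

text \<open>If \<open>-1 \<le> h \<le> 1\<close>, then \<open>h\<close> is the real part of the unitary \<open>h + i \<surd>(1 - h\<^sup>2)\<close>.\<close>

lemma pos_elem_norm_le: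
  assumes "pos_elem (l *\<^sub>R 1 - h)" "pos_elem (l *\<^sub>R 1 + h)" "l \<ge> 0"
  shows "norm (h :: 'a :: unital_cstar_algebra) \<le> l"
proof -
  have sh: "star h = h"
    using pos_elem_star[OF assms(2)] by (simp add: star_add star_scaleR star_1)
  have "pos_elem ((l *\<^sub>R 1 - h) * (l *\<^sub>R 1 + h))"
    by (intro pos_elem_mult assms) (simp add: algebra_simps)
  then have P: "pos_elem ((l * l) *\<^sub>R 1 - h * h)" by (simp add: algebra_simps)
  have "norm h \<le> sqrt (l\<^sup>2 + e)" if e: "e > 0" for e
  proof -
    have "h * ((l * l) *\<^sub>R 1 - h * h) = ((l * l) *\<^sub>R 1 - h * h) * h" by (simp add: algebra_simps)
    then obtain c where c: "c * c = (l * l) *\<^sub>R 1 - h * h + e *\<^sub>R 1" "pos_elem c" and hc: "h * c = c * h"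
      using pos_elem_sqrt[OF P e] by metis
    define w where "w = h + \<i> *\<^sub>C c"
    have sw: "star w = h - \<i> *\<^sub>C c"
      by (simp add: w_def star_add star_scaleC sh pos_elem_star[OF c(2)] cvec.scale_minus_left)
    have "star w * w = h * h + (\<i> *\<^sub>C (h * c) - \<i> *\<^sub>C (c * h)) - (\<i> * \<i>) *\<^sub>C (c * c)"
      unfolding sw unfolding w_def by (simp add: algebra_simps mult_scaleC_left mult_scaleC_right scaleC_scaleC)
    also have "\<dots> = (l * l + e) *\<^sub>R 1"
      unfolding hc by (simp add: c(1) cvec.scale_minus_left algebra_simps)
    finally have "(norm w)\<^sup>2 \<le> l\<^sup>2 + e"
      unfolding cstar_identity[symmetric] using norm_scaleR_one_le[of "l * l + e", where 'a='a] e
      by (simp add: power2_eq_square)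
    then have nw: "norm w \<le> sqrt (l\<^sup>2 + e)" by (rule real_le_rsqrt)
    have "norm (2 *\<^sub>R h) = norm (w + star w)" unfolding sw by (simp add: w_def scaleR_2)
    also have "\<dots> \<le> norm w + norm (star w)" by (rule norm_triangle_ineq)
    finally show ?thesis using nw by (simp add: norm_star)
  qed
  then have "(norm h)\<^sup>2 \<le> l\<^sup>2 + e" if "e > 0" for e
    using that real_sqrt_le_iff[of "(norm h)\<^sup>2" "l\<^sup>2 + e"] by simp
  then have "(norm h)\<^sup>2 \<le> l\<^sup>2" by (rule field_le_epsilon)
  then show ?thesis using assms(3) by (rule power2_le_imp_le)
qed

text \<open>The inverse \<open>v\<close> is self-adjoint, so 1 - d v is positive for small d, and
  multiplication by the commuting positive \<open>w\<close> gives w - d.\<close>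

lemma pos_elem_invertible:
  assumes w: "pos_elem w" and v: "w * v = 1" "v * w = 1"
  shows "\<exists>d>0. pos_elem (w - d *\<^sub>R 1)"
proof -
  have "star v = star v * (w * v)" by (simp add: v)
  also have "\<dots> = star (w * v) * v" by (simp add: star_mult pos_elem_star[OF w] mult.assoc)
  finally have sv: "star v = v" by (simp add: v star_1)
  define d where "d = 1 / (norm v + 1)"
  have d: "d > 0" by (simp add: d_def add_nonneg_pos)
  have "d * norm v \<le> d * (norm v + 1)" using d by simp
  also have "\<dots> = 1" using add_nonneg_pos[OF norm_ge_zero[of v] zero_less_one] by (simp add: d_def)
  finally have "pos_elem (1 *\<^sub>R 1 - d *\<^sub>R v)"
    using d by (intro pos_elem_norm_minus) (simp_all add: star_scaleR sv)
  then have "pos_elem (w * (1 - d *\<^sub>R v))"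
    using v by (intro pos_elem_mult w) (simp_all add: algebra_simps)
  then show ?thesis using d v by (auto simp: algebra_simps)
qed

text \<open>\<open>star b * b\<close> and \<open>b * star b\<close> have the same spectrum apart
  from 0. Let m be the least bound of \<open>b * star b\<close> that is at least \<open>l\<close>.
  If m > l, then m - \<open>star b * b\<close> has an inverse R, so m - \<open>b * star b\<close>
  has the inverse (1 + b R \<open>star b\<close>)/m, and a positive invertible element leaves room
  to lower m.\<close>

lemma pos_elem_swap:
  assumes P: "pos_elem (l *\<^sub>R 1 - star b * b)" and l: "l > 0"
  shows "pos_elem (l *\<^sub>R 1 - b * star b)"
proof -
  define S where "S = {m. m \<ge> l \<and> pos_elem (m *\<^sub>R 1 - b * star b)}"
  define m where "m = Inf S"
  have sb: "star (b * star b) = b * star b" by (simp add: star_mult star_star)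
  have "pos_elem ((norm (b * star b) + l) *\<^sub>R 1 - b * star b)"
    using l by (intro pos_elem_norm_minus sb) simp
  then have ne: "S \<noteq> {}" by (auto simp: S_def intro!: exI[of _ "norm (b * star b) + l"])
  have bdd: "bdd_below S" by (auto simp: S_def)
  have ml: "m \<ge> l" unfolding m_def by (rule cInf_greatest[OF ne]) (simp add: S_def)
  have Pm: "pos_elem (m *\<^sub>R 1 - b * star b)"
  proof (rule pos_elem_approx[where y=1])
    show "star (m *\<^sub>R 1 - b * star b) = m *\<^sub>R 1 - b * star b"
      by (simp add: star_diff star_scaleR star_1 sb)
    fix e :: real assume "e > 0"
    then obtain s where s: "s \<in> S" "s < m + e"
      using cInf_lessD[OF ne, of "m + e"] by (auto simp: m_def)
    then have "pos_elem ((s *\<^sub>R 1 - b * star b) + (m + e - s) *\<^sub>R 1)"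
      by (intro pos_elem_add pos_elem_scaleR_one) (auto simp: S_def)
    then show "pos_elem (m *\<^sub>R 1 - b * star b + e *\<^sub>R 1)" by (simp add: algebra_simps)
  qed
  have "m = l"
  proof (rule ccontr)
    assume "m \<noteq> l"
    then have "m - l > 0" using ml by simp
    from pos_elem_sqrt[OF P this] obtain c d where
      c: "c * c = l *\<^sub>R 1 - star b * b + (m - l) *\<^sub>R 1" "c * d = 1" "d * c = 1" by metis
    define R where "R = d * d"
    have "(c * c) * R = c * (c * d) * d" "R * (c * c) = d * (d * c) * c"
      by (simp_all add: R_def mult.assoc)
    then have R: "(c * c) * R = 1" "R * (c * c) = 1" by (simp_all add: c)
    have cc: "c * c = m *\<^sub>R 1 - star b * b" using c(1) by (simp add: algebra_simps)
    define w where "w = m *\<^sub>R 1 - b * star b"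
    define v where "v = (1 / m) *\<^sub>R (1 + b * R * star b)"
    have m0: "m \<noteq> 0" using ml l by simp
    have "w * b = b * (c * c)" "star b * w = (c * c) * star b"
      by (simp_all add: w_def cc algebra_simps)
    then have "w * (b * R * star b) = b * ((c * c) * R) * star b"
      "(b * R * star b) * w = b * (R * (c * c)) * star b"
      by (metis mult.assoc)+
    then have "w * (b * R * star b) = b * star b" "(b * R * star b) * w = b * star b"
      by (simp_all add: R)
    then have "w * v = 1" "v * w = 1"
      using m0 by (simp_all add: v_def distrib_left distrib_right) (simp_all add: w_def)
    moreover have "pos_elem w" using Pm by (simp add: w_def)
    ultimately obtain e where e: "e > 0" "pos_elem (w - e *\<^sub>R 1)"
      using pos_elem_invertible by blast
    define f where "f = max (m - e) l"
    have "f < m" using e \<open>m \<noteq> l\<close> ml by (auto simp: f_def)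
    have "pos_elem ((w - e *\<^sub>R 1) + (f - (m - e)) *\<^sub>R 1)"
      by (intro pos_elem_add e pos_elem_scaleR_one) (simp add: f_def)
    then have "pos_elem (f *\<^sub>R 1 - b * star b)" by (simp add: w_def algebra_simps)
    then have "f \<in> S" by (simp add: S_def f_def)
    then show False using cInf_lower[OF _ bdd, of f] \<open>f < m\<close> by (simp add: m_def)
  qed
  then show ?thesis using Pm by simp
qed


text \<open>Kaplansky's argument. With \<open>k = a\<^sup>*a = u - v\<close> and \<open>u v = \<epsilon>/4\<close>, the element \<open>b = a v\<close> satisfies
  \<open>b\<^sup>*b = (\<epsilon>/4) v - v\<^sup>3 \<le> \<lambda>\<close> with a small \<open>\<lambda>\<close>. Hence \<open>bb\<^sup>* \<le> \<lambda>\<close>, and since \<open>b\<^sup>*b + bb\<^sup>* \<ge> 0\<close>, the norm of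
  \<open>b\<^sup>*b\<close> and so the norm of \<open>v\<close> is small.\<close>

theorem pos_elem_star_mult: "pos_elem (star a * a)"
  for a :: "'a :: unital_cstar_algebra"
proof -
  define k where "k = star a * a"
  have sk: "star k = k" by (simp add: k_def star_mult star_star)
  have approx: "\<exists>y. pos_elem y \<and> norm (y - k) \<le> e" if e: "e > 0" for e
  proof -
    \<comment> \<open>The bound 1/2 will force \<open>norm v \<le> 1\<close>; the cubic bound then
      turns \<open>norm v ^ 3 \<le> d\<close> into \<open>norm v \<le> e / 2\<close>.\<close>
    define d where "d = min (1/2) ((e / 2) ^ 3)"
    have d: "d > 0" "d \<le> 1/2" "d \<le> (e / 2) ^ 3" using e by (simp_all add: d_def)
    \<comment> \<open>\<open>c\<close> is a smoothed absolute value of \<open>k\<close>, invertible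
      because of \<open>d\<close>. It is the positive approximant sought: c - k is twice the
      smoothed negative part \<open>v\<close>.\<close>
    obtain c c' where c: "c * c = k * k + d *\<^sub>R 1" "pos_elem c" and c': "c * c' = 1" "c' * c = 1"
      and cc: "\<And>z. z * (k * k) = (k * k) * z \<Longrightarrow> z * c = c * z"
      using pos_elem_sqrt[OF pos_elem_square[OF sk] d(1)] by metis
    have kc: "k * c = c * k" by (rule cc) (simp add: mult.assoc)
    have comm: "c' * z = z * c'" if "z * c = c * z" for z
    proof -
      have "c' * z = c' * (z * c) * c'" by (simp add: mult.assoc c')
      also have "\<dots> = (c' * c) * z * c'" by (simp add: that mult.assoc)
      finally show ?thesis by (simp add: c')
    qed
    have "star c' = star c' * (c * c')" by (simp add: c')
    also have "\<dots> = star (c * c') * c'" by (simp add: star_mult pos_elem_star[OF c(2)] mult.assoc)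
    finally have sc': "star c' = c'" by (simp add: c' star_1)
    \<comment> \<open>\<open>c'\<close> is positive as the product of the commuting positive
      elements \<open>c' * c'\<close> and \<open>c\<close>.\<close>
    have "(c' * c') * c = c'" "c * (c' * c') = c'" by (simp_all add: c' mult.assoc) (simp add: c' flip: mult.assoc)
    then have "pos_elem ((c' * c') * c)"
      by (intro pos_elem_mult pos_elem_square sc' c(2)) simp
    then have Pc': "pos_elem c'" by (simp add: mult.assoc c')
    define v where "v = (1/2) *\<^sub>R (c - k)"
    define u where "u = (1/2) *\<^sub>R (c + k)"
    have uv: "u * v = (d/4) *\<^sub>R 1"
    proof -
      have "u * v = (1/4) *\<^sub>R ((c + k) * (c - k))" by (simp add: u_def v_def)
      also have "(c + k) * (c - k) = c * c - k * k" by (simp add: algebra_simps kc)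
      finally have "u * v = (1/4) *\<^sub>R (c * c - k * k)" .
      then show ?thesis by (simp add: c)
    qed
    have cuv: "c = u + v" and kuv: "k = u - v"
      by (simp_all add: u_def v_def flip: scaleR_add_right scaleR_diff_right scaleR_2)
    have sv: "star v = v" by (simp add: v_def star_scaleR star_diff sk pos_elem_star[OF c(2)])
    \<comment> \<open>Positivity of \<open>v\<close> is seen after multiplication by
      \<open>c\<close>: the product \<open>c * v\<close> equals d/4 + \<open>v * v\<close>, and the
      positive inverse \<open>c'\<close> recovers \<open>v\<close>.\<close>
    have "pos_elem ((d/4) *\<^sub>R 1 + v * v)"
      using d by (intro pos_elem_add pos_elem_scaleR_one pos_elem_square sv) simp
    moreover have "c * v = (d/4) *\<^sub>R 1 + v * v" by (simp add: cuv distrib_right uv)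
    ultimately have Pcv: "pos_elem (c * v)" by simp
    have vc: "v * c = c * v" by (simp add: v_def kc left_diff_distrib right_diff_distrib)
    have "c' * (c * v) = (c * v) * c'" by (rule comm) (simp add: mult.assoc vc)
    then have "pos_elem (c' * (c * v))" by (rule pos_elem_mult[OF Pc' Pcv])
    then have Pv: "pos_elem v" by (simp add: c' flip: mult.assoc)
    have Pv3: "pos_elem (v * (v * v))" by (intro pos_elem_mult Pv pos_elem_square sv) (simp add: mult.assoc)
    define b where "b = a * v"
    define l where "l = (d/4) * (norm v + 1)"
    have l: "l > 0" using d by (simp add: l_def add_nonneg_pos)
    have bb: "star b * b = (d/4) *\<^sub>R v - v * (v * v)"
    proof -
      have "star b * b = v * (k * v)" by (simp add: b_def k_def star_mult sv mult.assoc)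
      also have "k * v = (d/4) *\<^sub>R 1 - v * v" by (simp add: kuv left_diff_distrib uv)
      finally show ?thesis by (simp add: right_diff_distrib)
    qed
    have "pos_elem ((norm v + 1) *\<^sub>R 1 - v)" by (rule pos_elem_norm_minus[OF sv]) simp
    then have "pos_elem ((d/4) *\<^sub>R ((norm v + 1) *\<^sub>R 1 - v) + v * (v * v))"
      using d by (intro pos_elem_add pos_elem_scaleR Pv3) auto
    then have P1: "pos_elem (l *\<^sub>R 1 - star b * b)" by (simp add: bb l_def algebra_simps add_divide_distrib)
    then have P2: "pos_elem (l *\<^sub>R 1 - b * star b)" using l by (rule pos_elem_swap)
    \<comment> \<open>With the real and imaginary parts of \<open>b\<close>, the sum of
      \<open>star b * b\<close> and \<open>b * star b\<close> becomes twice a sum of two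
      self-adjoint squares.\<close>
    define x where "x = (1/2) *\<^sub>R (b + star b)"
    define y where "y = (1/2) *\<^sub>C (\<i> *\<^sub>C (star b - b))"
    have sx: "star x = x" by (simp add: x_def star_scaleR star_add star_star add.commute)
    have sy: "star y = y"
      by (simp add: y_def star_scaleC star_diff star_star cvec.scale_right_diff_distrib)
    have "y * y = (1/4 * (\<i> * \<i>)) *\<^sub>C ((star b - b) * (star b - b))"
      unfolding y_def mult_scaleC_left mult_scaleC_right scaleC_scaleC by simp
    also have "1/4 * (\<i> * \<i>) = complex_of_real (- 1/4)" by simp
    also have "complex_of_real (- 1/4) *\<^sub>C ((star b - b) * (star b - b))
        = (- 1/4) *\<^sub>R ((star b - b) * (star b - b))"
      by (simp only: scaleR_scaleC)
    finally have yy: "y * y = (- 1/4) *\<^sub>R ((star b - b) * (star b - b))" .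
    have xx: "x * x = (1/4) *\<^sub>R ((b + star b) * (b + star b))" by (simp add: x_def)
    have "2 *\<^sub>R (x * x + y * y) = (1/2) *\<^sub>R ((b + star b) * (b + star b) - (star b - b) * (star b - b))"
      unfolding xx yy by (simp only: scaleR_add_right scaleR_diff_right scaleR_scaleR) simp
    also have "\<dots> = (1/2) *\<^sub>R (2 *\<^sub>R (star b * b + b * star b))"
      by (rule arg_cong[where f="scaleR (1/2)"]) (simp add: scaleR_2 algebra_simps)
    also have "\<dots> = star b * b + b * star b" by simp
    finally have sum: "2 *\<^sub>R (x * x + y * y) = star b * b + b * star b" .
    have "pos_elem (2 *\<^sub>R (x * x + y * y) + (l *\<^sub>R 1 - b * star b))"
      by (intro pos_elem_add pos_elem_scaleR pos_elem_square sx sy P2) simp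
    then have P3: "pos_elem (l *\<^sub>R 1 + star b * b)" unfolding sum by (simp add: algebra_simps)
    have nb: "norm (star b * b) \<le> l" using P1 P3 l by (intro pos_elem_norm_le) auto
    have "norm (v * (v * v)) = norm ((d/4) *\<^sub>R v - star b * b)" by (simp add: bb)
    also have "\<dots> \<le> d/4 * norm v + l"
      using norm_triangle_ineq4[of "(d/4) *\<^sub>R v" "star b * b"] nb d by simp
    also have "\<dots> \<le> d/2 * (norm v + 1)" using d by (simp add: l_def field_simps)
    finally have n3: "norm (v * (v * v)) \<le> d/2 * (norm v + 1)" .
    \<comment> \<open>The norm identity is available for even powers of \<open>v\<close> only, so
      the cube is compared with the fourth power.\<close>
    have nv2: "norm (v * v) = norm v ^ 2" using cstar_identity[of v] by (simp add: sv)
    have "norm v ^ 4 = norm (v * v) ^ 2" by (simp add: nv2)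
    also have "\<dots> = norm ((v * v) * (v * v))" using cstar_identity[of "v * v"] by (simp add: star_mult sv)
    also have "\<dots> \<le> norm v * norm (v * (v * v))"
      using norm_mult_ineq[of v "v * (v * v)"] by (simp add: mult.assoc)
    finally have n4: "norm v ^ 4 \<le> norm v * norm (v * (v * v))" .
    have n3': "norm v ^ 3 \<le> d/2 * (norm v + 1)"
    proof (cases "norm v = 0")
      case True
      then show ?thesis using d by simp
    next
      case False
      then have "norm v > 0" by simp
      moreover have "norm v * norm v ^ 3 \<le> norm v * norm (v * (v * v))"
        using n4 by (simp add: eval_nat_numeral)
      ultimately have "norm v ^ 3 \<le> norm (v * (v * v))" by simp
      then show ?thesis using n3 by simp
    qed
    \<comment> \<open>If \<open>norm v > 1\<close>, the cube would exceed \<open>norm v\<close>,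
      while the right-hand side of \<open>n3'\<close> is at most half of it because
      \<open>d \<le> 1/2\<close>.\<close>
    have n1: "norm v \<le> 1"
    proof (rule ccontr)
      assume "\<not> norm v \<le> 1"
      then have g: "norm v > 1" by simp
      then have "norm v < norm v ^ 3" using power_strict_increasing[of 1 3 "norm v"] by simp
      moreover have "d/2 * (norm v + 1) \<le> (1/4) * (2 * norm v)"
        using d g by (intro mult_mono) auto
      ultimately show False using n3' g by simp
    qed
    have "d/2 * (norm v + 1) \<le> d/2 * 2" using n1 d by (intro mult_left_mono) auto
    then have "norm v ^ 3 \<le> d/2 * 2" by (rule order_trans[OF n3'])
    then have "norm v ^ 3 \<le> (e/2) ^ 3" using d(3) by linarith
    then have "norm v \<le> e / 2" using e by (simp add: power_mono_iff)
    moreover have "c - k = 2 *\<^sub>R v" by (simp add: v_def)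
    ultimately show ?thesis using c(2) by (intro exI[of _ c]) simp
  qed
  show ?thesis using pos_elem_closed[OF sk approx] by (simp add: k_def)
qed

section \<open>Sublinear functionals and states\<close>

definition sublinear :: "('v :: real_vector \<Rightarrow> real) \<Rightarrow> bool" where
  "sublinear q \<longleftrightarrow> (\<forall>x y. q (x + y) \<le> q x + q y) \<and> (\<forall>c>0. \<forall>x. q (c *\<^sub>R x) \<le> c * q x)"

lemma sublinear_add: "sublinear q \<Longrightarrow> q (x + y) \<le> q x + q y"
  by (simp add: sublinear_def)

lemma sublinear_scaleR:
  assumes q: "sublinear q" and c: "c > 0" shows "q (c *\<^sub>R x) = c * q x"
proof (rule antisym)
  have "q (inverse c *\<^sub>R c *\<^sub>R x) \<le> inverse c * q (c *\<^sub>R x)"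
    using q c unfolding sublinear_def by (metis positive_imp_inverse_positive)
  then show "c * q x \<le> q (c *\<^sub>R x)" using c by (simp add: field_simps)
qed (use q c in \<open>simp add: sublinear_def\<close>)

lemma sublinear_zero: assumes "sublinear q" shows "q 0 = 0"
  using sublinear_scaleR[OF assms, of 2 0] by simp

lemma sublinear_minus: assumes "sublinear q" shows "- q (- x) \<le> q x"
  using sublinear_add[OF assms, of x "- x"] sublinear_zero[OF assms] by simp

text \<open>The minorant is the infimum over t \<ge> 0 of q(x + t h) - t q(h), which flattens
  \<open>q\<close> along \<open>h\<close>. If \<open>q\<close> is minimal, then r = q, and the last
  property says that \<open>q\<close> is odd at \<open>h\<close>.\<close>

lemma sublinear_minorant:
  fixes q :: "'v :: real_vector \<Rightarrow> real"
  assumes q: "sublinear q"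
  obtains r where "sublinear r" "r \<le> q" "r (- h) \<le> - q h"
proof -
  define g where "g x t = q (x + t *\<^sub>R h) - t * q h" for x t
  define r where "r x = (INF t\<in>{0..}. g x t)" for x
  have scale: "q (t *\<^sub>R h) = t * q h" if "t \<ge> 0" for t
    using that sublinear_scaleR[OF q, of t h] sublinear_zero[OF q] by (cases "t = 0") auto
  have "- q (- x) \<le> g x t" if "t \<ge> 0" for x t
    using sublinear_add[OF q, of "x + t *\<^sub>R h" "- x"] scale[OF that] by (simp add: g_def)
  then have bdd: "bdd_below (g x ` {0..})" for x
    by (intro bdd_belowI[of _ "- q (- x)"]) auto
  have le: "r x \<le> g x t" if "t \<ge> 0" for x t
    unfolding r_def using that by (intro cINF_lower bdd) simp
  have great: "m \<le> r x" if "\<And>t. t \<ge> 0 \<Longrightarrow> m \<le> g x t" for m x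
    unfolding r_def using that by (intro cINF_greatest) auto
  have "sublinear r"
    unfolding sublinear_def
  proof (intro conjI allI impI)
    fix x y
    have "r (x + y) - g y s \<le> g x t" if "s \<ge> 0" "t \<ge> 0" for s t
      using le[of "t + s" "x + y"] sublinear_add[OF q, of "x + t *\<^sub>R h" "y + s *\<^sub>R h"] that
      by (simp add: g_def algebra_simps)
    then have "r (x + y) - r x \<le> g y s" if "s \<ge> 0" for s
      using great[of "r (x + y) - g y s" x] that by fastforce
    then show "r (x + y) \<le> r x + r y"
      using great[of "r (x + y) - r x" y] by fastforce
  next
    fix c :: real and x assume c: "c > 0"
    have "r (c *\<^sub>R x) / c \<le> g x t" if "t \<ge> 0" for t
    proof -
      have "r (c *\<^sub>R x) \<le> c * g x t"
        using le[of "c * t" "c *\<^sub>R x"] sublinear_scaleR[OF q c, of "x + t *\<^sub>R h"] c that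
        by (simp add: g_def algebra_simps)
      then show ?thesis using c by (simp add: divide_le_eq mult.commute)
    qed
    then show "r (c *\<^sub>R x) \<le> c * r x"
      using great[of "r (c *\<^sub>R x) / c" x] c by (simp add: field_simps)
  qed
  moreover have "r \<le> q" using le[of 0] by (simp add: le_fun_def g_def)
  moreover have "r (- h) \<le> - q h" using le[of 1 "- h"] sublinear_zero[OF q] by (simp add: g_def)
  ultimately show ?thesis by (rule that)
qed

text \<open>Zorn's lemma applies to pointwise infima of chains. They are finite since every
  sublinear q \<le> p satisfies q(x) \<ge> - p(-x). They are subadditive since the smaller of two
  members of a chain bounds both summands.\<close>

lemma sublinear_minimal:
  fixes p :: "'v :: real_vector \<Rightarrow> real"
  assumes p: "sublinear p"
  obtains q where "sublinear q" "q \<le> p" "\<And>r. sublinear r \<Longrightarrow> r \<le> q \<Longrightarrow> r = q"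
proof -
  define A where "A = {q. sublinear q \<and> q \<le> p}"
  \<comment> \<open>The order is reversed, so that the maximal elements of Zorn's lemma are the
    minimal functionals.\<close>
  let ?P = "\<lambda>q r :: 'v \<Rightarrow> real. r \<le> q"
  have "\<exists>m\<in>A. \<forall>a\<in>A. ?P m a \<longrightarrow> a = m"
  proof (rule predicate_Zorn)
    show "partial_order_on A (relation_of ?P A)"
      by (rule partial_order_on_relation_ofI) auto
    fix C assume C: "C \<in> Chains (relation_of ?P A)"
    show "\<exists>u\<in>A. \<forall>a\<in>C. ?P a u"
    proof (cases "C = {}")
      case True
      then show ?thesis using p by (auto simp: A_def)
    next
      case False
      have CA: "C \<subseteq> A" using C by (rule Chains_relation_of)
      have tot: "q \<le> r \<or> r \<le> q" if "q \<in> C" "r \<in> C" for q r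
        using C that by (auto simp: Chains_def relation_of_def)
      define u where "u x = (INF q\<in>C. q x)" for x
      have "- p (- x) \<le> q x" if "q \<in> C" for q x
      proof -
        have "sublinear q" "q (- x) \<le> p (- x)" using that CA by (auto simp: A_def le_fun_def)
        then show ?thesis using sublinear_minus[of q x] by simp
      qed
      then have bdd: "bdd_below ((\<lambda>q. q x) ` C)" for x
        by (intro bdd_belowI[of _ "- p (- x)"]) auto
      have le: "u x \<le> q x" if "q \<in> C" for q x
        unfolding u_def using that by (intro cINF_lower bdd)
      have great: "m \<le> u x" if "\<And>q. q \<in> C \<Longrightarrow> m \<le> q x" for m x
        unfolding u_def using that False by (intro cINF_greatest) auto
      have "sublinear u"
        unfolding sublinear_def
      proof (intro conjI allI impI)
        fix x y
        have "u (x + y) - r y \<le> q x" if qr: "q \<in> C" "r \<in> C" for q r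
        proof -
          have sub: "sublinear q" "sublinear r" using qr CA by (auto simp: A_def)
          from tot[OF qr] show ?thesis
          proof
            assume "q \<le> r"
            then have "q y \<le> r y" by (simp add: le_fun_def)
            then show ?thesis using le[OF qr(1), of "x + y"] sublinear_add[OF sub(1), of x y] by simp
          next
            assume "r \<le> q"
            then have "r x \<le> q x" by (simp add: le_fun_def)
            then show ?thesis using le[OF qr(2), of "x + y"] sublinear_add[OF sub(2), of x y] by simp
          qed
        qed
        then have "u (x + y) - u x \<le> r y" if "r \<in> C" for r
          using great[of "u (x + y) - r y" x] that by fastforce
        then show "u (x + y) \<le> u x + u y"
          using great[of "u (x + y) - u x" y] by fastforce
      next
        fix c :: real and x assume c: "c > 0"
        have "u (c *\<^sub>R x) / c \<le> q x" if "q \<in> C" for q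
        proof -
          have "sublinear q" using that CA by (auto simp: A_def)
          then show ?thesis
            using le[OF that, of "c *\<^sub>R x"] c sublinear_scaleR[of q c x] by (simp add: field_simps)
        qed
        then show "u (c *\<^sub>R x) \<le> c * u x"
          using great[of "u (c *\<^sub>R x) / c" x] c by (simp add: field_simps)
      qed
      moreover have "u \<le> p"
      proof (rule le_funI)
        fix x
        obtain q where "q \<in> C" using False by blast
        then show "u x \<le> p x" using le[of q x] CA by (auto simp: A_def le_fun_def intro: order_trans)
      qed
      ultimately show ?thesis using le by (intro bexI[of _ u]) (auto simp: A_def le_fun_def)
    qed
  qed
  then obtain q where q: "q \<in> A" "\<And>a. a \<in> A \<Longrightarrow> a \<le> q \<Longrightarrow> a = q" by blast
  show ?thesis
  proof (rule that)
    show "sublinear q" "q \<le> p" using q(1) by (auto simp: A_def)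
    show "r = q" if "sublinear r" "r \<le> q" for r
      using q(2)[of r] that \<open>q \<le> p\<close> by (auto simp: A_def)
  qed
qed

text \<open>A minimal sublinear functional is linear, which gives the Hahn--Banach theorem.\<close>

theorem Hahn_Banach_sublinear:
  fixes p :: "'v :: real_vector \<Rightarrow> real"
  assumes p: "sublinear p"
  obtains l where "linear l" "\<And>x. l x \<le> p x" "l h = p h"
proof -
  \<comment> \<open>Descending from \<open>p'\<close> instead of \<open>p\<close> forces
    \<open>l (- h) \<le> - p h\<close>, which yields equality at \<open>h\<close>.\<close>
  obtain p' where p': "sublinear p'" "p' \<le> p" "p' (- h) \<le> - p h"
    using sublinear_minorant[OF p] .
  obtain l where l: "sublinear l" "l \<le> p'" and min: "\<And>r. sublinear r \<Longrightarrow> r \<le> l \<Longrightarrow> r = l"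
    using sublinear_minimal[OF p'(1)] by blast
  have neg: "l (- x) = - l x" for x
  proof -
    obtain r where "sublinear r" "r \<le> l" "r (- x) \<le> - l x" using sublinear_minorant[OF l(1)] .
    with min have "l (- x) \<le> - l x" by metis
    then show ?thesis using sublinear_minus[OF l(1), of x] by simp
  qed
  have add: "l (x + y) = l x + l y" for x y
    using sublinear_add[OF l(1), of x y] sublinear_add[OF l(1), of "x + y" "- y"] neg[of y] by simp
  have scale: "l (c *\<^sub>R x) = c * l x" for c x
  proof -
    consider "c > 0" | "c = 0" | "c < 0" by linarith
    then show ?thesis
    proof cases
      case 3
      then show ?thesis using sublinear_scaleR[OF l(1), of "- c" x] neg[of "c *\<^sub>R x"] by simp
    qed (simp_all add: sublinear_scaleR[OF l(1)] sublinear_zero[OF l(1)])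
  qed
  have lp: "l x \<le> p x" for x using l(2) p'(2) by (meson le_funD order_trans)
  have "l (- h) \<le> - p h" using l(2) p'(3) by (meson le_funD order_trans)
  then have "l h = p h" using lp[of h] neg[of h] by simp
  moreover have "linear l" by (rule linearI) (simp_all add: add scale)
  ultimately show ?thesis using lp that by blast
qed

text \<open>For self-adjoint \<open>x\<close> this is the supremum of the spectrum. In the zero algebra the set is not
  bounded below.\<close>

definition upper_bound :: "'a :: unital_cstar_algebra \<Rightarrow> real" where
  "upper_bound x = (INF r\<in>{0..}. norm (r *\<^sub>R 1 + x) - r)"

definition re_part :: "'a :: unital_cstar_algebra \<Rightarrow> 'a" where
  "re_part x = (1/2) *\<^sub>R (x + star x)"

definition im_part :: "'a :: unital_cstar_algebra \<Rightarrow> 'a" where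
  "im_part x = (1/2) *\<^sub>R (\<i> *\<^sub>C (star x - x))"

lemma re_part_star: "star (re_part x) = re_part x"
  by (simp add: re_part_def star_scaleR star_add star_star add.commute)

lemma im_part_star: "star (im_part x) = im_part x"
  by (simp add: im_part_def star_scaleR star_scaleC star_diff star_star cvec.scale_right_diff_distrib)

lemma re_part_plus_im_part: "x = re_part x + \<i> *\<^sub>C im_part x"
proof -
  have "\<i> *\<^sub>C im_part x = (1/2) *\<^sub>R ((\<i> * \<i>) *\<^sub>C (star x - x))"
    by (simp only: im_part_def scaleR_scaleC scaleC_scaleC mult_ac)
  also have "(\<i> * \<i>) *\<^sub>C (star x - x) = x - star x" by (simp add: cvec.scale_minus_left)
  finally have "re_part x + \<i> *\<^sub>C im_part x = (1/2) *\<^sub>R (2 *\<^sub>R x)"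
    by (simp add: re_part_def scaleR_2 flip: scaleR_add_right)
  then show ?thesis by simp
qed

lemma norm_re_part_le: "norm (re_part x) \<le> norm x"
  using norm_triangle_ineq[of x "star x"] by (simp add: re_part_def norm_star)

lemma norm_im_part_le: "norm (im_part x) \<le> norm x"
  using norm_triangle_ineq4[of "star x" x] by (simp add: im_part_def norm_star norm_scaleC)

context
  assumes one: "norm (1 :: 'a :: unital_cstar_algebra) = 1"
begin

lemma upper_bound_bdd: "bdd_below ((\<lambda>r. norm (r *\<^sub>R 1 + x) - r) ` {0..})" for x :: 'a
proof -
  have "- norm x \<le> norm (r *\<^sub>R 1 + x) - r" if "r \<ge> 0" for r
    using norm_triangle_ineq4[of "r *\<^sub>R 1 + x" x] one that by simp
  then show ?thesis by (intro bdd_belowI[of _ "- norm x"]) auto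
qed

lemma upper_bound_le: "r \<ge> 0 \<Longrightarrow> upper_bound x \<le> norm (r *\<^sub>R 1 + x) - r" for x :: 'a
  unfolding upper_bound_def by (intro cINF_lower upper_bound_bdd) simp

lemma upper_bound_greatest:
  "(\<And>r. r \<ge> 0 \<Longrightarrow> m \<le> norm (r *\<^sub>R 1 + x) - r) \<Longrightarrow> m \<le> upper_bound x" for x :: 'a
  unfolding upper_bound_def by (intro cINF_greatest) auto

lemma upper_bound_le_norm: "upper_bound x \<le> norm x" for x :: 'a
  using upper_bound_le[of 0 x] by simp

lemma sublinear_upper_bound: "sublinear (upper_bound :: 'a \<Rightarrow> real)"
  unfolding sublinear_def
proof (intro conjI allI impI)
  fix x y :: 'a
  have "upper_bound (x + y) - (norm (s *\<^sub>R 1 + y) - s) \<le> norm (r *\<^sub>R 1 + x) - r" if "r \<ge> 0" "s \<ge> 0" for r s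
    using upper_bound_le[of "r + s" "x + y"] norm_triangle_ineq[of "r *\<^sub>R 1 + x" "s *\<^sub>R 1 + y"] that
    by (simp add: algebra_simps)
  then have "upper_bound (x + y) - upper_bound x \<le> norm (s *\<^sub>R 1 + y) - s" if "s \<ge> 0" for s
    using upper_bound_greatest[of "upper_bound (x + y) - (norm (s *\<^sub>R 1 + y) - s)" x] that by fastforce
  then show "upper_bound (x + y) \<le> upper_bound x + upper_bound y"
    using upper_bound_greatest[of "upper_bound (x + y) - upper_bound x" y] by fastforce
next
  fix c :: real and x :: 'a assume c: "c > 0"
  have "upper_bound (c *\<^sub>R x) / c \<le> norm (r *\<^sub>R 1 + x) - r" if "r \<ge> 0" for r
  proof -
    have "norm ((c * r) *\<^sub>R 1 + c *\<^sub>R x) = c * norm (r *\<^sub>R 1 + x)"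
      using c by (simp flip: scaleR_scaleR scaleR_add_right)
    then show ?thesis
      using upper_bound_le[of "c * r" "c *\<^sub>R x"] c that by (simp add: field_simps)
  qed
  then show "upper_bound (c *\<^sub>R x) \<le> c * upper_bound x"
    using upper_bound_greatest[of "upper_bound (c *\<^sub>R x) / c" x] c by (simp add: field_simps)
qed

lemma upper_bound_pos_elem: "pos_elem x \<Longrightarrow> upper_bound (- x) \<le> 0" for x :: 'a
proof (rule field_le_epsilon)
  fix e :: real assume "pos_elem x" "e > 0"
  then obtain r where "r \<ge> 0" "norm (r *\<^sub>R 1 - x) \<le> r + e" by (metis pos_elemE)
  then show "upper_bound (- x) \<le> 0 + e" using upper_bound_le[of r "- x"] by simp
qed

lemma upper_bound_one: "upper_bound (1 :: 'a) \<le> 1" "upper_bound (- 1 :: 'a) \<le> - 1"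
proof -
  show "upper_bound (1 :: 'a) \<le> 1" using upper_bound_le_norm[of 1] one by simp
  show "upper_bound (- 1 :: 'a) \<le> - 1" using upper_bound_le[of 1 "- 1"] by simp
qed

text \<open>With l the larger of the two bounds, both l - h and l + h are positive: a radius
  \<open>r\<close> that nearly realises the bound of \<open>k\<close> becomes the radius r + l for l
  - k.\<close>

lemma norm_le_upper_bound:
  fixes h :: 'a assumes h: "star h = h"
  shows "norm h \<le> max (upper_bound h) (upper_bound (- h))"
proof (rule pos_elem_norm_le)
  let ?l = "max (upper_bound h) (upper_bound (- h))"
  show l0: "?l \<ge> 0" using sublinear_minus[OF sublinear_upper_bound, of h] by linarith
  have "pos_elem (?l *\<^sub>R 1 - k)" if k: "star k = k" "upper_bound k \<le> ?l" for k :: 'a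
    unfolding pos_elem_def
  proof (intro conjI allI impI)
    fix e :: real assume e: "e > 0"
    have "\<not> ?l + e \<le> upper_bound k" using k e by simp
    then obtain r where r: "r \<ge> 0" "norm (r *\<^sub>R 1 + k) - r < ?l + e"
      using upper_bound_greatest[of "?l + e" k] by force
    then show "\<exists>r\<ge>0. norm (r *\<^sub>R 1 - (?l *\<^sub>R 1 - k)) \<le> r + e"
      using l0 by (intro exI[of _ "r + ?l"]) (simp add: algebra_simps)
  qed (simp add: star_diff star_scaleR star_1 k)
  from this[of h] this[of "- h"] show "pos_elem (?l *\<^sub>R 1 - h)" "pos_elem (?l *\<^sub>R 1 + h)"
    by (simp_all add: h star_minus)
qed

text \<open>Hahn--Banach gives a real functional below \<open>upper_bound\<close> that attains it at
  the real part of \<open>h\<close>; it is complexified through real and imaginary parts. It is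
  nonnegative on \<open>star a * a\<close> because the upper bound of a negative element is at most
  0, and the upper bounds of 1 and -1 fix its value at 1.\<close>

lemma state_exists:
  obtains \<psi> where "state \<psi>" "\<And>x :: 'a. star x = x \<Longrightarrow> \<psi> x \<in> \<real>" "Re (\<psi> h) = upper_bound (re_part h)"
proof -
  obtain l where l: "linear l" and le: "\<And>x :: 'a. l x \<le> upper_bound x"
    and lh: "l (re_part h) = upper_bound (re_part h)"
    using Hahn_Banach_sublinear[OF sublinear_upper_bound] by blast
  interpret l: linear l by (rule l)
  define \<psi> where "\<psi> x = Complex (l (re_part x)) (l (im_part x))" for x
  have re_add: "re_part (x + y) = re_part x + re_part y"
    and im_add: "im_part (x + y) = im_part x + im_part y"
    and re_sc: "re_part (r *\<^sub>R x) = r *\<^sub>R re_part x"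
    and im_sc: "im_part (r *\<^sub>R x) = r *\<^sub>R im_part x"
    and re_i: "re_part (\<i> *\<^sub>C x) = - im_part x"
    and im_i: "im_part (\<i> *\<^sub>C x) = re_part x" for x y :: 'a and r
  proof -
    show "re_part (x + y) = re_part x + re_part y"
      by (simp add: re_part_def star_add algebra_simps)
    show "im_part (x + y) = im_part x + im_part y"
      by (simp add: im_part_def star_add scaleC_add_right scaleR_add_right cvec.scale_right_diff_distrib algebra_simps)
    show "re_part (r *\<^sub>R x) = r *\<^sub>R re_part x"
      by (simp add: re_part_def star_scaleR algebra_simps)
    show "im_part (r *\<^sub>R x) = r *\<^sub>R im_part x"
      by (simp add: im_part_def scaleR_scaleC scaleC_scaleC star_scaleC mult_ac cvec.scale_right_diff_distrib)
    show "re_part (\<i> *\<^sub>C x) = - im_part x"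
      by (simp add: re_part_def im_part_def star_scaleC cvec.scale_right_diff_distrib cvec.scale_minus_left
          flip: scaleR_minus_right)
    show "im_part (\<i> *\<^sub>C x) = re_part x"
      by (simp add: re_part_def im_part_def star_scaleC cvec.scale_right_diff_distrib scaleC_scaleC
          cvec.scale_minus_left add.commute)
  qed
  have add: "\<psi> (x + y) = \<psi> x + \<psi> y" for x y
    by (simp add: \<psi>_def re_add im_add l.add complex_eq_iff)
  have scR: "\<psi> (r *\<^sub>R x) = of_real r * \<psi> x" for r x
    by (simp add: \<psi>_def re_sc im_sc l.scale complex_eq_iff)
  have sci: "\<psi> (\<i> *\<^sub>C x) = \<i> * \<psi> x" for x
    by (simp add: \<psi>_def re_i im_i l.neg complex_eq_iff)
  have sc: "\<psi> (c *\<^sub>C x) = c * \<psi> x" for c x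
  proof -
    have "c *\<^sub>C x = Re c *\<^sub>R x + Im c *\<^sub>R (\<i> *\<^sub>C x)"
      by (simp add: scaleR_scaleC scaleC_scaleC complex_eq mult.commute flip: scaleC_add_left)
    then show ?thesis by (simp add: add scR sci complex_eq_iff)
  qed
  have lin: "clinear \<psi>"
    unfolding clinear_def by unfold_locales (simp_all add: add sc scaleC_complex_def algebra_simps)
  have labs: "\<bar>l y\<bar> \<le> norm y" for y
    using le[of y] le[of "- y"] upper_bound_le_norm[of y] upper_bound_le_norm[of "- y"]
    by (simp add: l.neg)
  have "norm (\<psi> x) \<le> 2 * norm x" for x
    using cmod_le[of "\<psi> x"] labs[of "re_part x"] labs[of "im_part x"]
      norm_re_part_le[of x] norm_im_part_le[of x]
    by (simp add: \<psi>_def)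
  then have bd: "bounded_clinear \<psi>" using lin by (auto simp: bounded_clinear_def)
  have sa: "re_part x = x" "im_part x = 0" if "star x = x" for x :: 'a
    using that by (simp_all add: re_part_def im_part_def flip: scaleR_2)
  have real: "\<psi> x = of_real (l x)" if "star x = x" for x
    using sa[OF that] by (simp add: \<psi>_def l.zero complex_eq_iff)
  have "\<psi> (star a * a) \<in> \<real>\<^sub>\<ge>\<^sub>0" for a
    using le[of "- (star a * a)"] upper_bound_pos_elem[OF pos_elem_star_mult[of a]]
    by (subst real) (simp_all add: star_mult star_star l.neg)
  moreover have "\<psi> 1 = 1"
    using le[of 1] le[of "- 1"] upper_bound_one by (subst real) (simp_all add: star_1 l.neg)
  ultimately have "state \<psi>" using bd by (simp add: state_def)
  then show ?thesis
    by (rule that) (simp_all add: real, simp add: \<psi>_def lh)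
qed

end


section \<open>States determine the norm, and positive functionals are bounded\<close>

lemma norm_one_eq: "x \<noteq> 0 \<Longrightarrow> norm (1 :: 'a) = 1" for x :: "'a :: unital_cstar_algebra"
proof -
  assume x: "x \<noteq> 0"
  have "norm x \<le> norm (1 :: 'a) * norm x" using norm_mult_ineq[of 1 x] by simp
  then have "1 \<le> norm (1 :: 'a)" using x by simp
  then show ?thesis using norm_one_le[where 'a='a] by simp
qed

lemma state_clinear: "state \<phi> \<Longrightarrow> clinear \<phi>"
  by (simp add: state_def bounded_clinear_def)

lemma state_one: "state \<phi> \<Longrightarrow> \<phi> 1 = 1"
  by (simp add: state_def)

lemma state_norm_selfadjoint:
  fixes h :: "'a :: unital_cstar_algebra"
  assumes h: "star h = h" and one: "norm (1 :: 'a) = 1"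
  obtains \<psi> where "state \<psi>" "norm h \<le> cmod (\<psi> h)"
proof -
  have re: "re_part k = k" if "star k = k" for k :: 'a
    using that by (simp add: re_part_def flip: scaleR_2)
  note result = that
  have *: thesis if k: "star k = k" "norm h \<le> upper_bound k" "k = h \<or> k = - h" for k
  proof -
    obtain \<psi> where \<psi>: "state \<psi>" "Re (\<psi> k) = upper_bound (re_part k)"
      using state_exists[OF one] by metis
    have "norm h \<le> cmod (\<psi> k)" using \<psi>(2) k re[OF k(1)] complex_Re_le_cmod[of "\<psi> k"] by simp
    moreover have "\<psi> (- h) = - \<psi> h"
      using positive_functional.minus[OF state_positive_functional[OF \<psi>(1)]] .
    ultimately have "norm h \<le> cmod (\<psi> h)" using k(3) by auto
    then show thesis using result \<psi>(1) by blast
  qed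
  show thesis
    using norm_le_upper_bound[OF one h] *[of h] *[of "- h"] h
    by (simp add: star_minus max_def split: if_splits)
qed

text \<open>The Gelfand--Naimark theorem, up to a factor.\<close>

theorem state_norm:
  fixes x :: "'a :: unital_cstar_algebra"
  assumes x: "x \<noteq> 0"
  obtains \<psi> where "state \<psi>" "norm x \<le> 2 * cmod (\<psi> x)"
proof -
  note one = norm_one_eq[OF x]
  \<comment> \<open>The larger of the two parts carries at least half of the norm; this is the
    origin of the factor 2.\<close>
  define y where "y = (if norm (im_part x) \<le> norm (re_part x) then re_part x else im_part x)"
  have y: "star y = y" by (simp add: y_def re_part_star im_part_star)
  have "norm x \<le> norm (re_part x) + norm (\<i> *\<^sub>C im_part x)"
    using norm_triangle_ineq[of "re_part x" "\<i> *\<^sub>C im_part x"] by (simp flip: re_part_plus_im_part)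
  then have xy: "norm x \<le> 2 * norm y" by (auto simp: y_def norm_scaleC)
  obtain \<psi> where \<psi>: "state \<psi>" "norm y \<le> cmod (\<psi> y)" using state_norm_selfadjoint[OF y one] .
  interpret \<psi>: positive_functional scaleC star \<psi> by (rule state_positive_functional[OF \<psi>(1)])
  have real: "Im (\<psi> z) = 0" if "star z = z" for z
    using \<psi>.hermitian'[of z] that by (simp add: complex_eq_iff)
  have "\<psi> x = \<psi> (re_part x) + \<i> * \<psi> (im_part x)"
    by (metis re_part_plus_im_part \<psi>.add \<psi>.sc)
  then have "Re (\<psi> x) = Re (\<psi> (re_part x))" "Im (\<psi> x) = Re (\<psi> (im_part x))"
    using real[OF re_part_star] real[OF im_part_star] by simp_all
  moreover have "cmod (\<psi> y) = \<bar>Re (\<psi> y)\<bar>" using real[OF y] by (simp add: cmod_eq_Re)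
  ultimately have "cmod (\<psi> y) \<le> cmod (\<psi> x)"
    by (auto simp: y_def abs_Re_le_cmod) (metis abs_Im_le_cmod abs_Re_le_cmod)+
  then show ?thesis using \<psi> xy that by fastforce
qed

lemma state_separating:
  assumes "\<And>\<psi>. state \<psi> \<Longrightarrow> \<psi> x = 0" shows "x = (0 :: 'a :: unital_cstar_algebra)"
proof (rule ccontr)
  assume "x \<noteq> 0"
  then obtain \<psi> where "state \<psi>" "norm x \<le> 2 * cmod (\<psi> x)" by (rule state_norm)
  then show False using assms[of \<psi>] \<open>x \<noteq> 0\<close> by simp
qed

lemma norm_le_states:
  assumes "\<And>\<psi>. state \<psi> \<Longrightarrow> cmod (\<psi> x) \<le> K" and "K \<ge> 0"
  shows "norm (x :: 'a :: unital_cstar_algebra) \<le> 2 * K"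
proof (cases "x = 0")
  case False
  then obtain \<psi> where "state \<psi>" "norm x \<le> 2 * cmod (\<psi> x)" by (rule state_norm)
  then show ?thesis using assms(1)[of \<psi>] by simp
qed (use assms in simp)

text \<open>x + d is the square of a self-adjoint element. As continuity of \<Phi> is not yet
  available, the limit in d is taken in the scalar term d \<Phi>(1).\<close>

lemma positive_functional_pos_elem:
  fixes x :: "'a :: unital_cstar_algebra"
  assumes \<Phi>: "positive_functional scaleC star \<Phi>" and x: "pos_elem x"
  shows "Re (\<Phi> x) \<ge> 0"
proof -
  interpret positive_functional scaleC star \<Phi> by (rule \<Phi>)
  have one: "Re (\<Phi> 1) \<ge> 0" using q_ge_0[of 1] by (simp add: star_1)
  have scR: "Re (\<Phi> (r *\<^sub>R y)) = r * Re (\<Phi> y)" for r y by (simp add: scaleR_scaleC sc)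
  have "0 \<le> Re (\<Phi> x) + e" if e: "e > 0" for e
  proof -
    define d where "d = e / (Re (\<Phi> 1) + 1)"
    have d: "d > 0" using e one by (simp add: d_def)
    obtain c where c: "c * c = x + d *\<^sub>R 1" "pos_elem c" using pos_elem_sqrt[OF x d] by metis
    have "0 \<le> Re (\<Phi> (c * c))" using q_ge_0[of c] by (simp add: pos_elem_star[OF c(2)])
    also have "\<dots> = Re (\<Phi> x) + d * Re (\<Phi> 1)" by (simp add: c add scR)
    also have "d * Re (\<Phi> 1) \<le> d * (Re (\<Phi> 1) + 1)" using d by simp
    also have "\<dots> = e" using one by (simp add: d_def)
    finally show ?thesis by simp
  qed
  then show ?thesis by (rule field_le_epsilon)
qed

text \<open>The compressed functional sending x to \<Phi>(\<open>star s * x * s\<close>) is again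
  positive, and it is applied to the positive element (norm y)^2 -
  \<open>star y * y\<close>.\<close>

lemma positive_functional_square_le:
  fixes y s :: "'a :: unital_cstar_algebra"
  assumes \<Phi>: "positive_functional scaleC star \<Phi>"
  shows "Re (\<Phi> (star (y * s) * (y * s))) \<le> (norm y)\<^sup>2 * Re (\<Phi> (star s * s))"
proof -
  interpret positive_functional scaleC star \<Phi> by (rule \<Phi>)
  define \<Psi> where "\<Psi> x = \<Phi> (star s * x * s)" for x
  interpret \<Psi>: positive_functional scaleC star \<Psi>
  proof
    show "Im (\<Psi> (star x * x)) = 0 \<and> 0 \<le> Re (\<Psi> (star x * x))" for x
      using pos[of "x * s"] by (simp add: \<Psi>_def star_mult mult.assoc)
  qed (simp_all add: \<Psi>_def distrib_left distrib_right add sc mult_scaleC_left mult_scaleC_right)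
  have scR: "Re (\<Psi> (r *\<^sub>R x)) = r * Re (\<Psi> x)" for r x by (simp add: scaleR_scaleC \<Psi>.sc)
  have "pos_elem ((norm y)\<^sup>2 *\<^sub>R 1 - star y * y)"
    by (rule pos_elem_norm_minus) (simp_all add: star_mult star_star cstar_identity)
  then have "0 \<le> Re (\<Psi> ((norm y)\<^sup>2 *\<^sub>R 1 + - (star y * y)))"
    using positive_functional_pos_elem[OF \<Psi>.positive_functional_axioms] by simp
  then have "Re (\<Psi> (star y * y)) \<le> (norm y)\<^sup>2 * Re (\<Psi> 1)"
    unfolding \<Psi>.add \<Psi>.minus by (simp add: scR)
  then show ?thesis by (simp add: \<Psi>_def star_mult mult.assoc)
qed

text \<open>Cauchy--Schwarz against 1. Continuity of positive functionals is thus automatic.\<close>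

lemma positive_functional_bounded:
  fixes x :: "'a :: unital_cstar_algebra"
  assumes \<Phi>: "positive_functional scaleC star \<Phi>"
  shows "cmod (\<Phi> x) \<le> Re (\<Phi> 1) * norm x"
proof -
  interpret positive_functional scaleC star \<Phi> by (rule \<Phi>)
  have one: "Re (\<Phi> 1) \<ge> 0" using q_ge_0[of 1] by (simp add: star_1)
  have "(cmod (\<Phi> x))\<^sup>2 \<le> Re (\<Phi> 1) * q x" using Cauchy_Schwarz[of 1 x] by (simp add: star_1)
  also have "\<dots> \<le> Re (\<Phi> 1) * ((norm x)\<^sup>2 * Re (\<Phi> 1))"
    using positive_functional_square_le[OF \<Phi>, of x 1] one by (intro mult_left_mono) (simp_all add: star_1)
  also have "\<dots> = (Re (\<Phi> 1) * norm x)\<^sup>2" by (simp add: power2_eq_square)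
  finally show ?thesis by (rule power2_le_imp_le) (simp add: one)
qed

lemma state_norm_le: "state \<phi> \<Longrightarrow> cmod (\<phi> x) \<le> norm x"
  using positive_functional_bounded[OF state_positive_functional, of \<phi> x] by (simp add: state_one)

lemma positive_functional_state:
  fixes \<Phi> :: "'a :: unital_cstar_algebra \<Rightarrow> complex"
  assumes \<Phi>: "positive_functional scaleC star \<Phi>" and one: "\<Phi> 1 = 1"
  shows "state \<Phi>"
proof -
  interpret positive_functional scaleC star \<Phi> by (rule \<Phi>)
  have "clinear \<Phi>"
    unfolding clinear_def by unfold_locales (simp_all add: add sc scaleC_complex_def algebra_simps)
  moreover have "norm (\<Phi> x) \<le> 1 * norm x" for x
    using positive_functional_bounded[OF \<Phi>, of x] one by simp
  moreover have "\<Phi> (star a * a) \<in> \<real>\<^sub>\<ge>\<^sub>0" for a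
    using pos[of a] by (simp add: complex_nonneg_Reals_iff)
  ultimately show ?thesis using one unfolding state_def bounded_clinear_def by blast
qed

text \<open>The zero functional is a separate case because an algebra without states offers no
  \<phi> of which it could be a multiple.\<close>

lemma positive_functional_multiple_state:
  fixes \<Phi> :: "'a :: unital_cstar_algebra \<Rightarrow> complex"
  assumes \<Phi>: "positive_functional scaleC star \<Phi>"
  shows "\<Phi> = (\<lambda>_. 0) \<or> (\<exists>c \<phi>. state \<phi> \<and> \<Phi> = (\<lambda>x. c * \<phi> x))"
proof -
  interpret positive_functional scaleC star \<Phi> by (rule \<Phi>)
  have im: "Im (\<Phi> 1) = 0" and re: "Re (\<Phi> 1) \<ge> 0" using pos[of 1] by (simp_all add: star_1)
  define r where "r = Re (\<Phi> 1)"
  have r: "\<Phi> 1 = of_real r" using im by (simp add: r_def complex_eq_iff)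
  show ?thesis
  proof (cases "r = 0")
    case True
    then have "\<Phi> x = 0" for x using positive_functional_bounded[OF \<Phi>, of x] r by simp
    then show ?thesis by auto
  next
    case False
    then have "r > 0" using re by (simp add: r_def)
    have "positive_functional scaleC star (\<lambda>x. \<Phi> x / of_real r)"
    proof
      show "Im (\<Phi> (star x * x) / of_real r) = 0 \<and> 0 \<le> Re (\<Phi> (star x * x) / of_real r)" for x
        using pos[of x] \<open>r > 0\<close> by simp
    qed (simp_all add: add sc add_divide_distrib)
    then have "state (\<lambda>x. \<Phi> x / of_real r)"
      by (rule positive_functional_state) (use False r in simp)
    moreover have "\<Phi> = (\<lambda>x. of_real r * (\<Phi> x / of_real r))" using False by auto
    ultimately show ?thesis by blast
  qed
qed

section \<open>Extension of bilinear maps to the minimal tensor product\<close>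

lemma clinearI:
  assumes "\<And>x y. f (x + y) = f x + f y" "\<And>c x. f (c *\<^sub>C x) = c *\<^sub>C f x"
  shows "clinear f"
  unfolding clinear_def by unfold_locales (simp_all add: assms scaleC_add_right scaleC_add_left scaleC_scaleC)

lemma clinear_0: "clinear f \<Longrightarrow> f 0 = 0"
  using clinear_scaleC[of f 0 0] by simp

lemma clinear_diff: "clinear f \<Longrightarrow> f (x - y) = f x - f y"
  using clinear_add[of f "x - y" y] by simp

lemma clinear_sum: "clinear f \<Longrightarrow> f (\<Sum>i\<in>I. g i) = (\<Sum>i\<in>I. f (g i))"
  by (induction I rule: infinite_finite_induct) (simp_all add: clinear_0 clinear_add)

lemma bounded_clinear_clinear: "bounded_clinear f \<Longrightarrow> clinear f"
  by (simp add: bounded_clinear_def)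

lemma bounded_clinearI:
  assumes "clinear f" "\<And>x. norm (f x) \<le> K * norm x" shows "bounded_clinear f"
  using assms unfolding bounded_clinear_def by blast

lemma bounded_clinear_bounded_linear: "bounded_clinear f \<Longrightarrow> bounded_linear f"
proof -
  assume "bounded_clinear f"
  then obtain K where "clinear f" "\<And>x. norm (f x) \<le> K * norm x"
    unfolding bounded_clinear_def by blast
  then show ?thesis
    by (intro bounded_linear_intro[where K=K])
      (simp_all add: clinear_add clinear_scaleC scaleR_scaleC mult.commute)
qed

lemma bounded_clinear_iff:
  "bounded_clinear f \<longleftrightarrow> bounded_linear f \<and> (\<forall>c x. f (c *\<^sub>C x) = c *\<^sub>C f x)"
proof
  assume "bounded_linear f \<and> (\<forall>c x. f (c *\<^sub>C x) = c *\<^sub>C f x)"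
  then show "bounded_clinear f"
    by (intro bounded_clinearI[where K="onorm f"] clinearI)
      (auto simp: linear_simps onorm)
qed (simp add: bounded_clinear_bounded_linear bounded_clinear_clinear clinear_scaleC)

lemma bounded_clinear_continuous:
  "bounded_clinear f \<Longrightarrow> continuous_on S g \<Longrightarrow> continuous_on S (\<lambda>x. f (g x))"
  by (rule bounded_linear.continuous_on[OF bounded_clinear_bounded_linear])

lemma bounded_clinear_intros:
  "bounded_clinear (\<lambda>x. x)"
  "bounded_clinear f \<Longrightarrow> bounded_clinear (\<lambda>x. a * f x)"
  "bounded_clinear f \<Longrightarrow> bounded_clinear (\<lambda>x. f x * a)"
  "bounded_clinear f \<Longrightarrow> bounded_clinear (\<lambda>x. c *\<^sub>C f x)"
  "bounded_clinear f \<Longrightarrow> bounded_clinear g \<Longrightarrow> bounded_clinear (\<lambda>x. f x + g x)"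
  "bounded_clinear h \<Longrightarrow> bounded_clinear f \<Longrightarrow> bounded_clinear (\<lambda>x. h (f x))"
  "(\<And>i. i \<in> I \<Longrightarrow> bounded_clinear (k i)) \<Longrightarrow> bounded_clinear (\<lambda>x. \<Sum>i\<in>I. k i x)"
  unfolding bounded_clinear_iff
  by (auto intro!: bounded_linear_ident bounded_linear_const_mult bounded_linear_mult_const
      bounded_linear_compose[OF bounded_linear_scaleC] bounded_linear_add bounded_linear_sum
      bounded_linear_compose[of h f]
      simp: mult_scaleC_left mult_scaleC_right scaleC_scaleC scaleC_add_right mult.commute
        cvec.scale_sum_right)

lemma state_bounded_clinear: "state \<phi> \<Longrightarrow> bounded_clinear \<phi>"
  by (simp add: state_def)

section \<open>Passage from formal tensors to the completion\<close>

lemma tensor_dense_induct: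
  fixes x :: "'a :: unital_cstar_algebra \<otimes>\<^sub>m 'b :: unital_cstar_algebra"
  assumes "closed {x. P x}" and "\<And>t. P (of_pretensor t)"
  shows "P x"
proof -
  have "x \<in> closure {x. P x}"
    unfolding closure_approachable dist_norm
  proof (intro allI impI)
    fix e :: real assume "e > 0"
    then obtain t where "norm (x - of_pretensor t) < e" using of_pretensor_dense by blast
    then show "\<exists>y\<in>{x. P x}. norm (y - x) < e"
      using assms(2)[of t] by (intro bexI[of _ "of_pretensor t"]) (simp_all add: norm_minus_commute)
  qed
  then show ?thesis using assms(1) by simp
qed

text \<open>The linear extension lives on the free vector space, so \<beta> need not be bilinear. A
  bound by \<open>min_seminorm\<close> later makes it vanish on the bilinearity relations.\<close>

definition pretensor_lift ::
    "('a \<Rightarrow> 'b \<Rightarrow> 'c :: unital_cstar_algebra) \<Rightarrow> ('a, 'b) pretensor \<Rightarrow> 'c" where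
  "pretensor_lift \<beta> t =
     (\<Sum>k\<in>Poly_Mapping.keys t. Poly_Mapping.lookup t k *\<^sub>C \<beta> (left_factor k) (right_factor k))"

lemma pretensor_lift_single [simp]:
  "pretensor_lift \<beta> (Poly_Mapping.single k c) = c *\<^sub>C \<beta> (left_factor k) (right_factor k)"
  by (simp add: pretensor_lift_def)

lemma pretensor_lift_add: "pretensor_lift \<beta> (s + t) = pretensor_lift \<beta> s + pretensor_lift \<beta> t"
  unfolding pretensor_lift_def
  by (rule setsum_keys_plus_distrib[of "\<lambda>k c. c *\<^sub>C \<beta> (left_factor k) (right_factor k)"])
    (simp_all add: scaleC_add_left)

lemma pretensor_lift_diff: "pretensor_lift \<beta> (s - t) = pretensor_lift \<beta> s - pretensor_lift \<beta> t"
  using pretensor_lift_add[of \<beta> "s - t" t] by simp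

lemma pretensor_lift_pscale:
  fixes t :: "('a :: monoid_mult, 'b :: monoid_mult) pretensor"
  shows "pretensor_lift \<beta> (pscale c t) = c *\<^sub>C pretensor_lift \<beta> t"
  by (induction t rule: pretensor_induct)
    (simp_all add: mult_single distrib_left pretensor_lift_add scaleC_scaleC scaleC_add_right)

lemma pretensor_lift_tens:
  "pretensor_lift (\<lambda>a b. a \<otimes>\<^sub>m b) t = of_pretensor t"
proof (induction t rule: pretensor_induct)
  case (single k c)
  have "Poly_Mapping.single k c = pscale c (Poly_Mapping.single (Elementary (left_factor k) (right_factor k)) 1)"
    by (simp add: mult_single)
  then have "of_pretensor (Poly_Mapping.single k c) = c *\<^sub>C (left_factor k \<otimes>\<^sub>m right_factor k)"
    unfolding tens_def by (simp only: of_pretensor_pscale)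
  then show ?case by simp
qed (simp add: pretensor_lift_add of_pretensor_add)

lemma pretensor_lift_comp:
  assumes "clinear h" shows "h (pretensor_lift \<beta> t) = pretensor_lift (\<lambda>a b. h (\<beta> a b)) t"
  by (simp add: pretensor_lift_def clinear_sum[OF assms] clinear_scaleC[OF assms])

lemma product_functional_eq_lift: "product_functional \<phi> \<psi> = pretensor_lift (\<lambda>a b. \<phi> a * \<psi> b)"
  by (simp add: fun_eq_iff product_functional_def pretensor_lift_def scaleC_complex_def)

text \<open>The bound makes the lift Lipschitz for the seminorm, so limits along approximating
  sequences exist and do not depend on the sequence. Uniqueness of bounded extensions identifies the
  limit map with the definite description.\<close>

lemma tensor_extension_exists:
  fixes \<beta> :: "'a :: unital_cstar_algebra \<Rightarrow> 'b :: unital_cstar_algebra \<Rightarrow> 'c :: unital_cstar_algebra"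
  assumes bnd: "\<And>t. norm (pretensor_lift \<beta> t) \<le> K * min_seminorm t"
  shows "bounded_clinear (tensor_extension \<beta>)"
    and "tensor_extension \<beta> (of_pretensor t) = pretensor_lift \<beta> t"
    and "tensor_extension \<beta> (a \<otimes>\<^sub>m b) = \<beta> a b"
    and "norm (tensor_extension \<beta> x) \<le> K * norm x"
proof -
  let ?L = "pretensor_lift \<beta>"
  have bnd': "norm (?L s - ?L t) \<le> K * norm (of_pretensor s - of_pretensor t)" for s t
    using bnd[of "s - t"]
    by (simp add: pretensor_lift_diff norm_of_pretensor flip: of_pretensor_diff)
  have ex: "\<exists>v. (\<lambda>n. of_pretensor (v n)) \<longlonglongrightarrow> x" for x :: "'a \<otimes>\<^sub>m 'b"
  proof -
    have "\<exists>v. \<forall>n. norm (x - of_pretensor (v n)) < inverse (real (Suc n))"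
      by (intro choice allI of_pretensor_dense) simp
    then obtain v where v: "\<And>n. norm (x - of_pretensor (v n)) < inverse (real (Suc n))" by blast
    have "(\<lambda>n. of_pretensor (v n) - x) \<longlonglongrightarrow> 0"
      by (rule Lim_null_comparison[OF _ LIMSEQ_inverse_real_of_nat])
        (use v in \<open>auto intro!: always_eventually less_imp_le simp: norm_minus_commute\<close>)
    then show ?thesis using LIM_zero_iff by blast
  qed
  have lim0: "(\<lambda>n. ?L (v n) - ?L (w n)) \<longlonglongrightarrow> 0"
    if "(\<lambda>n. of_pretensor (v n)) \<longlonglongrightarrow> x" "(\<lambda>n. of_pretensor (w n)) \<longlonglongrightarrow> x" for v w x
  proof (rule Lim_null_comparison)
    show "\<forall>\<^sub>F n in sequentially. norm (?L (v n) - ?L (w n)) \<le> K * norm (of_pretensor (v n) - of_pretensor (w n))"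
      using bnd' by simp
    have "(\<lambda>n. of_pretensor (v n) - of_pretensor (w n)) \<longlonglongrightarrow> x - x" by (intro tendsto_diff that)
    from tendsto_mult_left[OF tendsto_norm[OF this], of K] show "(\<lambda>n. K * norm (of_pretensor (v n) - of_pretensor (w n))) \<longlonglongrightarrow> 0" by simp
  qed
  have "\<exists>l. \<forall>v. (\<lambda>n. of_pretensor (v n)) \<longlonglongrightarrow> x \<longrightarrow> (\<lambda>n. ?L (v n)) \<longlonglongrightarrow> l" for x :: "'a \<otimes>\<^sub>m 'b"
  proof -
    obtain v where v: "(\<lambda>n. of_pretensor (v n)) \<longlonglongrightarrow> x" using ex by blast
    \<comment> \<open>\<open>K\<close> carries no sign, so a strictly positive constant replaces it
      before dividing.\<close>
    have K: "norm (?L s - ?L t) \<le> (\<bar>K\<bar> + 1) * norm (of_pretensor s - of_pretensor t)" for s t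
      by (rule order_trans[OF bnd']) (simp add: mult_right_mono)
    have "Cauchy (\<lambda>n. ?L (v n))"
    proof (rule metric_CauchyI)
      fix e :: real assume e: "e > 0"
      have "Cauchy (\<lambda>n. of_pretensor (v n))" using v by (rule LIMSEQ_imp_Cauchy)
      moreover have "e / (\<bar>K\<bar> + 1) > 0" using e by (simp add: add_nonneg_pos)
      ultimately obtain M where M: "\<And>m n. m \<ge> M \<Longrightarrow> n \<ge> M \<Longrightarrow>
          norm (of_pretensor (v m) - of_pretensor (v n)) < e / (\<bar>K\<bar> + 1)"
        using CauchyD by blast
      have "dist (?L (v m)) (?L (v n)) < e" if "m \<ge> M" "n \<ge> M" for m n
      proof -
        have "(\<bar>K\<bar> + 1) * norm (of_pretensor (v m) - of_pretensor (v n)) < e"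
          using M[OF that] by (simp add: pos_less_divide_eq mult.commute add_nonneg_pos)
        then show ?thesis using K[of "v m" "v n"] by (simp add: dist_norm)
      qed
      then show "\<exists>M. \<forall>m\<ge>M. \<forall>n\<ge>M. dist (?L (v m)) (?L (v n)) < e" by blast
    qed
    then obtain l where l: "(\<lambda>n. ?L (v n)) \<longlonglongrightarrow> l" using Cauchy_convergent convergent_def by blast
    have "(\<lambda>n. ?L (w n)) \<longlonglongrightarrow> l" if w: "(\<lambda>n. of_pretensor (w n)) \<longlonglongrightarrow> x" for w
      using tendsto_add[OF lim0[OF w v] l] by simp
    then show ?thesis by blast
  qed
  then obtain h where h: "\<And>x v. (\<lambda>n. of_pretensor (v n)) \<longlonglongrightarrow> x \<Longrightarrow> (\<lambda>n. ?L (v n)) \<longlonglongrightarrow> h x"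
    by metis
  have lin: "clinear h"
  proof (rule clinearI)
    fix x y :: "'a \<otimes>\<^sub>m 'b" and c
    obtain v w where v: "(\<lambda>n. of_pretensor (v n)) \<longlonglongrightarrow> x" and w: "(\<lambda>n. of_pretensor (w n)) \<longlonglongrightarrow> y"
      using ex by metis
    have "(\<lambda>n. of_pretensor (v n + w n)) \<longlonglongrightarrow> x + y"
      using tendsto_add[OF v w] by (simp add: of_pretensor_add)
    from h[OF this] have "(\<lambda>n. ?L (v n) + ?L (w n)) \<longlonglongrightarrow> h (x + y)" by (simp add: pretensor_lift_add)
    then show "h (x + y) = h x + h y"
      using tendsto_add[OF h[OF v] h[OF w]] LIMSEQ_unique by blast
    have "(\<lambda>n. of_pretensor (pscale c (v n))) \<longlonglongrightarrow> c *\<^sub>C x"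
      using bounded_linear.tendsto[OF bounded_linear_scaleC v, of c] by (simp add: of_pretensor_pscale)
    from h[OF this] have "(\<lambda>n. c *\<^sub>C ?L (v n)) \<longlonglongrightarrow> h (c *\<^sub>C x)" by (simp add: pretensor_lift_pscale)
    then show "h (c *\<^sub>C x) = c *\<^sub>C h x"
      using bounded_linear.tendsto[OF bounded_linear_scaleC h[OF v], of c] LIMSEQ_unique by blast
  qed
  have nh: "norm (h x) \<le> K * norm x" for x
  proof -
    obtain v where v: "(\<lambda>n. of_pretensor (v n)) \<longlonglongrightarrow> x" using ex by blast
    have "(\<lambda>n. K * norm (of_pretensor (v n))) \<longlonglongrightarrow> K * norm x"
      by (intro tendsto_intros v)
    then show ?thesis
      using bnd by (intro LIMSEQ_le[OF tendsto_norm[OF h[OF v]]]) (auto simp: norm_of_pretensor)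
  qed
  have hp: "h (of_pretensor t) = ?L t" for t
    by (rule LIMSEQ_unique[OF h[OF tendsto_const] tendsto_const])
  have bc: "bounded_clinear h" using lin nh by (rule bounded_clinearI)
  have ht: "h (a \<otimes>\<^sub>m b) = \<beta> a b" for a b
    by (simp add: tens_def hp cvec.scale_one)
  have "tensor_extension \<beta> = h" by (rule tensor_extension_eqI[OF bc ht])
  then show "bounded_clinear (tensor_extension \<beta>)"
    "tensor_extension \<beta> (of_pretensor t) = pretensor_lift \<beta> t"
    "tensor_extension \<beta> (a \<otimes>\<^sub>m b) = \<beta> a b"
    "norm (tensor_extension \<beta> x) \<le> K * norm x"
    by (simp_all add: bc hp ht nh)
qed

lemma pretensor_lift_mult:
  fixes \<beta> :: "'a :: monoid_mult \<Rightarrow> 'b :: monoid_mult \<Rightarrow> 'c :: unital_cstar_algebra"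
  assumes "\<And>a a' b b'. \<beta> (a * a') (b * b') = \<beta> a b * \<beta> a' b'"
  shows "pretensor_lift \<beta> (s * t) = pretensor_lift \<beta> s * pretensor_lift \<beta> t"
proof (induction s rule: pretensor_induct)
  case (single k c)
  show ?case
    by (induction t rule: pretensor_induct)
      (simp_all add: mult_single plus_elementary_def assms pretensor_lift_add distrib_left
        mult_scaleC_left mult_scaleC_right scaleC_scaleC)
qed (simp add: distrib_right pretensor_lift_add)

lemma pretensor_lift_star:
  assumes "\<And>a b. \<beta> (star a) (star b) = star (\<beta> a b)"
  shows "pretensor_lift \<beta> (pretensor_star t) = star (pretensor_lift \<beta> t)"
  by (induction t rule: pretensor_induct)
    (simp_all add: pretensor_star_add pretensor_lift_add star_add assms star_scaleC)

lemma pretensor_lift_one: "pretensor_lift \<beta> (1 :: ('a :: monoid_mult, 'b :: monoid_mult) pretensor) = \<beta> 1 1"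
  by (simp add: cvec.scale_one flip: single_one)

lemma tensor_extension_star_hom:
  fixes \<beta> :: "'a :: unital_cstar_algebra \<Rightarrow> 'b :: unital_cstar_algebra \<Rightarrow> 'c :: unital_cstar_algebra"
  assumes bnd: "\<And>t. norm (pretensor_lift \<beta> t) \<le> K * min_seminorm t"
    and mult: "\<And>a a' b b'. \<beta> (a * a') (b * b') = \<beta> a b * \<beta> a' b'"
    and st: "\<And>a b. \<beta> (star a) (star b) = star (\<beta> a b)" and one: "\<beta> 1 1 = 1"
  shows "unital_star_hom (tensor_extension \<beta>)"
proof -
  let ?h = "tensor_extension \<beta>"
  note h = tensor_extension_exists[OF bnd]
  have c: "continuous_on UNIV ?h"
    using bounded_clinear_continuous[OF h(1) continuous_on_id] .
  have cs: "continuous_on UNIV (star :: 'z \<Rightarrow> 'z :: unital_cstar_algebra)"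
    using bounded_linear.continuous_on[OF bounded_linear_star continuous_on_id] .
  have m0: "?h (of_pretensor s * of_pretensor t) = ?h (of_pretensor s) * ?h (of_pretensor t)" for s t
    by (simp add: h pretensor_lift_mult[of \<beta>, OF mult] flip: of_pretensor_mult)
  have cl1: "closed {y. ?h (z * y) = ?h z * ?h y}" for z
    by (intro closed_Collect_eq continuous_on_compose2[OF c, of _ "\<lambda>y. z * y"]
        continuous_on_mult_left c continuous_on_id subset_UNIV)
  have m1: "?h (of_pretensor s * y) = ?h (of_pretensor s) * ?h y" for s y
    by (rule tensor_dense_induct[where P="\<lambda>y. ?h (of_pretensor s * y) = ?h (of_pretensor s) * ?h y", OF cl1 m0])
  have cl2: "closed {x. ?h (x * y) = ?h x * ?h y}" for y
    by (intro closed_Collect_eq continuous_on_compose2[OF c, of _ "\<lambda>x. x * y"]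
        continuous_on_mult_right c continuous_on_id subset_UNIV)
  have m: "?h (x * y) = ?h x * ?h y" for x y
    by (rule tensor_dense_induct[where P="\<lambda>x. ?h (x * y) = ?h x * ?h y", OF cl2 m1])
  have s0: "?h (star (of_pretensor t)) = star (?h (of_pretensor t))" for t
    by (simp add: h pretensor_lift_star[of \<beta>, OF st] flip: of_pretensor_star)
  have cl3: "closed {x. ?h (star x) = star (?h x)}"
    by (intro closed_Collect_eq continuous_on_compose2[OF c cs] continuous_on_compose2[OF cs c] subset_UNIV)
  have s: "?h (star x) = star (?h x)" for x
    by (rule tensor_dense_induct[where P="\<lambda>x. ?h (star x) = star (?h x)", OF cl3 s0])
  have "?h 1 = 1" using h(3)[of 1 1] by (simp add: tens_one one)
  then show ?thesis using m s h(1) by (simp add: unital_star_hom_def bounded_clinear_clinear)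
qed

section \<open>Product functionals and slice maps\<close>

text \<open>Matrix coefficients of representations are not positive, but they are finite
  combinations of states. On such combinations boundedness for the minimal norm follows from the
  case of states by induction.\<close>

inductive state_span :: "('a :: unital_cstar_algebra \<Rightarrow> complex) \<Rightarrow> bool" where
  zero: "state_span (\<lambda>_. 0)"
| add: "state_span \<xi> \<Longrightarrow> state \<phi> \<Longrightarrow> state_span (\<lambda>a. \<xi> a + c * \<phi> a)"

lemma state_span_state: "state \<phi> \<Longrightarrow> state_span \<phi>"
  using state_span.add[OF state_span.zero, of \<phi> 1] by simp

lemma state_span_add_positive:
  assumes "state_span \<xi>" "positive_functional scaleC star \<Phi>"
  shows "state_span (\<lambda>a. \<xi> a + c * \<Phi> a)"
  using positive_functional_multiple_state[OF assms(2)]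
proof
  assume "\<exists>d \<phi>. state \<phi> \<and> \<Phi> = (\<lambda>x. d * \<phi> x)"
  then obtain d \<phi> where "state \<phi>" "\<Phi> = (\<lambda>x. d * \<phi> x)" by blast
  then show ?thesis using state_span.add[OF assms(1), of \<phi> "c * d"] by (simp add: mult.assoc)
qed (use assms in simp)

lemma product_functional_le:
  assumes "state \<phi>" "state \<psi>"
  shows "cmod (product_functional \<phi> \<psi> (pretensor_star s * (t * s)))
    \<le> min_seminorm t * Re (product_functional \<phi> \<psi> (pretensor_star s * s))"
proof -
  interpret positive_functional pscale pretensor_star "product_functional \<phi> \<psi>"
    by (rule product_functional_positive[OF assms])
  have "cmod (product_functional \<phi> \<psi> (pretensor_star s * (t * s))) \<le> p s * p (t * s)"
    by (rule Cauchy_Schwarz')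
  also have "\<dots> \<le> p s * (min_seminorm t * p s)"
    using assms unfolding min_seminorm_def
    by (intro mult_left_mono functional_family.N_bound[OF functional_family_states]) (auto simp: q_ge_0)
  also have "\<dots> = min_seminorm t * q s" using q_ge_0[of s] by simp
  finally show ?thesis .
qed

lemma product_functional_state_le:
  assumes "state \<phi>" "state \<psi>"
  shows "cmod (product_functional \<phi> \<psi> t) \<le> min_seminorm t"
proof -
  interpret star_algebra pscale "pretensor_star :: ('a, 'b) pretensor \<Rightarrow> _" by (rule star_algebra_pretensor)
  have "product_functional \<phi> \<psi> 1 = 1"
    using assms by (simp add: product_functional_eq_lift pretensor_lift_one state_one)
  then show ?thesis using product_functional_le[OF assms, of 1 t] by (simp add: st_1)
qed

lemma product_functional_state_span_le:
  assumes "state_span \<xi>" "state_span \<eta>"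
  obtains C where "C \<ge> 0" "\<And>t. cmod (product_functional \<xi> \<eta> t) \<le> C * min_seminorm t"
proof -
  have 1: "\<exists>C\<ge>0. \<forall>t. cmod (product_functional \<phi> \<eta> t) \<le> C * min_seminorm t"
    if \<phi>: "state \<phi>" for \<phi> :: "'a \<Rightarrow> complex"
    using assms(2)
  proof (induction rule: state_span.induct)
    case zero
    show ?case by (rule exI[of _ 0]) (simp add: product_functional_def)
  next
    case (add \<eta> \<psi> c)
    then obtain C where C: "C \<ge> 0" "\<And>t. cmod (product_functional \<phi> \<eta> t) \<le> C * min_seminorm t"
      by blast
    have "cmod (product_functional \<phi> (\<lambda>a. \<eta> a + c * \<psi> a) t) \<le> (C + cmod c) * min_seminorm t" for t
    proof -
      have "product_functional \<phi> (\<lambda>a. \<eta> a + c * \<psi> a) t = product_functional \<phi> \<eta> t + c * product_functional \<phi> \<psi> t"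
        by (simp add: product_functional_def algebra_simps sum.distrib sum_distrib_left)
      then show ?thesis
        using norm_triangle_ineq[of "product_functional \<phi> \<eta> t" "c * product_functional \<phi> \<psi> t"] C(2)[of t]
          mult_left_mono[OF product_functional_state_le[OF \<phi> add(2), of t], of "cmod c"]
        by (simp add: norm_mult algebra_simps)
    qed
    then show ?case using C(1) by (intro exI[of _ "C + cmod c"]) simp
  qed
  have "\<exists>C\<ge>0. \<forall>t. cmod (product_functional \<xi> \<eta> t) \<le> C * min_seminorm t"
    using assms(1)
  proof (induction rule: state_span.induct)
    case zero
    show ?case by (rule exI[of _ 0]) (simp add: product_functional_def)
  next
    case (add \<xi> \<phi> c)
    then obtain C where C: "C \<ge> 0" "\<And>t. cmod (product_functional \<xi> \<eta> t) \<le> C * min_seminorm t"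
      by blast
    obtain D where D: "D \<ge> 0" "\<And>t. cmod (product_functional \<phi> \<eta> t) \<le> D * min_seminorm t"
      using 1[OF add(2)] by blast
    have "cmod (product_functional (\<lambda>a. \<xi> a + c * \<phi> a) \<eta> t) \<le> (C + cmod c * D) * min_seminorm t" for t
    proof -
      have "product_functional (\<lambda>a. \<xi> a + c * \<phi> a) \<eta> t = product_functional \<xi> \<eta> t + c * product_functional \<phi> \<eta> t"
        by (simp add: product_functional_def algebra_simps sum.distrib sum_distrib_left)
      then show ?thesis
        using norm_triangle_ineq[of "product_functional \<xi> \<eta> t" "c * product_functional \<phi> \<eta> t"] C(2)[of t]
          mult_left_mono[OF D(2)[of t], of "cmod c"]
        by (simp add: norm_mult algebra_simps)
    qed
    then show ?case using C(1) D(1) by (intro exI[of _ "C + cmod c * D"]) simp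
  qed
  then show ?thesis using that by blast
qed

lemma tensor_functional_facts:
  assumes "state_span \<xi>" "state_span \<eta>"
  shows "bounded_clinear (tensor_functional \<xi> \<eta>)"
    and "tensor_functional \<xi> \<eta> (of_pretensor t) = product_functional \<xi> \<eta> t"
    and "tensor_functional \<xi> \<eta> (a \<otimes>\<^sub>m b) = \<xi> a * \<eta> b"
proof -
  obtain C where "\<And>t. cmod (product_functional \<xi> \<eta> t) \<le> C * min_seminorm t"
    using product_functional_state_span_le[OF assms] by blast
  then have "norm (pretensor_lift (\<lambda>a b. \<xi> a * \<eta> b) t) \<le> C * min_seminorm t" for t
    by (simp add: product_functional_eq_lift)
  from tensor_extension_exists(1)[OF this] tensor_extension_exists(2,3)[OF this]
  show "bounded_clinear (tensor_functional \<xi> \<eta>)"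
    "tensor_functional \<xi> \<eta> (of_pretensor t) = product_functional \<xi> \<eta> t"
    "tensor_functional \<xi> \<eta> (a \<otimes>\<^sub>m b) = \<xi> a * \<eta> b"
    by (simp_all add: tensor_functional_def product_functional_eq_lift)
qed

lemmas tensor_functional_state_facts = tensor_functional_facts[OF state_span_state state_span_state]

lemma tensor_functional_state:
  assumes "state \<phi>" "state \<psi>" shows "state (tensor_functional \<phi> \<psi>)"
proof -
  let ?\<Phi> = "tensor_functional \<phi> \<psi>"
  note \<Phi> = tensor_functional_state_facts[OF assms]
  interpret positive_functional pscale pretensor_star "product_functional \<phi> \<psi>"
    by (rule product_functional_positive[OF assms])
  have "?\<Phi> (star (of_pretensor t) * of_pretensor t) \<in> \<real>\<^sub>\<ge>\<^sub>0" for t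
    using pos[of t] by (simp add: \<Phi>(2) complex_nonneg_Reals_iff flip: of_pretensor_star of_pretensor_mult)
  then have "?\<Phi> (star x * x) \<in> \<real>\<^sub>\<ge>\<^sub>0" for x
  proof (rule tensor_dense_induct[rotated])
    have "continuous_on UNIV (\<lambda>x. ?\<Phi> (star x * x))"
      by (intro bounded_clinear_continuous[OF \<Phi>(1)] continuous_intros
          bounded_linear.continuous_on[OF bounded_linear_star])
    then show "closed {x. ?\<Phi> (star x * x) \<in> \<real>\<^sub>\<ge>\<^sub>0}"
      using continuous_closed_vimage[of "\<real>\<^sub>\<ge>\<^sub>0 :: complex set" "\<lambda>x. ?\<Phi> (star x * x)"]
      by (simp add: vimage_def continuous_on_eq_continuous_at closed_nonneg_Reals_complex)
  qed
  moreover have "?\<Phi> 1 = 1" using \<Phi>(3)[of 1 1] assms by (simp add: tens_one state_one)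
  ultimately show ?thesis using \<Phi>(1) by (simp add: state_def)
qed

text \<open>For a state \<phi>, each state \<psi> composed with the slice is the product functional
  of \<phi> and \<psi>, which \<open>min_seminorm\<close> dominates. The norm of the slice is then
  controlled by \<open>norm_le_states\<close>.\<close>

lemma slice_facts:
  fixes \<xi> :: "'a :: unital_cstar_algebra \<Rightarrow> complex"
  assumes "state_span \<xi>"
  shows "bounded_clinear (slice \<xi> :: 'a \<otimes>\<^sub>m 'b :: unital_cstar_algebra \<Rightarrow> 'b)"
    and "slice \<xi> (a \<otimes>\<^sub>m (b :: 'b)) = \<xi> a *\<^sub>C b"
proof -
  have "\<exists>C. \<forall>t. norm (pretensor_lift (\<lambda>a (b :: 'b). \<xi> a *\<^sub>C b) t) \<le> C * min_seminorm t"
    using assms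
  proof (induction rule: state_span.induct)
    case zero
    show ?case by (rule exI[of _ 0]) (simp add: pretensor_lift_def)
  next
    case (add \<xi> \<phi> c)
    then obtain C where C: "\<And>t. norm (pretensor_lift (\<lambda>a (b :: 'b). \<xi> a *\<^sub>C b) t) \<le> C * min_seminorm t"
      by blast
    have 2: "norm (pretensor_lift (\<lambda>a (b :: 'b). \<phi> a *\<^sub>C b) t) \<le> 2 * min_seminorm t" for t
    proof (rule norm_le_states[OF _ min_seminorm_ge_0])
      fix \<psi> :: "'b \<Rightarrow> complex" assume \<psi>: "state \<psi>"
      have "\<psi> (pretensor_lift (\<lambda>a b. \<phi> a *\<^sub>C b) t) = product_functional \<phi> \<psi> t"
        using state_clinear[OF \<psi>]
        by (simp add: pretensor_lift_comp clinear_scaleC product_functional_eq_lift scaleC_complex_def)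
      then show "cmod (\<psi> (pretensor_lift (\<lambda>a b. \<phi> a *\<^sub>C b) t)) \<le> min_seminorm t"
        using product_functional_state_le[OF add(2) \<psi>] by simp
    qed
    have "norm (pretensor_lift (\<lambda>a (b :: 'b). (\<xi> a + c * \<phi> a) *\<^sub>C b) t) \<le> (C + cmod c * 2) * min_seminorm t" for t
    proof -
      have "pretensor_lift (\<lambda>a (b :: 'b). (\<xi> a + c * \<phi> a) *\<^sub>C b) t
          = pretensor_lift (\<lambda>a b. \<xi> a *\<^sub>C b) t + c *\<^sub>C pretensor_lift (\<lambda>a b. \<phi> a *\<^sub>C b) t"
        by (simp add: pretensor_lift_def scaleC_add_left scaleC_add_right sum.distrib scaleC_scaleC
            cvec.scale_sum_right mult_ac)
      then show ?thesis
        using norm_triangle_ineq[of "pretensor_lift (\<lambda>a b. \<xi> a *\<^sub>C b) t" "c *\<^sub>C pretensor_lift (\<lambda>a (b :: 'b). \<phi> a *\<^sub>C b) t"]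
          C[of t] mult_left_mono[OF 2[of t], of "cmod c"]
        by (simp add: norm_scaleC algebra_simps)
    qed
    then show ?case by blast
  qed
  then obtain C where "\<And>t. norm (pretensor_lift (\<lambda>a (b :: 'b). \<xi> a *\<^sub>C b) t) \<le> C * min_seminorm t"
    by blast
  from tensor_extension_exists(1)[OF this] tensor_extension_exists(3)[OF this]
  show "bounded_clinear (slice \<xi> :: 'a \<otimes>\<^sub>m 'b :: unital_cstar_algebra \<Rightarrow> 'b)" "slice \<xi> (a \<otimes>\<^sub>m b) = \<xi> a *\<^sub>C b"
    by (simp_all add: slice_def)
qed

text \<open>Slicing the second factor produces a function on \<open>X\<close> out of an element of
  C(X) \<otimes> Q, so that a product with the state of a measure becomes an integral over
  \<open>X\<close>.\<close>

definition right_slice ::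
    "('b :: unital_cstar_algebra \<Rightarrow> complex) \<Rightarrow> 'a :: unital_cstar_algebra \<otimes>\<^sub>m 'b \<Rightarrow> 'a" where
  "right_slice \<psi> = tensor_extension (\<lambda>a b. \<psi> b *\<^sub>C a)"

lemma right_slice_facts:
  fixes \<psi> :: "'b :: unital_cstar_algebra \<Rightarrow> complex"
  assumes \<psi>: "state \<psi>"
  shows "bounded_clinear (right_slice \<psi> :: 'a :: unital_cstar_algebra \<otimes>\<^sub>m 'b \<Rightarrow> 'a)"
    and "right_slice \<psi> ((a :: 'a) \<otimes>\<^sub>m b) = \<psi> b *\<^sub>C a"
proof -
  have 2: "norm (pretensor_lift (\<lambda>(a :: 'a) b. \<psi> b *\<^sub>C a) t) \<le> 2 * min_seminorm t" for t
  proof (rule norm_le_states[OF _ min_seminorm_ge_0])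
    fix \<phi> :: "'a \<Rightarrow> complex" assume \<phi>: "state \<phi>"
    have "\<phi> (pretensor_lift (\<lambda>a b. \<psi> b *\<^sub>C a) t) = product_functional \<phi> \<psi> t"
      using state_clinear[OF \<phi>]
      by (simp add: pretensor_lift_comp clinear_scaleC product_functional_eq_lift scaleC_complex_def mult.commute)
    then show "cmod (\<phi> (pretensor_lift (\<lambda>a b. \<psi> b *\<^sub>C a) t)) \<le> min_seminorm t"
      using product_functional_state_le[OF \<phi> \<psi>] by simp
  qed
  from tensor_extension_exists(1)[OF this] tensor_extension_exists(3)[OF this]
  show "bounded_clinear (right_slice \<psi> :: 'a \<otimes>\<^sub>m 'b \<Rightarrow> 'a)" "right_slice \<psi> (a \<otimes>\<^sub>m b) = \<psi> b *\<^sub>C a"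
    by (simp_all add: right_slice_def)
qed

section \<open>Tensor products of homomorphisms and associativity\<close>

lemma unital_star_homD:
  assumes "unital_star_hom f"
  shows "clinear f" "f 1 = 1" "f (a * b) = f a * f b" "f (star a) = star (f a)"
  using assms by (simp_all add: unital_star_hom_def)

lemma unital_star_hom_id: "unital_star_hom id"
  by (simp add: unital_star_hom_def clinearI)

lemma unital_star_hom_positive_functional:
  assumes f: "unital_star_hom f" and \<phi>: "state \<phi>"
  shows "positive_functional scaleC star (\<lambda>a. \<phi> (star d * (f a * d)))"
proof -
  interpret \<phi>: positive_functional scaleC star \<phi> by (rule state_positive_functional[OF \<phi>])
  note F = unital_star_homD[OF f]
  show ?thesis
  proof (intro positive_functional.intro star_algebra_cstar positive_functional_axioms.intro)
    fix x y c
    show "\<phi> (star d * (f (x + y) * d)) = \<phi> (star d * (f x * d)) + \<phi> (star d * (f y * d))"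
      by (simp add: clinear_add[OF F(1)] distrib_left distrib_right \<phi>.add)
    show "\<phi> (star d * (f (c *\<^sub>C x) * d)) = c * \<phi> (star d * (f x * d))"
      by (simp add: clinear_scaleC[OF F(1)] mult_scaleC_left mult_scaleC_right \<phi>.sc)
    show "Im (\<phi> (star d * (f (star x * x) * d))) = 0 \<and> 0 \<le> Re (\<phi> (star d * (f (star x * x) * d)))"
      using \<phi>.pos[of "f x * d"] by (simp add: F star_mult mult.assoc)
  qed
qed

text \<open>A state composed with \<open>f\<close> is positive with value 1 at 1, hence bounded by
  the norm. States recover the norm up to the factor 2.\<close>

lemma unital_star_hom_bounded_clinear:
  assumes f: "unital_star_hom f" shows "bounded_clinear f"
proof (rule bounded_clinearI)
  show "clinear f" using f by (rule unital_star_homD)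
  fix x
  have "cmod (\<psi> (f x)) \<le> norm x" if \<psi>: "state \<psi>" for \<psi>
    using positive_functional_bounded[OF unital_star_hom_positive_functional[OF f \<psi>, of 1], of x]
    by (simp add: star_1 unital_star_homD[OF f] state_one[OF \<psi>])
  then show "norm (f x) \<le> 2 * norm x" by (intro norm_le_states) simp_all
qed

text \<open>Polarization: the expression is the sum over the fourth roots of unity w of
  \<open>cnj w / 4\<close> times the positive functional with vector
  \<open>c + w *\<^sub>C c'\<close>.\<close>

lemma unital_star_hom_state_span:
  assumes f: "unital_star_hom f" and \<phi>: "state \<phi>"
  shows "state_span (\<lambda>a. \<phi> (star c * (f a * c')))"
proof -
  interpret \<phi>: positive_functional scaleC star \<phi> by (rule state_positive_functional[OF \<phi>])
  define P where "P d a = \<phi> (star d * (f a * d))" for d a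
  have P: "positive_functional scaleC star (P d)" for d
    unfolding P_def by (rule unital_star_hom_positive_functional[OF f \<phi>])
  have exp: "P (c + w *\<^sub>C c') a = P c a + w * \<phi> (star c * (f a * c')) + cnj w * \<phi> (star c' * (f a * c))
      + cnj w * w * P c' a" for w a
    by (simp add: P_def star_add star_scaleC distrib_left distrib_right mult_scaleC_left mult_scaleC_right
        \<phi>.add \<phi>.sc scaleC_scaleC algebra_simps)
  have "state_span (\<lambda>a. (((0 + 1/4 * P (c + 1 *\<^sub>C c') a) + (-1/4) * P (c + (-1) *\<^sub>C c') a)
      + (- \<i>/4) * P (c + \<i> *\<^sub>C c') a) + (\<i>/4) * P (c + (-\<i>) *\<^sub>C c') a)"
    by (intro state_span_add_positive P state_span.zero)
  also have "(\<lambda>a. (((0 + 1/4 * P (c + 1 *\<^sub>C c') a) + (-1/4) * P (c + (-1) *\<^sub>C c') a)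
      + (- \<i>/4) * P (c + \<i> *\<^sub>C c') a) + (\<i>/4) * P (c + (-\<i>) *\<^sub>C c') a) = (\<lambda>a. \<phi> (star c * (f a * c')))"
    unfolding exp by (simp add: fun_eq_iff field_simps)
  finally show ?thesis .
qed

text \<open>The norm of the completion is again an operator norm in the product representations.
  Replacing \<open>x\<close> by a nearby formal tensor \<open>u\<close> changes these operators by
  at most the norm of x - u.\<close>

lemma tensor_norm_leI:
  fixes x :: "'a :: unital_cstar_algebra \<otimes>\<^sub>m 'b :: unital_cstar_algebra"
  assumes M: "M \<ge> 0"
    and le: "\<And>\<phi> \<psi> s. state \<phi> \<Longrightarrow> state \<psi> \<Longrightarrow>
      Re (tensor_functional \<phi> \<psi> (star (x * of_pretensor s) * (x * of_pretensor s)))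
        \<le> M\<^sup>2 * Re (tensor_functional \<phi> \<psi> (star (of_pretensor s) * of_pretensor s))"
  shows "norm x \<le> M"
proof (rule field_le_epsilon)
  fix e :: real assume e: "e > 0"
  then obtain u where u: "norm (x - of_pretensor u) < e / 2" using of_pretensor_dense[of "e / 2" x] by auto
  have "min_seminorm u \<le> M + e / 2"
    unfolding min_seminorm_def
  proof (rule functional_family.N_least[OF functional_family_states])
    fix \<Phi> :: "('a, 'b) pretensor \<Rightarrow> complex" and s :: "('a, 'b) pretensor"
    assume "\<Phi> \<in> {product_functional \<phi> \<psi> |\<phi> \<psi>. state \<phi> \<and> state \<psi>}"
    then obtain \<phi> \<psi> where st: "state \<phi>" "state \<psi>" and \<Phi>: "\<Phi> = product_functional \<phi> \<psi>" by blast
    let ?T = "tensor_functional \<phi> \<psi>" and ?s = "of_pretensor s"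
    interpret T: positive_functional scaleC star ?T
      by (rule state_positive_functional[OF tensor_functional_state[OF st]])
    have T: "Re (\<Phi> (pretensor_star w * w)) = T.q (of_pretensor w)" for w
      by (simp add: \<Phi> tensor_functional_state_facts(2)[OF st] flip: of_pretensor_star of_pretensor_mult)
    have "sqrt (Re (\<Phi> (pretensor_star (u * s) * (u * s)))) = T.p (x * ?s + (of_pretensor u - x) * ?s)"
      unfolding T by (simp add: of_pretensor_mult algebra_simps)
    also have "\<dots> \<le> T.p (x * ?s) + T.p ((of_pretensor u - x) * ?s)" by (rule T.p_triangle)
    also have "T.p (x * ?s) \<le> sqrt (M\<^sup>2 * T.q ?s)" using le[OF st, of s] by (rule real_sqrt_le_mono)
    also have "\<dots> = M * T.p ?s" using M by (simp add: real_sqrt_mult)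
    also have "T.p ((of_pretensor u - x) * ?s) \<le> sqrt ((norm (of_pretensor u - x))\<^sup>2 * T.q ?s)"
      by (intro real_sqrt_le_mono positive_functional_square_le T.positive_functional_axioms)
    also have "\<dots> = norm (of_pretensor u - x) * T.p ?s" by (simp add: real_sqrt_mult)
    also have "\<dots> \<le> e / 2 * T.p ?s"
      using u T.q_ge_0 by (intro mult_right_mono) (auto simp: norm_minus_commute)
    finally show "sqrt (Re (\<Phi> (pretensor_star (u * s) * (u * s)))) \<le> (M + e / 2) * sqrt (Re (\<Phi> (pretensor_star s * s)))"
      unfolding T by (simp add: algebra_simps)
  qed (use M e in simp)
  moreover have "norm x \<le> norm (x - of_pretensor u) + norm (of_pretensor u)"
    using norm_triangle_ineq[of "x - of_pretensor u" "of_pretensor u"] by simp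
  ultimately show "norm x \<le> M + e" using u by (simp add: norm_of_pretensor)
qed

text \<open>For a self-adjoint \<open>z\<close> the numerical radius suffices: with \<open>y = z\<rho>\<close>, polarization of the form of \<open>z\<close> at
  \<open>\<rho> \<plusminus> y/M\<close> bounds \<open>\<langle>y, y\<rangle> = \<langle>z\<rho>, y\<rangle>\<close>.\<close>

lemma tensor_norm_le_selfadjoint:
  fixes z :: "'a :: unital_cstar_algebra \<otimes>\<^sub>m 'b :: unital_cstar_algebra"
  assumes z: "star z = z" and M: "M \<ge> 0"
    and le: "\<And>\<phi> \<psi> s. state \<phi> \<Longrightarrow> state \<psi> \<Longrightarrow>
      cmod (tensor_functional \<phi> \<psi> (star (of_pretensor s) * (z * of_pretensor s)))
        \<le> M * Re (tensor_functional \<phi> \<psi> (star (of_pretensor s) * of_pretensor s))"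
  shows "norm z \<le> M"
proof (rule field_le_epsilon)
  fix e :: real assume e: "e > 0"
  \<comment> \<open>\<open>M\<close> may be 0; the slightly larger \<open>K\<close> can be divided
    by.\<close>
  define K where "K = M + e"
  have K: "K > 0" "M \<le> K" using M e by (simp_all add: K_def)
  show "norm z \<le> M + e"
    unfolding K_def[symmetric]
  proof (rule tensor_norm_leI)
    fix \<phi> :: "'a \<Rightarrow> complex" and \<psi> :: "'b \<Rightarrow> complex" and s :: "('a, 'b) pretensor"
    assume st: "state \<phi>" "state \<psi>"
    let ?T = "tensor_functional \<phi> \<psi>"
    interpret T: positive_functional scaleC star ?T
      by (rule state_positive_functional[OF tensor_functional_state[OF st]])
    have cont: "continuous_on UNIV (\<lambda>r. ?T (g r))" if "continuous_on UNIV g" for g :: "_ \<Rightarrow> 'a \<otimes>\<^sub>m 'b"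
      by (rule bounded_clinear_continuous[OF tensor_functional_state_facts(1)[OF st] that])
    have cstar: "continuous_on UNIV (star :: 'a \<otimes>\<^sub>m 'b \<Rightarrow> _)"
      by (rule bounded_linear.continuous_on[OF bounded_linear_star continuous_on_id])
    have cl: "closed {r. cmod (?T (star r * (z * r))) \<le> M * Re (?T (star r * r))}"
      by (intro closed_Collect_le continuous_on_norm continuous_on_mult_left continuous_on_Re cont
          continuous_on_mult cstar continuous_on_id)
    have form: "cmod (?T (star r * (z * r))) \<le> K * Re (?T (star r * r))" for r
    proof -
      have "cmod (?T (star r * (z * r))) \<le> M * Re (?T (star r * r))"
        by (rule tensor_dense_induct[OF cl le[OF st]])
      also have "\<dots> \<le> K * Re (?T (star r * r))" by (intro mult_right_mono K T.q_ge_0)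
      finally show ?thesis .
    qed
    define \<rho> where "\<rho> = of_pretensor s"
    define y where "y = z * \<rho>"
    define r where "r = 1 / K"
    have TR: "Re (?T (c *\<^sub>R x)) = c * Re (?T x)" for c x by (simp add: scaleR_scaleC T.sc)
    have Td: "?T (x - w) = ?T x - ?T w" for x w using T.add[of x "- w"] T.minus[of w] by simp
    have y1: "star \<rho> * (z * y) = star y * y" and y2: "star y * (z * \<rho>) = star y * y"
      by (simp_all add: y_def star_mult z mult.assoc)
    have "star (\<rho> + r *\<^sub>R y) * (z * (\<rho> + r *\<^sub>R y)) - star (\<rho> - r *\<^sub>R y) * (z * (\<rho> - r *\<^sub>R y))
        = (2 * r) *\<^sub>R (star \<rho> * (z * y)) + (2 * r) *\<^sub>R (star y * (z * \<rho>))"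
      by (simp add: star_add star_diff star_scaleR algebra_simps flip: scaleR_2 scaleR_add_left)
    also have "\<dots> = (4 * r) *\<^sub>R (star y * y)" unfolding y1 y2 by (simp flip: scaleR_add_left)
    finally have "Re (?T (star (\<rho> + r *\<^sub>R y) * (z * (\<rho> + r *\<^sub>R y)) - star (\<rho> - r *\<^sub>R y) * (z * (\<rho> - r *\<^sub>R y))))
        = Re (?T ((4 * r) *\<^sub>R (star y * y)))" by (rule arg_cong)
    then have "Re (?T (star (\<rho> + r *\<^sub>R y) * (z * (\<rho> + r *\<^sub>R y)))) - Re (?T (star (\<rho> - r *\<^sub>R y) * (z * (\<rho> - r *\<^sub>R y))))
        = 4 * r * T.q y"
      by (simp only: TR Td minus_complex.sel)
    then have "4 * r * T.q y \<le> K * T.q (\<rho> + r *\<^sub>R y) + K * T.q (\<rho> - r *\<^sub>R y)"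
      using form[of "\<rho> + r *\<^sub>R y"] form[of "\<rho> - r *\<^sub>R y"]
        abs_Re_le_cmod[of "?T (star (\<rho> + r *\<^sub>R y) * (z * (\<rho> + r *\<^sub>R y)))"]
        abs_Re_le_cmod[of "?T (star (\<rho> - r *\<^sub>R y) * (z * (\<rho> - r *\<^sub>R y)))"]
      by linarith
    \<comment> \<open>Parallelogram identity. With r = 1/K its right-hand side contains half of the
      left-hand term 4 r \<open>T.q y\<close>, which is absorbed.\<close>
    also have "\<dots> = K * Re (?T (star (\<rho> + r *\<^sub>R y) * (\<rho> + r *\<^sub>R y) + star (\<rho> - r *\<^sub>R y) * (\<rho> - r *\<^sub>R y)))"
      by (simp add: T.add distrib_left)
    also have "star (\<rho> + r *\<^sub>R y) * (\<rho> + r *\<^sub>R y) + star (\<rho> - r *\<^sub>R y) * (\<rho> - r *\<^sub>R y)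
        = 2 *\<^sub>R (star \<rho> * \<rho>) + (2 * r\<^sup>2) *\<^sub>R (star y * y)"
      by (simp add: star_add star_diff star_scaleR algebra_simps power2_eq_square flip: scaleR_2 scaleR_add_left)
    also have "K * Re (?T (2 *\<^sub>R (star \<rho> * \<rho>) + (2 * r\<^sup>2) *\<^sub>R (star y * y))) = 2 * K * T.q \<rho> + 2 * r * T.q y"
      using K by (simp add: T.add TR r_def field_simps power2_eq_square)
    finally have "r * T.q y \<le> K * T.q \<rho>" by simp
    then have "T.q y \<le> K\<^sup>2 * T.q \<rho>" using K by (simp add: r_def field_simps power2_eq_square)
    then show "Re (?T (star (z * of_pretensor s) * (z * of_pretensor s)))
        \<le> K\<^sup>2 * Re (?T (star (of_pretensor s) * of_pretensor s))"
      by (simp add: y_def \<rho>_def)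
  qed (use K in simp)
qed

text \<open>In a C*-algebra it suffices to estimate powers of \<open>\<theta>(t\<^sup>*t)\<close>, hence the constant \<open>C\<close> may depend on the
  vector.\<close>

lemma tensor_hom_contractive:
  fixes \<theta> :: "('a :: unital_cstar_algebra, 'b :: unital_cstar_algebra) pretensor \<Rightarrow>
      'c :: unital_cstar_algebra \<otimes>\<^sub>m 'd :: unital_cstar_algebra"
  assumes mult: "\<And>s t. \<theta> (s * t) = \<theta> s * \<theta> t" and star: "\<And>t. \<theta> (pretensor_star t) = star (\<theta> t)"
    and one: "\<theta> 1 = 1"
    and bnd: "\<And>\<phi> \<psi> s. state \<phi> \<Longrightarrow> state \<psi> \<Longrightarrow> \<exists>C\<ge>0. \<forall>t. pretensor_star t = t \<longrightarrow>
      cmod (tensor_functional \<phi> \<psi> (star (of_pretensor s) * (\<theta> t * of_pretensor s))) \<le> C * min_seminorm t"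
  shows "norm (\<theta> t) \<le> min_seminorm t"
proof (rule tensor_norm_leI[OF min_seminorm_ge_0])
  fix \<phi> :: "'c \<Rightarrow> complex" and \<psi> :: "'d \<Rightarrow> complex" and s :: "('c, 'd) pretensor"
  assume st: "state \<phi>" "state \<psi>"
  let ?T = "tensor_functional \<phi> \<psi>" and ?s = "of_pretensor s"
  interpret T: positive_functional scaleC star ?T
    by (rule state_positive_functional[OF tensor_functional_state[OF st]])
  interpret V: star_algebra pscale "pretensor_star :: ('a, 'b) pretensor \<Rightarrow> _" by (rule star_algebra_pretensor)
  obtain C where C: "C \<ge> 0" "\<And>t. pretensor_star t = t \<Longrightarrow>
      cmod (?T (star ?s * (\<theta> t * ?s))) \<le> C * min_seminorm t"
    using bnd[OF st] by blast
  define u where "u = pretensor_star t * t"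
  have su: "pretensor_star u = u" by (simp add: u_def V.st_mult V.st_st)
  \<comment> \<open>All powers of \<open>u\<close> are self-adjoint, so the hypothesis
    \<open>bnd\<close> covers each of them with the same constant.\<close>
  have sun: "pretensor_star (u ^ n) = u ^ n" for n
    by (induction n) (simp_all add: V.st_1 V.st_mult su power_commutes)
  have \<theta>n: "\<theta> u ^ n = \<theta> (u ^ n)" for n by (induction n) (simp_all add: one mult)
  have opow: "of_pretensor (u ^ n) = of_pretensor u ^ n" for n
  proof (induction n)
    case 0
    show ?case using tens_one by (simp add: tens_def flip: zero_elementary_def)
  qed (simp add: of_pretensor_mult)
  have Nu: "min_seminorm (u ^ n) \<le> ((min_seminorm t)\<^sup>2) ^ n" for n
  proof -
    have "min_seminorm (u ^ n) \<le> norm (of_pretensor u) ^ n"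
      using norm_power_le[of "of_pretensor u" n] by (simp add: opow flip: norm_of_pretensor)
    also have "norm (of_pretensor u) = (min_seminorm t)\<^sup>2"
      by (simp add: u_def of_pretensor_mult of_pretensor_star cstar_identity norm_of_pretensor)
    finally show ?thesis .
  qed
  have "cmod (?T (star ?s * (\<theta> u ^ n * ?s))) \<le> C * ((min_seminorm t)\<^sup>2) ^ n" for n
    unfolding \<theta>n using C(2)[OF sun] mult_left_mono[OF Nu C(1)] by (rule order_trans)
  then have "cmod (?T (star ?s * (\<theta> u * ?s))) \<le> (min_seminorm t)\<^sup>2 * T.q ?s"
    by (intro T.power_bound[OF _ C(1)]) (simp_all add: su flip: star)
  moreover have "star (\<theta> t * ?s) * (\<theta> t * ?s) = star ?s * (\<theta> u * ?s)"
    by (simp add: u_def mult star star_mult mult.assoc)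
  ultimately show "Re (?T (star (\<theta> t * ?s) * (\<theta> t * ?s))) \<le> (min_seminorm t)\<^sup>2 * Re (?T (star ?s * ?s))"
    using complex_Re_le_cmod[of "?T (star ?s * (\<theta> u * ?s))"] by simp
qed

context
  fixes f :: "'a :: unital_cstar_algebra \<Rightarrow> 'c :: unital_cstar_algebra"
    and g :: "'b :: unital_cstar_algebra \<Rightarrow> 'd :: unital_cstar_algebra"
  assumes f: "unital_star_hom f" and g: "unital_star_hom g"
begin

text \<open>For a fixed vector \<open>s\<close>, the vector functional expands over pairs of terms
  of \<open>s\<close> into product functionals of combinations of states. Each is bounded with a
  constant depending on \<open>s\<close>, which \<open>tensor_hom_contractive\<close> then
  removes.\<close>

lemma tensor_map_lift_le: "norm (pretensor_lift (\<lambda>a b. f a \<otimes>\<^sub>m g b) t) \<le> 1 * min_seminorm t"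
proof -
  let ?\<theta> = "pretensor_lift (\<lambda>a b. f a \<otimes>\<^sub>m g b)"
  note F = unital_star_homD[OF f] and G = unital_star_homD[OF g]
  have "norm (?\<theta> t) \<le> min_seminorm t"
  proof (rule tensor_hom_contractive)
    show "?\<theta> (s * t) = ?\<theta> s * ?\<theta> t" for s t by (rule pretensor_lift_mult) (simp add: F G tens_mult)
    show "?\<theta> (pretensor_star t) = star (?\<theta> t)" for t by (rule pretensor_lift_star) (simp add: F G tens_star)
    show "?\<theta> 1 = 1" by (simp add: pretensor_lift_one F G tens_one)
    fix \<phi> :: "'c \<Rightarrow> complex" and \<psi> :: "'d \<Rightarrow> complex" and s :: "('c, 'd) pretensor"
    assume st: "state \<phi>" "state \<psi>"
    let ?T = "tensor_functional \<phi> \<psi>" and ?s = "of_pretensor s"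
    let ?K = "Poly_Mapping.keys s" and ?l = "Poly_Mapping.lookup s"
    define \<xi> where "\<xi> i j a = \<phi> (star (left_factor i) * (f a * left_factor j))"
      for i j :: "('c, 'd) elementary" and a
    define \<eta> where "\<eta> i j b = \<psi> (star (right_factor i) * (g b * right_factor j))"
      for i j :: "('c, 'd) elementary" and b
    have "\<exists>C. C \<ge> 0 \<and> (\<forall>t. cmod (product_functional (\<xi> i j) (\<eta> i j) t) \<le> C * min_seminorm t)" for i j
      unfolding \<xi>_def \<eta>_def
      using product_functional_state_span_le[OF unital_star_hom_state_span[OF f st(1)] unital_star_hom_state_span[OF g st(2)]]
      by metis
    then obtain C where C: "\<And>i j. C i j \<ge> 0"
      "\<And>i j t. cmod (product_functional (\<xi> i j) (\<eta> i j) t) \<le> C i j * min_seminorm t" by metis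
    interpret T: positive_functional scaleC star ?T
      by (rule state_positive_functional[OF tensor_functional_state[OF st]])
    have T: "?T (star ?s * (?\<theta> t * ?s)) = (\<Sum>i\<in>?K. \<Sum>j\<in>?K. cnj (?l i) * ?l j * product_functional (\<xi> i j) (\<eta> i j) t)" for t
    proof (induction t rule: pretensor_induct)
      case (single k c)
      let ?e = "Elementary (f (left_factor k)) (g (right_factor k))"
      have "star ?s * (?\<theta> (Poly_Mapping.single k c) * ?s)
          = c *\<^sub>C of_pretensor (pretensor_star s * (Poly_Mapping.single ?e 1 * s))"
        by (simp add: of_pretensor_mult of_pretensor_star tens_def mult_scaleC_left mult_scaleC_right)
      then have "?T (star ?s * (?\<theta> (Poly_Mapping.single k c) * ?s))
          = c * product_functional \<phi> \<psi> (pretensor_star s * (Poly_Mapping.single ?e 1 * s))"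
        by (simp only: T.sc tensor_functional_state_facts(2)[OF st])
      then show ?case
        unfolding product_functional_sandwich by (simp add: \<xi>_def \<eta>_def sum_distrib_left mult_ac)
    next
      case (add t t')
      then show ?case
        by (simp add: pretensor_lift_add product_functional_add distrib_left distrib_right T.add sum.distrib)
    qed
    have "cmod (?T (star ?s * (?\<theta> t * ?s))) \<le> (\<Sum>i\<in>?K. \<Sum>j\<in>?K. cmod (?l i) * cmod (?l j) * C i j) * min_seminorm t" for t
    proof -
      have "cmod (?T (star ?s * (?\<theta> t * ?s))) \<le> (\<Sum>i\<in>?K. \<Sum>j\<in>?K. cmod (?l i) * cmod (?l j) * (C i j * min_seminorm t))"
        unfolding T by (intro sum_norm_le order_trans[OF norm_sum] sum_mono) (simp add: norm_mult mult_left_mono C)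
      then show ?thesis by (simp add: sum_distrib_right mult.assoc)
    qed
    moreover have "0 \<le> (\<Sum>i\<in>?K. \<Sum>j\<in>?K. cmod (?l i) * cmod (?l j) * C i j)"
      by (intro sum_nonneg mult_nonneg_nonneg C) simp_all
    ultimately show "\<exists>C\<ge>0. \<forall>t. pretensor_star t = t \<longrightarrow> cmod (?T (star ?s * (?\<theta> t * ?s))) \<le> C * min_seminorm t"
      by blast
  qed
  then show ?thesis by simp
qed

lemma tensor_map_facts:
  shows "bounded_clinear (tensor_map f g)" and "unital_star_hom (tensor_map f g)"
    and "tensor_map f g (a \<otimes>\<^sub>m b) = f a \<otimes>\<^sub>m g b"
  using tensor_extension_exists(1,3)[OF tensor_map_lift_le] tensor_extension_star_hom[OF tensor_map_lift_le]
  by (simp_all add: tensor_map_def unital_star_homD[OF f] unital_star_homD[OF g] tens_mult tens_star tens_one)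

end

section \<open>Associativity of the minimal tensor product\<close>

lemma of_pretensor_single:
  "of_pretensor (Poly_Mapping.single k c) = c *\<^sub>C (left_factor k \<otimes>\<^sub>m right_factor k)"
  using pretensor_lift_tens[of "Poly_Mapping.single k c"] by simp

lemma unital_star_hom_tens_one: "unital_star_hom (\<lambda>a. a \<otimes>\<^sub>m 1)"
  unfolding unital_star_hom_def
  by (auto intro!: clinearI simp: tens_add_left tens_scaleC_left tens_mult tens_star tens_one star_1)

lemma bounded_clinear_tens_left: "bounded_clinear (\<lambda>a. a \<otimes>\<^sub>m b)"
proof -
  have "bounded_clinear (\<lambda>a. (a \<otimes>\<^sub>m 1) * (1 \<otimes>\<^sub>m b))"
    by (intro bounded_clinear_intros(3) unital_star_hom_bounded_clinear unital_star_hom_tens_one)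
  then show ?thesis by (simp add: tens_mult)
qed

lemma slice_star:
  fixes u :: "'a :: unital_cstar_algebra \<otimes>\<^sub>m 'b :: unital_cstar_algebra"
  assumes \<phi>: "state \<phi>" shows "slice \<phi> (star u) = star (slice \<phi> u)"
proof -
  interpret \<phi>: positive_functional scaleC star \<phi> by (rule state_positive_functional[OF \<phi>])
  note S = slice_facts[OF state_span_state[OF \<phi>]]
  note lin = bounded_clinear_clinear[OF S(1)]
  have c: "continuous_on UNIV (slice \<phi> :: 'a \<otimes>\<^sub>m 'b \<Rightarrow> 'b)"
    by (rule bounded_clinear_continuous[OF S(1) continuous_on_id])
  have cs: "continuous_on UNIV (star :: 'z \<Rightarrow> 'z :: unital_cstar_algebra)"
    using bounded_linear.continuous_on[OF bounded_linear_star continuous_on_id] .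
  show ?thesis
  proof (rule tensor_dense_induct[where x=u])
    show "closed {u :: 'a \<otimes>\<^sub>m 'b. slice \<phi> (star u) = star (slice \<phi> u)}"
      by (intro closed_Collect_eq continuous_on_compose2[OF c cs] continuous_on_compose2[OF cs c] subset_UNIV)
    show "slice \<phi> (star (of_pretensor t)) = star (slice \<phi> (of_pretensor t :: 'a \<otimes>\<^sub>m 'b))" for t
      by (induction t rule: pretensor_induct)
        (simp_all add: of_pretensor_single of_pretensor_add star_add star_scaleC tens_star
          clinear_add[OF lin] clinear_scaleC[OF lin] S(2) \<phi>.hermitian' scaleC_scaleC)
  qed
qed

text \<open>The homomorphism \<open>x \<otimes> c \<mapsto> J(x) (1 \<otimes> 1 \<otimes> c)\<close> with \<open>J(a \<otimes> b) = a \<otimes> b \<otimes> 1\<close> is contractive for the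
  minimal norms. A state \<open>\<omega>\<close> of \<open>B \<otimes> C\<close> need not be a product, so its functionals are estimated through the
  norms of slices in \<open>B \<otimes> C\<close>, which are determined by the product states.\<close>

definition assoc_map ::
    "'a :: unital_cstar_algebra \<otimes>\<^sub>m 'b :: unital_cstar_algebra \<Rightarrow> 'c :: unital_cstar_algebra \<Rightarrow>
      'a \<otimes>\<^sub>m 'b \<otimes>\<^sub>m 'c" where
  "assoc_map x c = tensor_map id (\<lambda>b. b \<otimes>\<^sub>m 1) x * (1 \<otimes>\<^sub>m 1 \<otimes>\<^sub>m c)"

lemmas tensor_map_id_tens_one = tensor_map_facts[OF unital_star_hom_id unital_star_hom_tens_one]

lemma assoc_map_tens: "assoc_map (a \<otimes>\<^sub>m b) c = a \<otimes>\<^sub>m b \<otimes>\<^sub>m c"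
  by (simp add: assoc_map_def tensor_map_id_tens_one tens_mult)

lemma bounded_clinear_assoc_map: "bounded_clinear (\<lambda>x. assoc_map x c)"
  unfolding assoc_map_def by (intro bounded_clinear_intros(3) tensor_map_id_tens_one)

lemma assoc_map_commute:
  "assoc_map x c = (1 \<otimes>\<^sub>m 1 \<otimes>\<^sub>m c) * tensor_map id (\<lambda>b. b \<otimes>\<^sub>m 1) x"
proof -
  have "(\<lambda>x. assoc_map x c) = (\<lambda>x. (1 \<otimes>\<^sub>m 1 \<otimes>\<^sub>m c) * tensor_map id (\<lambda>b. b \<otimes>\<^sub>m 1) x)"
    by (intro bounded_clinear_tensor_eqI bounded_clinear_assoc_map bounded_clinear_intros(2) tensor_map_id_tens_one)
      (simp add: assoc_map_tens tensor_map_id_tens_one tens_mult)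
  then show ?thesis by metis
qed

lemma assoc_map_mult:
  fixes x x' :: "'a :: unital_cstar_algebra \<otimes>\<^sub>m 'b :: unital_cstar_algebra" and c c' :: "'c :: unital_cstar_algebra"
  shows "assoc_map (x * x') (c * c') = assoc_map x c * assoc_map x' c'"
proof -
  define J where "J = tensor_map id (\<lambda>b :: 'b. b \<otimes>\<^sub>m (1 :: 'c)) \<circ> (\<lambda>x :: 'a \<otimes>\<^sub>m 'b. x)"
  define E where "E c = (1 :: 'a) \<otimes>\<^sub>m (1 :: 'b) \<otimes>\<^sub>m c" for c :: 'c
  have J: "J (x * x') = J x * J x'" and E: "E (c * c') = E c * E c'" and JE: "assoc_map z d = J z * E d" for z d
    by (simp_all add: J_def E_def assoc_map_def unital_star_homD[OF tensor_map_id_tens_one(2)] tens_mult)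
  have "J x' * E c = E c * J x'"
    using assoc_map_commute[of x' c] by (simp add: assoc_map_def J_def E_def)
  then show ?thesis unfolding JE J E by (metis mult.assoc)
qed

lemma assoc_map_star: "assoc_map (star x) (star c) = star (assoc_map x c)"
  unfolding assoc_map_commute[of x c]
  by (simp add: assoc_map_def star_mult unital_star_homD[OF tensor_map_id_tens_one(2)] tens_star star_1)

lemma assoc_map_one: "assoc_map 1 1 = 1"
  by (simp add: assoc_map_def unital_star_homD[OF tensor_map_id_tens_one(2)] tens_one)

text \<open>Slicing with \<phi> turns an element of A \<otimes> (B \<otimes> C) into one of B
  \<otimes> C. Its coefficients for \<psi> \<otimes> \<theta> are coefficients on (A \<otimes> B)
  \<otimes> C for the product of the states \<phi> \<otimes> \<psi> and \<theta>.\<close>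

lemma slice_assoc_map:
  fixes x :: "'a :: unital_cstar_algebra \<otimes>\<^sub>m 'b :: unital_cstar_algebra" and y :: "'c :: unital_cstar_algebra"
  assumes \<phi>: "state \<phi>" and \<psi>: "state \<psi>" and \<theta>: "state \<theta>"
  shows "tensor_functional \<psi> \<theta> ((l \<otimes>\<^sub>m m) * (slice \<phi> (assoc_map x y) * (l' \<otimes>\<^sub>m m')))
    = tensor_functional \<phi> \<psi> ((1 \<otimes>\<^sub>m l) * (x * (1 \<otimes>\<^sub>m l'))) * \<theta> (m * (y * m'))"
proof -
  note S = slice_facts[OF state_span_state[OF \<phi>]]
  note T = tensor_functional_state_facts[OF \<psi> \<theta>] and U = tensor_functional_state_facts[OF \<phi> \<psi>]
  have "(\<lambda>x. tensor_functional \<psi> \<theta> ((l \<otimes>\<^sub>m m) * (slice \<phi> (assoc_map x y) * (l' \<otimes>\<^sub>m m'))))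
    = (\<lambda>x. tensor_functional \<phi> \<psi> ((1 \<otimes>\<^sub>m l) * (x * (1 \<otimes>\<^sub>m l'))) * \<theta> (m * (y * m')))"
  proof (rule bounded_clinear_tensor_eqI)
    show "bounded_clinear (\<lambda>x. tensor_functional \<psi> \<theta> ((l \<otimes>\<^sub>m m) * (slice \<phi> (assoc_map x y) * (l' \<otimes>\<^sub>m m'))))"
      by (rule bounded_clinear_intros(6)[OF T(1)], rule bounded_clinear_intros(2), rule bounded_clinear_intros(3),
          rule bounded_clinear_intros(6)[OF S(1)], rule bounded_clinear_assoc_map)
    show "bounded_clinear (\<lambda>x. tensor_functional \<phi> \<psi> ((1 \<otimes>\<^sub>m l) * (x * (1 \<otimes>\<^sub>m l'))) * \<theta> (m * (y * m')))"
      by (rule bounded_clinear_intros(3), rule bounded_clinear_intros(6)[OF U(1)], rule bounded_clinear_intros(2),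
          rule bounded_clinear_intros(3), rule bounded_clinear_intros(1))
  qed (simp add: assoc_map_tens S(2) tens_mult mult_scaleC_left mult_scaleC_right T(3) U(3)
        clinear_scaleC[OF bounded_clinear_clinear[OF T(1)]] scaleC_complex_def)
  then show ?thesis by metis
qed

text \<open>This is 1 \<otimes> t regrouped as a formal tensor of (A \<otimes> B) \<otimes>
  C.\<close>

definition one_tens_pretensor ::
    "('b :: unital_cstar_algebra, 'c :: unital_cstar_algebra) pretensor \<Rightarrow>
     ('a :: unital_cstar_algebra \<otimes>\<^sub>m 'b, 'c) pretensor" where
  "one_tens_pretensor t = (\<Sum>k\<in>Poly_Mapping.keys t.
     Poly_Mapping.single (Elementary (1 \<otimes>\<^sub>m left_factor k) (right_factor k)) (Poly_Mapping.lookup t k))"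

lemma one_tens_pretensor_single [simp]:
  "one_tens_pretensor (Poly_Mapping.single k c) =
     Poly_Mapping.single (Elementary (1 \<otimes>\<^sub>m left_factor k) (right_factor k)) c"
  by (simp add: one_tens_pretensor_def)

lemma one_tens_pretensor_add:
  "one_tens_pretensor (s + t) = one_tens_pretensor s + one_tens_pretensor t"
  unfolding one_tens_pretensor_def
  by (rule setsum_keys_plus_distrib[of "\<lambda>k c. Poly_Mapping.single (Elementary (1 \<otimes>\<^sub>m left_factor k) (right_factor k)) c"])
    (simp_all add: single_add)

lemma one_tens_pretensor_star:
  "one_tens_pretensor (pretensor_star t) = pretensor_star (one_tens_pretensor t)"
  by (induction t rule: pretensor_induct)
    (simp_all add: pretensor_star_add one_tens_pretensor_add tens_star star_1)

lemma slice_assoc_map_lift: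
  fixes t :: "('a :: unital_cstar_algebra \<otimes>\<^sub>m 'b :: unital_cstar_algebra, 'c :: unital_cstar_algebra) pretensor"
  assumes \<phi>: "state \<phi>" and \<psi>: "state \<psi>" and \<theta>: "state \<theta>"
  shows "tensor_functional \<psi> \<theta> (of_pretensor p * (slice \<phi> (pretensor_lift assoc_map t) * of_pretensor q))
    = product_functional (tensor_functional \<phi> \<psi>) \<theta> (one_tens_pretensor p * (t * one_tens_pretensor q))"
    (is "?L p t q = ?R p t q")
proof -
  note lin = bounded_clinear_clinear[OF slice_facts(1)[OF state_span_state[OF \<phi>]]]
    bounded_clinear_clinear[OF tensor_functional_state_facts(1)[OF \<psi> \<theta>]]
  note add = lin[THEN clinear_add] and sc = lin[THEN clinear_scaleC]
  show ?thesis
  proof (induction p rule: pretensor_induct)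
    case (single k c)
    show ?case
    proof (induction q rule: pretensor_induct)
      case (single k' c')
      show ?case
      proof (induction t rule: pretensor_induct)
        case (single k'' c'')
        show ?case
          by (simp add: of_pretensor_single mult_single plus_elementary_def sc mult_scaleC_left mult_scaleC_right
              slice_assoc_map[OF assms] scaleC_scaleC) (simp add: scaleC_complex_def mult_ac)
      qed (simp add: pretensor_lift_add add distrib_left distrib_right product_functional_add)
    qed (simp add: of_pretensor_add one_tens_pretensor_add add distrib_left distrib_right product_functional_add)
  qed (simp add: of_pretensor_add one_tens_pretensor_add add distrib_left distrib_right product_functional_add)
qed

text \<open>The quadratic form of the slice at \<open>s\<close> is that of \<open>t\<close> at the
  regrouped vector 1 \<otimes> s for a product state, where \<open>min_seminorm t\<close> bounds it.
  Passing from the form to the norm uses self-adjointness, hence the hypothesis on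
  \<open>t\<close>.\<close>

lemma norm_slice_assoc_map_le:
  fixes t :: "('a :: unital_cstar_algebra \<otimes>\<^sub>m 'b :: unital_cstar_algebra, 'c :: unital_cstar_algebra) pretensor"
  assumes \<phi>: "state \<phi>" and t: "pretensor_star t = t"
  shows "norm (slice \<phi> (pretensor_lift assoc_map t)) \<le> min_seminorm t"
proof (rule tensor_norm_le_selfadjoint[OF _ min_seminorm_ge_0])
  have "star (pretensor_lift assoc_map t) = pretensor_lift assoc_map t"
    by (simp add: pretensor_lift_star[of assoc_map, OF assoc_map_star, symmetric] t)
  then show "star (slice \<phi> (pretensor_lift assoc_map t)) = slice \<phi> (pretensor_lift assoc_map t)"
    by (simp add: slice_star[OF \<phi>, symmetric])
next
  fix \<psi> :: "'b \<Rightarrow> complex" and \<theta> :: "'c \<Rightarrow> complex" and s :: "('b, 'c) pretensor"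
  assume st: "state \<psi>" "state \<theta>"
  let ?P = "product_functional (tensor_functional \<phi> \<psi>) \<theta>" and ?v = "one_tens_pretensor s"
  note eq = slice_assoc_map_lift[OF \<phi> st, of "pretensor_star s" _ s, unfolded of_pretensor_star one_tens_pretensor_star]
  have "cmod (?P (pretensor_star ?v * (t * ?v))) \<le> min_seminorm t * Re (?P (pretensor_star ?v * ?v))"
    by (rule product_functional_le[OF tensor_functional_state[OF \<phi> st(1)] st(2)])
  moreover have "?P (pretensor_star ?v * ?v) = tensor_functional \<psi> \<theta> (star (of_pretensor s) * of_pretensor s)"
  proof -
    have "slice \<phi> (1 :: 'a \<otimes>\<^sub>m 'b \<otimes>\<^sub>m 'c) = 1"
      using slice_facts(2)[OF state_span_state[OF \<phi>], of 1 "1 :: 'b \<otimes>\<^sub>m 'c"]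
      by (simp add: tens_one state_one[OF \<phi>] cvec.scale_one)
    then show ?thesis using eq[of 1] by (simp add: pretensor_lift_one assoc_map_one)
  qed
  ultimately show "cmod (tensor_functional \<psi> \<theta>
      (star (of_pretensor s) * (slice \<phi> (pretensor_lift assoc_map t) * of_pretensor s)))
    \<le> min_seminorm t * Re (tensor_functional \<psi> \<theta> (star (of_pretensor s) * of_pretensor s))"
    by (simp only: eq)
qed

lemma norm_slice_span_assoc_map_le:
  fixes \<xi> :: "'a :: unital_cstar_algebra \<Rightarrow> complex"
  assumes "state_span \<xi>"
  shows "\<exists>C\<ge>0. \<forall>t :: ('a \<otimes>\<^sub>m 'b :: unital_cstar_algebra, 'c :: unital_cstar_algebra) pretensor.
    pretensor_star t = t \<longrightarrow> norm (slice \<xi> (pretensor_lift assoc_map t)) \<le> C * min_seminorm t"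
  using assms
proof (induction rule: state_span.induct)
  case zero
  have "slice (\<lambda>_. 0) = (\<lambda>_ :: 'a \<otimes>\<^sub>m 'b \<otimes>\<^sub>m 'c. 0)"
    unfolding slice_def
    by (rule tensor_extension_eqI) (auto intro!: bounded_clinearI[where K=0] clinearI)
  then show ?case by (intro exI[of _ 0]) simp
next
  case (add \<xi> \<phi> c)
  then obtain C where C: "C \<ge> 0" "\<And>t :: ('a \<otimes>\<^sub>m 'b, 'c) pretensor. pretensor_star t = t \<Longrightarrow>
      norm (slice \<xi> (pretensor_lift assoc_map t)) \<le> C * min_seminorm t" by blast
  note S = slice_facts[OF add(1)] and S' = slice_facts[OF state_span_state[OF add(2)]]
  have eq: "slice (\<lambda>a. \<xi> a + c * \<phi> a) = (\<lambda>u :: 'a \<otimes>\<^sub>m 'b \<otimes>\<^sub>m 'c. slice \<xi> u + c *\<^sub>C slice \<phi> u)"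
    unfolding slice_def[of "\<lambda>a. \<xi> a + c * \<phi> a"]
  proof (rule tensor_extension_eqI)
    show "bounded_clinear (\<lambda>u :: 'a \<otimes>\<^sub>m 'b \<otimes>\<^sub>m 'c. slice \<xi> u + c *\<^sub>C slice \<phi> u)"
      by (rule bounded_clinear_intros(5)[OF S(1)], rule bounded_clinear_intros(4)[OF S'(1)])
  qed (simp add: S(2) S'(2) scaleC_add_left scaleC_scaleC)
  have "norm (slice (\<lambda>a. \<xi> a + c * \<phi> a) (pretensor_lift assoc_map t)) \<le> (C + cmod c) * min_seminorm t"
    if t: "pretensor_star t = t" for t :: "('a \<otimes>\<^sub>m 'b, 'c) pretensor"
  proof -
    have "norm (slice (\<lambda>a. \<xi> a + c * \<phi> a) (pretensor_lift assoc_map t))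
        \<le> norm (slice \<xi> (pretensor_lift assoc_map t)) + norm (c *\<^sub>C slice \<phi> (pretensor_lift assoc_map t))"
      unfolding eq by (rule norm_triangle_ineq)
    also have "\<dots> \<le> C * min_seminorm t + cmod c * min_seminorm t"
      unfolding norm_scaleC by (intro add_mono mult_left_mono C(2) norm_slice_assoc_map_le add(2) t) simp
    finally show ?thesis by (simp add: distrib_right)
  qed
  then show ?case using C(1) by (intro exI[of _ "C + cmod c"]) simp
qed

lemma assoc_map_lift_le: "norm (pretensor_lift assoc_map t) \<le> 1 * min_seminorm t"
  for t :: "('a :: unital_cstar_algebra \<otimes>\<^sub>m 'b :: unital_cstar_algebra, 'c :: unital_cstar_algebra) pretensor"
proof -
  have "norm (pretensor_lift assoc_map t) \<le> min_seminorm t"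
  proof (rule tensor_hom_contractive)
    show "pretensor_lift assoc_map (s * t) = pretensor_lift assoc_map s * pretensor_lift assoc_map t"
      for s t :: "('a \<otimes>\<^sub>m 'b, 'c) pretensor"
      by (rule pretensor_lift_mult) (rule assoc_map_mult)
    show "pretensor_lift assoc_map (pretensor_star t) = star (pretensor_lift assoc_map t)"
      for t :: "('a \<otimes>\<^sub>m 'b, 'c) pretensor"
      by (rule pretensor_lift_star) (rule assoc_map_star)
    show "pretensor_lift assoc_map (1 :: ('a \<otimes>\<^sub>m 'b, 'c) pretensor) = 1"
      by (simp add: pretensor_lift_one assoc_map_one)
    fix \<phi> :: "'a \<Rightarrow> complex" and \<omega> :: "'b \<otimes>\<^sub>m 'c \<Rightarrow> complex" and s :: "('a, 'b \<otimes>\<^sub>m 'c) pretensor"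
    assume st: "state \<phi>" "state \<omega>"
    let ?T = "tensor_functional \<phi> \<omega>" and ?s = "of_pretensor s"
    let ?K = "Poly_Mapping.keys s" and ?l = "Poly_Mapping.lookup s"
    note T = tensor_functional_state_facts[OF st]
    define \<xi> where "\<xi> i j a = \<phi> (star (left_factor i) * (a * left_factor j))"
      for i j :: "('a, 'b \<otimes>\<^sub>m 'c) elementary" and a
    have \<xi>: "state_span (\<xi> i j)" for i j
      using unital_star_hom_state_span[OF unital_star_hom_id st(1), of "left_factor i" "left_factor j"]
      by (simp add: \<xi>_def[abs_def])
    note S = slice_facts[OF \<xi>]
    obtain C where C: "\<And>i j. C i j \<ge> 0" "\<And>i j (t :: ('a \<otimes>\<^sub>m 'b, 'c) pretensor). pretensor_star t = t \<Longrightarrow>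
        norm (slice (\<xi> i j) (pretensor_lift assoc_map t)) \<le> C i j * min_seminorm t"
      using norm_slice_span_assoc_map_le[OF \<xi>] by metis
    \<comment> \<open>Only the left factors of \<open>s\<close> are absorbed into slices. The right
      factors stay inside \<omega>, which is then estimated by the norm of its argument.\<close>
    have "(\<lambda>u. ?T (star ?s * (u * ?s))) = (\<lambda>u. \<Sum>i\<in>?K. \<Sum>j\<in>?K.
        (cnj (?l i) * ?l j) *\<^sub>C \<omega> (star (right_factor i) * (slice (\<xi> i j) u * right_factor j)))"
    proof (rule bounded_clinear_tensor_eqI)
      show "bounded_clinear (\<lambda>u. ?T (star ?s * (u * ?s)))"
        by (rule bounded_clinear_intros(6)[OF T(1)], rule bounded_clinear_intros(2),
            rule bounded_clinear_intros(3), rule bounded_clinear_intros(1))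
      show "bounded_clinear (\<lambda>u. \<Sum>i\<in>?K. \<Sum>j\<in>?K.
          (cnj (?l i) * ?l j) *\<^sub>C \<omega> (star (right_factor i) * (slice (\<xi> i j) u * right_factor j)))"
        by (rule bounded_clinear_intros(7), rule bounded_clinear_intros(7), rule bounded_clinear_intros(4),
            rule bounded_clinear_intros(6)[OF state_bounded_clinear[OF st(2)]], rule bounded_clinear_intros(2),
            rule bounded_clinear_intros(3), rule bounded_clinear_intros(6)[OF S(1)], rule bounded_clinear_intros(1))
      fix a :: 'a and y :: "'b \<otimes>\<^sub>m 'c"
      have "star ?s * ((a \<otimes>\<^sub>m y) * ?s) = of_pretensor (pretensor_star s * (Poly_Mapping.single (Elementary a y) 1 * s))"
        by (simp add: of_pretensor_mult of_pretensor_star tens_def)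
      then have "?T (star ?s * ((a \<otimes>\<^sub>m y) * ?s)) =
          product_functional \<phi> \<omega> (pretensor_star s * (Poly_Mapping.single (Elementary a y) 1 * s))"
        by (simp only: T)
      then show "?T (star ?s * ((a \<otimes>\<^sub>m y) * ?s)) = (\<Sum>i\<in>?K. \<Sum>j\<in>?K.
          (cnj (?l i) * ?l j) *\<^sub>C \<omega> (star (right_factor i) * (slice (\<xi> i j) (a \<otimes>\<^sub>m y) * right_factor j)))"
        unfolding product_functional_sandwich
        by (simp add: S(2) \<xi>_def mult_scaleC_left mult_scaleC_right clinear_scaleC[OF state_clinear[OF st(2)]]
            scaleC_complex_def mult.assoc)
    qed
    then have T': "?T (star ?s * (u * ?s)) = (\<Sum>i\<in>?K. \<Sum>j\<in>?K.
        (cnj (?l i) * ?l j) *\<^sub>C \<omega> (star (right_factor i) * (slice (\<xi> i j) u * right_factor j)))" for u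
      by metis
    define D where "D i j = cmod (?l i) * cmod (?l j) * (norm (right_factor i) * (C i j * norm (right_factor j)))" for i j
    have "cmod (?T (star ?s * (pretensor_lift assoc_map t * ?s))) \<le> (\<Sum>i\<in>?K. \<Sum>j\<in>?K. D i j) * min_seminorm t"
      if t: "pretensor_star t = t" for t :: "('a \<otimes>\<^sub>m 'b, 'c) pretensor"
    proof -
      have "cmod ((cnj (?l i) * ?l j) *\<^sub>C \<omega> (star (right_factor i) * (slice (\<xi> i j) (pretensor_lift assoc_map t) * right_factor j)))
          \<le> D i j * min_seminorm t" for i j
      proof -
        have "cmod (\<omega> (star (right_factor i) * (slice (\<xi> i j) (pretensor_lift assoc_map t) * right_factor j)))
            \<le> norm (star (right_factor i) * (slice (\<xi> i j) (pretensor_lift assoc_map t) * right_factor j))"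
          by (rule state_norm_le[OF st(2)])
        also have "\<dots> \<le> norm (right_factor i) * (norm (slice (\<xi> i j) (pretensor_lift assoc_map t)) * norm (right_factor j))"
          by (rule order_trans[OF norm_mult_ineq]) (simp add: norm_star mult_left_mono norm_mult_ineq)
        also have "\<dots> \<le> norm (right_factor i) * ((C i j * min_seminorm t) * norm (right_factor j))"
          by (intro mult_left_mono mult_right_mono C(2) t) simp_all
        finally have "cmod (?l i) * cmod (?l j) *
            cmod (\<omega> (star (right_factor i) * (slice (\<xi> i j) (pretensor_lift assoc_map t) * right_factor j)))
            \<le> cmod (?l i) * cmod (?l j) * (norm (right_factor i) * ((C i j * min_seminorm t) * norm (right_factor j)))"
          by (intro mult_left_mono) simp_all
        then show ?thesis by (simp add: norm_scaleC norm_mult D_def mult_ac)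
      qed
      then show ?thesis
        unfolding T' sum_distrib_right by (intro sum_norm_le order_trans[OF norm_sum] sum_mono)
    qed
    moreover have "0 \<le> (\<Sum>i\<in>?K. \<Sum>j\<in>?K. D i j)"
      unfolding D_def by (intro sum_nonneg mult_nonneg_nonneg C) simp_all
    ultimately show "\<exists>C\<ge>0. \<forall>t. pretensor_star t = t \<longrightarrow>
        cmod (?T (star ?s * (pretensor_lift assoc_map t * ?s))) \<le> C * min_seminorm t"
      by blast
  qed
  then show ?thesis by simp
qed

lemma tensor_assoc_facts:
  shows "bounded_clinear (tensor_assoc ::
      ('a :: unital_cstar_algebra \<otimes>\<^sub>m 'b :: unital_cstar_algebra) \<otimes>\<^sub>m 'c :: unital_cstar_algebra \<Rightarrow> _)"
    and "tensor_assoc (((a :: 'a) \<otimes>\<^sub>m (b :: 'b)) \<otimes>\<^sub>m (c :: 'c)) = a \<otimes>\<^sub>m b \<otimes>\<^sub>m c"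
proof -
  let ?h = "tensor_extension assoc_map :: ('a \<otimes>\<^sub>m 'b) \<otimes>\<^sub>m 'c \<Rightarrow> _"
  note h = tensor_extension_exists(1,3)[OF assoc_map_lift_le]
  have "tensor_assoc = ?h"
    unfolding tensor_assoc_def
  proof (rule the_equality)
    show "bounded_clinear ?h \<and> (\<forall>a b c. ?h ((a \<otimes>\<^sub>m b) \<otimes>\<^sub>m c) = a \<otimes>\<^sub>m b \<otimes>\<^sub>m c)"
      by (simp add: h assoc_map_tens)
    fix g :: "('a \<otimes>\<^sub>m 'b) \<otimes>\<^sub>m 'c \<Rightarrow> 'a \<otimes>\<^sub>m 'b \<otimes>\<^sub>m 'c"
    assume g: "bounded_clinear g \<and> (\<forall>a b c. g ((a \<otimes>\<^sub>m b) \<otimes>\<^sub>m c) = a \<otimes>\<^sub>m b \<otimes>\<^sub>m c)"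
    show "g = ?h"
    proof (rule bounded_clinear_tensor_eqI)
      fix x :: "'a \<otimes>\<^sub>m 'b" and c :: 'c
      \<comment> \<open>Uniqueness in two stages: here \<open>c\<close> is fixed and both sides are
        compared as bounded maps of \<open>x\<close>; this supplies the values on elementary tensors
        for the outer product.\<close>
      have "(\<lambda>x. g (x \<otimes>\<^sub>m c)) = (\<lambda>x. ?h (x \<otimes>\<^sub>m c))"
        using g h(1) by (intro bounded_clinear_tensor_eqI bounded_clinear_intros(6)[OF _ bounded_clinear_tens_left])
          (simp_all add: h(2) assoc_map_tens)
      then show "g (x \<otimes>\<^sub>m c) = ?h (x \<otimes>\<^sub>m c)" by metis
    qed (use g h in auto)
  qed
  note eq = this
  show "bounded_clinear (tensor_assoc :: ('a \<otimes>\<^sub>m 'b) \<otimes>\<^sub>m 'c \<Rightarrow> _)"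
    unfolding eq by (rule h(1))
  show "tensor_assoc (((a :: 'a) \<otimes>\<^sub>m (b :: 'b)) \<otimes>\<^sub>m (c :: 'c)) = a \<otimes>\<^sub>m b \<otimes>\<^sub>m c"
    unfolding eq h(2) by (rule assoc_map_tens)
qed

section \<open>The antipode is antimultiplicative\<close>

lemma sum_swap_pairs:
  "(\<Sum>m\<in>M. \<Sum>k\<in>K m. \<Sum>i\<in>N. \<Sum>j\<in>J i. f m k i j) = (\<Sum>i\<in>N. \<Sum>j\<in>J i. \<Sum>m\<in>M. \<Sum>k\<in>K m. f m k i j)"
proof -
  have 1: "(\<Sum>k\<in>A. \<Sum>i\<in>N. \<Sum>j\<in>J i. g k i j) = (\<Sum>i\<in>N. \<Sum>j\<in>J i. \<Sum>k\<in>A. g k i j)"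
    for A :: "'z set" and g
  proof -
    have "(\<Sum>k\<in>A. \<Sum>i\<in>N. \<Sum>j\<in>J i. g k i j) = (\<Sum>i\<in>N. \<Sum>k\<in>A. \<Sum>j\<in>J i. g k i j)" by (rule sum.swap)
    also have "\<dots> = (\<Sum>i\<in>N. \<Sum>j\<in>J i. \<Sum>k\<in>A. g k i j)" by (rule sum.cong[OF refl], rule sum.swap)
    finally show ?thesis .
  qed
  show ?thesis unfolding 1 ..
qed

lemma cspan_tens_sum:
  assumes "x \<in> cspan {b \<otimes>\<^sub>m c |b c. b \<in> S \<and> c \<in> S}" and S: "csubspace S"
  obtains n :: nat and b c where "\<And>i. i < n \<Longrightarrow> b i \<in> S \<and> c i \<in> S" "x = (\<Sum>i<n. b i \<otimes>\<^sub>m c i)"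
proof -
  have "\<exists>(n :: nat) b c. (\<forall>i<n. b i \<in> S \<and> c i \<in> S) \<and> x = (\<Sum>i<n. b i \<otimes>\<^sub>m c i)"
    using assms(1)
  proof (induction rule: cvec.span_induct_alt)
    case base
    show ?case by (intro exI[of _ 0]) simp
  next
    case (step d y z)
    then obtain b0 c0 and n :: nat and b c where y: "y = b0 \<otimes>\<^sub>m c0" "b0 \<in> S" "c0 \<in> S"
      and bc: "\<forall>i<n. b i \<in> S \<and> c i \<in> S" "z = (\<Sum>i<n. b i \<otimes>\<^sub>m c i)" by blast
    have "d *\<^sub>C y + z = (\<Sum>i<Suc n. (b(n := d *\<^sub>C b0)) i \<otimes>\<^sub>m (c(n := c0)) i)"
      by (simp add: y bc tens_scaleC_left add.commute)
    moreover have "\<forall>i<Suc n. (b(n := d *\<^sub>C b0)) i \<in> S \<and> (c(n := c0)) i \<in> S"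
      using y bc cvec.subspace_scale[OF S] by (simp add: less_Suc_eq)
    ultimately show ?case by blast
  qed
  then show ?thesis using that by blast
qed

text \<open>On a finite set a linear map is a combination of states, since states separate points.\<close>

lemma clinear_state_combination:
  fixes L :: "'a :: unital_cstar_algebra \<Rightarrow> 'b :: unital_cstar_algebra"
  assumes L: "clinear L" and X: "finite X"
  obtains n :: nat and \<phi> w where "\<And>k. k < n \<Longrightarrow> state (\<phi> k)" "\<And>x. x \<in> X \<Longrightarrow> L x = (\<Sum>k<n. \<phi> k x *\<^sub>C w k)"
proof -
  \<comment> \<open>Stated for a family \<open>x\<close>, so that the induction may replace the
    vectors by their differences with multiples of \<open>x m\<close>.\<close>
  have "\<exists>(n :: nat) \<phi> w. (\<forall>k<n. state (\<phi> k)) \<and> (\<forall>i\<in>I. L (x i) = (\<Sum>k<n. \<phi> k (x i) *\<^sub>C w k))"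
    if "finite I" for I :: "'a set" and x
    using that
  proof (induction I arbitrary: x rule: finite_induct)
    case empty
    show ?case by auto
  next
    case (insert m I)
    show ?case
    proof (cases "x m = 0")
      case True
      obtain n :: nat and \<phi> w where *: "\<forall>k<n. state (\<phi> k)" "\<forall>i\<in>I. L (x i) = (\<Sum>k<n. \<phi> k (x i) *\<^sub>C w k)"
        using insert.IH by blast
      have "L (x m) = (\<Sum>k<n. \<phi> k (x m) *\<^sub>C w k)"
        using * by (simp add: True clinear_0[OF L] clinear_0[OF state_clinear])
      with * show ?thesis by blast
    next
      case False
      then obtain \<psi> where \<psi>: "state \<psi>" "\<psi> (x m) \<noteq> 0" using state_separating by blast
      define c where "c i = \<psi> (x i) / \<psi> (x m)" for i
      obtain n :: nat and \<phi> w where *: "\<And>k. k < n \<Longrightarrow> state (\<phi> k)"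
        "\<And>i. i \<in> I \<Longrightarrow> L (x i - c i *\<^sub>C x m) = (\<Sum>k<n. \<phi> k (x i - c i *\<^sub>C x m) *\<^sub>C w k)"
        using insert.IH[of "\<lambda>i. x i - c i *\<^sub>C x m"] by blast
      \<comment> \<open>On \<open>x i\<close> the error of the combination for the differences is
        \<open>c i\<close> times its error at \<open>x m\<close>, hence proportional to \<psi>. One
        further term \<psi> with coefficient \<open>v\<close> removes it.\<close>
      define v where "v = (1 / \<psi> (x m)) *\<^sub>C (L (x m) - (\<Sum>k<n. \<phi> k (x m) *\<^sub>C w k))"
      have \<psi>v: "\<psi> (x i) *\<^sub>C v = c i *\<^sub>C L (x m) - c i *\<^sub>C (\<Sum>k<n. \<phi> k (x m) *\<^sub>C w k)" for i
        by (simp add: v_def c_def scaleC_scaleC cvec.scale_right_diff_distrib)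
      have I: "L (x i) = (\<Sum>k<n. \<phi> k (x i) *\<^sub>C w k) + \<psi> (x i) *\<^sub>C v" if "i \<in> I" for i
      proof -
        have lin: "\<phi> k (x i - c i *\<^sub>C x m) = \<phi> k (x i) - c i * \<phi> k (x m)" if "k < n" for k
          using state_clinear[OF *(1)[OF that]]
          by (simp add: clinear_diff clinear_scaleC scaleC_complex_def)
        have "L (x i) - c i *\<^sub>C L (x m) = (\<Sum>k<n. \<phi> k (x i - c i *\<^sub>C x m) *\<^sub>C w k)"
          using *(2)[OF that] by (simp add: clinear_diff[OF L] clinear_scaleC[OF L])
        also have "\<dots> = (\<Sum>k<n. \<phi> k (x i) *\<^sub>C w k) - c i *\<^sub>C (\<Sum>k<n. \<phi> k (x m) *\<^sub>C w k)"
          by (simp add: lin cvec.scale_left_diff_distrib sum_subtractf cvec.scale_sum_right scaleC_scaleC)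
        finally show ?thesis by (simp add: \<psi>v algebra_simps)
      qed
      have m: "L (x m) = (\<Sum>k<n. \<phi> k (x m) *\<^sub>C w k) + \<psi> (x m) *\<^sub>C v"
        unfolding \<psi>v using \<psi>(2) by (simp add: c_def cvec.scale_one)
      show ?thesis
      proof (intro exI conjI)
        show "\<forall>k<Suc n. state ((\<phi>(n := \<psi>)) k)" using * \<psi> by (simp add: less_Suc_eq)
        show "\<forall>i\<in>insert m I. L (x i) = (\<Sum>k<Suc n. (\<phi>(n := \<psi>)) k (x i) *\<^sub>C (w(n := v)) k)"
          using I m by simp
      qed
    qed
  qed
  from this[OF X, of id] obtain n :: nat and \<phi> w where
    "\<forall>k<n. state (\<phi> k)" "\<forall>x\<in>X. L x = (\<Sum>k<n. \<phi> k x *\<^sub>C w k)" by auto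
  then show ?thesis using that[of n \<phi> w] by blast
qed

text \<open>Multiplying the legs together need not be bounded for the minimal norm, so it cannot be
  applied to the equation directly. On the finitely many legs the three maps are combinations of
  states, and products of states are bounded functionals on the triple tensor product.\<close>

lemma triple_tensor_sum_eq:
  fixes x :: "'i \<Rightarrow> 'q :: unital_cstar_algebra" and x' :: "'j \<Rightarrow> 'q"
  assumes eq: "(\<Sum>i\<in>I. x i \<otimes>\<^sub>m y i \<otimes>\<^sub>m z i) = (\<Sum>j\<in>J. x' j \<otimes>\<^sub>m y' j \<otimes>\<^sub>m (z' j :: 'q))"
    and fin: "finite I" "finite J"
    and L: "clinear L\<^sub>1" "clinear L\<^sub>2" "clinear L\<^sub>3"
  shows "(\<Sum>i\<in>I. L\<^sub>1 (x i) * (L\<^sub>2 (y i) * L\<^sub>3 (z i))) = (\<Sum>j\<in>J. L\<^sub>1 (x' j) * (L\<^sub>2 (y' j) * (L\<^sub>3 (z' j) :: 'q)))"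
proof -
  obtain n\<^sub>1 :: nat and \<phi>\<^sub>1 u where 1: "\<And>k. k < n\<^sub>1 \<Longrightarrow> state (\<phi>\<^sub>1 k)"
    "\<And>q. q \<in> x ` I \<union> x' ` J \<Longrightarrow> L\<^sub>1 q = (\<Sum>k<n\<^sub>1. \<phi>\<^sub>1 k q *\<^sub>C u k)"
    using clinear_state_combination[OF L(1), of "x ` I \<union> x' ` J"] fin by auto
  obtain n\<^sub>2 :: nat and \<phi>\<^sub>2 v where 2: "\<And>k. k < n\<^sub>2 \<Longrightarrow> state (\<phi>\<^sub>2 k)"
    "\<And>q. q \<in> y ` I \<union> y' ` J \<Longrightarrow> L\<^sub>2 q = (\<Sum>k<n\<^sub>2. \<phi>\<^sub>2 k q *\<^sub>C v k)"
    using clinear_state_combination[OF L(2), of "y ` I \<union> y' ` J"] fin by auto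
  obtain n\<^sub>3 :: nat and \<phi>\<^sub>3 w where 3: "\<And>k. k < n\<^sub>3 \<Longrightarrow> state (\<phi>\<^sub>3 k)"
    "\<And>q. q \<in> z ` I \<union> z' ` J \<Longrightarrow> L\<^sub>3 q = (\<Sum>k<n\<^sub>3. \<phi>\<^sub>3 k q *\<^sub>C w k)"
    using clinear_state_combination[OF L(3), of "z ` I \<union> z' ` J"] fin by auto
  define \<Phi> where "\<Phi> k l m = tensor_functional (\<phi>\<^sub>1 k) (tensor_functional (\<phi>\<^sub>2 l) (\<phi>\<^sub>3 m))" for k l m
  have expand: "(\<Sum>i\<in>K. L\<^sub>1 (a i) * (L\<^sub>2 (b i) * L\<^sub>3 (c i))) =
      (\<Sum>k<n\<^sub>1. \<Sum>l<n\<^sub>2. \<Sum>m<n\<^sub>3. \<Phi> k l m (\<Sum>i\<in>K. a i \<otimes>\<^sub>m b i \<otimes>\<^sub>m c i) *\<^sub>C (u k * (v l * w m)))"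
    if K: "a ` K \<subseteq> x ` I \<union> x' ` J" "b ` K \<subseteq> y ` I \<union> y' ` J" "c ` K \<subseteq> z ` I \<union> z' ` J"
    for K :: "'k set" and a b c
  proof -
    have "(\<Sum>i\<in>K. L\<^sub>1 (a i) * (L\<^sub>2 (b i) * L\<^sub>3 (c i))) =
      (\<Sum>i\<in>K. \<Sum>k<n\<^sub>1. \<Sum>l<n\<^sub>2. \<Sum>m<n\<^sub>3. (\<phi>\<^sub>1 k (a i) * (\<phi>\<^sub>2 l (b i) * \<phi>\<^sub>3 m (c i))) *\<^sub>C (u k * (v l * w m)))"
    proof (rule sum.cong[OF refl])
      fix i assume i: "i \<in> K"
      have "L\<^sub>1 (a i) * (L\<^sub>2 (b i) * L\<^sub>3 (c i)) =
          (\<Sum>k<n\<^sub>1. \<phi>\<^sub>1 k (a i) *\<^sub>C u k) * ((\<Sum>l<n\<^sub>2. \<phi>\<^sub>2 l (b i) *\<^sub>C v l) * (\<Sum>m<n\<^sub>3. \<phi>\<^sub>3 m (c i) *\<^sub>C w m))"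
        using K i 1(2)[of "a i"] 2(2)[of "b i"] 3(2)[of "c i"] by (simp add: image_subset_iff)
      also have "\<dots> = (\<Sum>k<n\<^sub>1. \<Sum>l<n\<^sub>2. \<Sum>m<n\<^sub>3. (\<phi>\<^sub>1 k (a i) * (\<phi>\<^sub>2 l (b i) * \<phi>\<^sub>3 m (c i))) *\<^sub>C (u k * (v l * w m)))"
        by (subst sum_product, subst sum_product)
          (simp add: sum_distrib_left mult_scaleC_left mult_scaleC_right scaleC_scaleC mult_ac)
      finally show "L\<^sub>1 (a i) * (L\<^sub>2 (b i) * L\<^sub>3 (c i)) = \<dots>" .
    qed
    also have "\<dots> = (\<Sum>k<n\<^sub>1. \<Sum>l<n\<^sub>2. \<Sum>m<n\<^sub>3. \<Sum>i\<in>K. (\<phi>\<^sub>1 k (a i) * (\<phi>\<^sub>2 l (b i) * \<phi>\<^sub>3 m (c i))) *\<^sub>C (u k * (v l * w m)))"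
      by (simp only: sum.swap[of _ _ K])
    also have "\<dots> = (\<Sum>k<n\<^sub>1. \<Sum>l<n\<^sub>2. \<Sum>m<n\<^sub>3. \<Phi> k l m (\<Sum>i\<in>K. a i \<otimes>\<^sub>m b i \<otimes>\<^sub>m c i) *\<^sub>C (u k * (v l * w m)))"
    proof (intro sum.cong refl)
      fix k l m assume "k \<in> {..<n\<^sub>1}" "l \<in> {..<n\<^sub>2}" "m \<in> {..<n\<^sub>3}"
      then have st: "state (\<phi>\<^sub>1 k)" "state (\<phi>\<^sub>2 l)" "state (\<phi>\<^sub>3 m)" using 1 2 3 by auto
      note T = tensor_functional_state_facts[OF st(2,3)]
        and U = tensor_functional_state_facts[OF st(1) tensor_functional_state[OF st(2,3)]]
      show "(\<Sum>i\<in>K. (\<phi>\<^sub>1 k (a i) * (\<phi>\<^sub>2 l (b i) * \<phi>\<^sub>3 m (c i))) *\<^sub>C (u k * (v l * w m))) =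
          \<Phi> k l m (\<Sum>i\<in>K. a i \<otimes>\<^sub>m b i \<otimes>\<^sub>m c i) *\<^sub>C (u k * (v l * w m))"
        by (simp add: \<Phi>_def clinear_sum[OF bounded_clinear_clinear[OF U(1)]] U(3) T(3) cvec.scale_sum_left)
    qed
    finally show ?thesis .
  qed
  show ?thesis
    using expand[of x I y z] expand[of x' J y' z'] eq by simp
qed

section \<open>Hopf algebra identities in terms of chosen legs\<close>

locale hopf_star_algebra =
  fixes \<Delta> :: "'q :: unital_cstar_algebra \<Rightarrow> 'q \<otimes>\<^sub>m 'q" and \<kappa> :: "'q \<Rightarrow> 'q" and Q\<^sub>0 \<epsilon>
  assumes \<Delta>: "unital_star_hom \<Delta>"
    and coassoc: "tensor_assoc (tensor_map \<Delta> id (\<Delta> a)) = tensor_map id \<Delta> (\<Delta> a)"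
    and \<kappa>: "bounded_clinear \<kappa>"
    and hopf: "dense_hopf_star_subalgebra \<Delta> Q\<^sub>0 \<epsilon> \<kappa>"
begin

lemma star_subalgebra: "csubspace Q\<^sub>0" "a \<in> Q\<^sub>0 \<Longrightarrow> b \<in> Q\<^sub>0 \<Longrightarrow> a * b \<in> Q\<^sub>0" "1 \<in> Q\<^sub>0" "closure Q\<^sub>0 = UNIV"
  using hopf by (auto simp: dense_hopf_star_subalgebra_def star_subalgebra_def)

lemma counit_mult: "a \<in> Q\<^sub>0 \<Longrightarrow> b \<in> Q\<^sub>0 \<Longrightarrow> \<epsilon> (a * b) = \<epsilon> a * \<epsilon> b" and counit_one: "\<epsilon> 1 = 1"
  using hopf by (auto simp: dense_hopf_star_subalgebra_def)

text \<open>A choice of expansion for every element at once; \<open>l a i\<close> and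
  \<open>r a i\<close> play the part of Sweedler's a_1 and a_2.\<close>

lemma comult_sum:
  obtains n :: "'q \<Rightarrow> nat" and l r where
    "\<And>a i. a \<in> Q\<^sub>0 \<Longrightarrow> i < n a \<Longrightarrow> l a i \<in> Q\<^sub>0" "\<And>a i. a \<in> Q\<^sub>0 \<Longrightarrow> i < n a \<Longrightarrow> r a i \<in> Q\<^sub>0"
    "\<And>a. a \<in> Q\<^sub>0 \<Longrightarrow> \<Delta> a = (\<Sum>i<n a. l a i \<otimes>\<^sub>m r a i)"
proof -
  have "\<exists>(n :: nat) b c. a \<in> Q\<^sub>0 \<longrightarrow> (\<forall>i<n. b i \<in> Q\<^sub>0 \<and> c i \<in> Q\<^sub>0) \<and> \<Delta> a = (\<Sum>i<n. b i \<otimes>\<^sub>m c i)" for a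
  proof (cases "a \<in> Q\<^sub>0")
    case True
    then have "\<Delta> a \<in> cspan {b \<otimes>\<^sub>m c |b c. b \<in> Q\<^sub>0 \<and> c \<in> Q\<^sub>0}"
      using hopf by (simp add: dense_hopf_star_subalgebra_def)
    from cspan_tens_sum[OF this star_subalgebra(1)] show ?thesis by metis
  qed simp
  then have "\<forall>a. \<exists>(n :: nat) b c. a \<in> Q\<^sub>0 \<longrightarrow> (\<forall>i<n. b i \<in> Q\<^sub>0 \<and> c i \<in> Q\<^sub>0) \<and> \<Delta> a = (\<Sum>i<n. b i \<otimes>\<^sub>m c i)"
    by blast
  from choice[OF this] obtain n :: "'q \<Rightarrow> nat" where
    "\<forall>a. \<exists>b c. a \<in> Q\<^sub>0 \<longrightarrow> (\<forall>i<n a. b i \<in> Q\<^sub>0 \<and> c i \<in> Q\<^sub>0) \<and> \<Delta> a = (\<Sum>i<n a. b i \<otimes>\<^sub>m c i)" ..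
  from choice[OF this] obtain l where
    "\<forall>a. \<exists>c. a \<in> Q\<^sub>0 \<longrightarrow> (\<forall>i<n a. l a i \<in> Q\<^sub>0 \<and> c i \<in> Q\<^sub>0) \<and> \<Delta> a = (\<Sum>i<n a. l a i \<otimes>\<^sub>m c i)" ..
  from choice[OF this] obtain r where
    "\<forall>a. a \<in> Q\<^sub>0 \<longrightarrow> (\<forall>i<n a. l a i \<in> Q\<^sub>0 \<and> r a i \<in> Q\<^sub>0) \<and> \<Delta> a = (\<Sum>i<n a. l a i \<otimes>\<^sub>m r a i)" ..
  then show ?thesis using that[of n l r] by blast
qed

text \<open>The axioms speak of sums over i < n. Arbitrary finite index sets are wanted because the
  coproduct of a product is a sum over pairs.\<close>

lemma hopf_identities:
  assumes "a \<in> Q\<^sub>0" "finite K" "\<And>i. i \<in> K \<Longrightarrow> b i \<in> Q\<^sub>0 \<and> c i \<in> Q\<^sub>0" "\<Delta> a = (\<Sum>i\<in>K. b i \<otimes>\<^sub>m c i)"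
  shows "(\<Sum>i\<in>K. \<epsilon> (b i) *\<^sub>C c i) = a" "(\<Sum>i\<in>K. \<epsilon> (c i) *\<^sub>C b i) = a"
    "(\<Sum>i\<in>K. \<kappa> (b i) * c i) = \<epsilon> a *\<^sub>C 1" "(\<Sum>i\<in>K. b i * \<kappa> (c i)) = \<epsilon> a *\<^sub>C 1"
proof -
  obtain h where h: "bij_betw h {0..<card K} K" using ex_bij_betw_nat_finite[OF assms(2)] by blast
  have re: "(\<Sum>i\<in>K. g i) = (\<Sum>i<card K. g (h i))" for g :: "_ \<Rightarrow> 'z :: comm_monoid_add"
    using sum.reindex_bij_betw[OF h, of g] by (simp add: lessThan_atLeast0)
  have ax: "\<forall>a\<in>Q\<^sub>0. \<forall>n :: nat. \<forall>b c. (\<forall>i<n. b i \<in> Q\<^sub>0 \<and> c i \<in> Q\<^sub>0) \<and> \<Delta> a = (\<Sum>i<n. b i \<otimes>\<^sub>m c i) \<longrightarrow>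
        (\<Sum>i<n. \<epsilon> (b i) *\<^sub>C c i) = a \<and> (\<Sum>i<n. \<epsilon> (c i) *\<^sub>C b i) = a \<and>
        (\<Sum>i<n. \<kappa> (b i) * c i) = \<epsilon> a *\<^sub>C 1 \<and> (\<Sum>i<n. b i * \<kappa> (c i)) = \<epsilon> a *\<^sub>C 1"
    using hopf unfolding dense_hopf_star_subalgebra_def by (elim conjE)
  have "\<forall>i<card K. b (h i) \<in> Q\<^sub>0 \<and> c (h i) \<in> Q\<^sub>0"
    using bij_betwE[OF h] assms(3) by simp
  moreover have "\<Delta> a = (\<Sum>i<card K. b (h i) \<otimes>\<^sub>m c (h i))" using assms(4) by (simp add: re)
  ultimately have "(\<Sum>i<card K. \<epsilon> (b (h i)) *\<^sub>C c (h i)) = a \<and> (\<Sum>i<card K. \<epsilon> (c (h i)) *\<^sub>C b (h i)) = a \<and>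
        (\<Sum>i<card K. \<kappa> (b (h i)) * c (h i)) = \<epsilon> a *\<^sub>C 1 \<and> (\<Sum>i<card K. b (h i) * \<kappa> (c (h i))) = \<epsilon> a *\<^sub>C 1"
    using assms(1) ax[rule_format, of a "card K" "\<lambda>i. b (h i)" "\<lambda>i. c (h i)"] by simp
  then show "(\<Sum>i\<in>K. \<epsilon> (b i) *\<^sub>C c i) = a" "(\<Sum>i\<in>K. \<epsilon> (c i) *\<^sub>C b i) = a"
    "(\<Sum>i\<in>K. \<kappa> (b i) * c i) = \<epsilon> a *\<^sub>C 1" "(\<Sum>i\<in>K. b i * \<kappa> (c i)) = \<epsilon> a *\<^sub>C 1"
    by (simp_all add: re)
qed

text \<open>Coassociativity in Sweedler form: (a_1)_1, (a_1)_2, a_2 may be replaced by a_1, (a_2)_1,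
  (a_2)_2 in any product of linear images of the three legs.\<close>

lemma comult_coassoc:
  fixes n :: "'q \<Rightarrow> nat"
  assumes leg: "\<And>a i. a \<in> Q\<^sub>0 \<Longrightarrow> i < n a \<Longrightarrow> l a i \<in> Q\<^sub>0" "\<And>a i. a \<in> Q\<^sub>0 \<Longrightarrow> i < n a \<Longrightarrow> r a i \<in> Q\<^sub>0"
    and comult: "\<And>a. a \<in> Q\<^sub>0 \<Longrightarrow> \<Delta> a = (\<Sum>i<n a. l a i \<otimes>\<^sub>m r a i)"
    and a: "a \<in> Q\<^sub>0" and L: "clinear L\<^sub>1" "clinear L\<^sub>2" "clinear L\<^sub>3"
  shows "(\<Sum>i<n a. \<Sum>j<n (l a i). L\<^sub>1 (l (l a i) j) * (L\<^sub>2 (r (l a i) j) * (L\<^sub>3 (r a i) :: 'q))) =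
      (\<Sum>i<n a. \<Sum>j<n (r a i). L\<^sub>1 (l a i) * (L\<^sub>2 (l (r a i) j) * L\<^sub>3 (r (r a i) j)))"
proof -
  note M1 = tensor_map_facts[OF \<Delta> unital_star_hom_id] and M2 = tensor_map_facts[OF unital_star_hom_id \<Delta>]
  note lin = bounded_clinear_clinear[OF M1(1)] bounded_clinear_clinear[OF M2(1)]
    bounded_clinear_clinear[OF tensor_assoc_facts(1)]
  have tl: "(\<Sum>j\<in>J. f j) \<otimes>\<^sub>m x = (\<Sum>j\<in>J. f j \<otimes>\<^sub>m x)" for J :: "nat set" and f :: "nat \<Rightarrow> 'q \<otimes>\<^sub>m 'q" and x :: 'q
    by (rule clinear_sum[OF bounded_clinear_clinear[OF bounded_clinear_tens_left]])
  have tr: "x \<otimes>\<^sub>m (\<Sum>j\<in>J. f j) = (\<Sum>j\<in>J. x \<otimes>\<^sub>m f j)" for J :: "nat set" and f :: "nat \<Rightarrow> 'q \<otimes>\<^sub>m 'q" and x :: 'q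
    by (rule clinear_sum) (simp add: clinearI tens_add_right tens_scaleC_right)
  have "tensor_map \<Delta> id (\<Delta> a) = (\<Sum>i<n a. \<Delta> (l a i) \<otimes>\<^sub>m r a i)"
    by (simp add: comult[OF a] clinear_sum[OF lin(1)] M1(3))
  also have "\<dots> = (\<Sum>i<n a. \<Sum>j<n (l a i). (l (l a i) j \<otimes>\<^sub>m r (l a i) j) \<otimes>\<^sub>m r a i)"
    by (rule sum.cong[OF refl]) (simp only: lessThan_iff comult[OF leg(1)[OF a]] tl)
  finally have "tensor_assoc (tensor_map \<Delta> id (\<Delta> a)) =
      (\<Sum>i<n a. \<Sum>j<n (l a i). l (l a i) j \<otimes>\<^sub>m r (l a i) j \<otimes>\<^sub>m r a i)"
    by (simp add: clinear_sum[OF lin(3)] tensor_assoc_facts(2))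
  moreover have "tensor_map id \<Delta> (\<Delta> a) = (\<Sum>i<n a. l a i \<otimes>\<^sub>m \<Delta> (r a i))"
    by (simp add: comult[OF a] clinear_sum[OF lin(2)] M2(3))
  moreover have "\<dots> = (\<Sum>i<n a. \<Sum>j<n (r a i). l a i \<otimes>\<^sub>m l (r a i) j \<otimes>\<^sub>m r (r a i) j)"
    by (rule sum.cong[OF refl]) (simp only: lessThan_iff comult[OF leg(2)[OF a]] tr)
  ultimately have eq: "(\<Sum>k\<in>Sigma {..<n a} (\<lambda>i. {..<n (l a i)}).
        l (l a (fst k)) (snd k) \<otimes>\<^sub>m r (l a (fst k)) (snd k) \<otimes>\<^sub>m r a (fst k))
      = (\<Sum>k\<in>Sigma {..<n a} (\<lambda>i. {..<n (r a i)}).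
        l a (fst k) \<otimes>\<^sub>m l (r a (fst k)) (snd k) \<otimes>\<^sub>m r (r a (fst k)) (snd k))"
    using coassoc[of a] by (simp add: sum.Sigma case_prod_unfold)
  from triple_tensor_sum_eq[OF eq _ _ L] show ?thesis
    by (simp add: sum.Sigma case_prod_unfold)
qed

text \<open>In Sweedler's notation, both sides equal
  \<open>\<Sum> \<kappa>(a\<^sub>1 a'\<^sub>1) a\<^sub>2 a'\<^sub>2 \<kappa>(a'\<^sub>3) \<kappa>(a\<^sub>3)\<close>.\<close>

lemma antipode_mult_hopf:
  assumes a: "a \<in> Q\<^sub>0" and a': "a' \<in> Q\<^sub>0" shows "\<kappa> (a * a') = \<kappa> a' * \<kappa> a"
proof -
  note \<kappa>lin = bounded_clinear_clinear[OF \<kappa>]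
  obtain n :: "'q \<Rightarrow> nat" and l r where
    leg: "\<And>a i. a \<in> Q\<^sub>0 \<Longrightarrow> i < n a \<Longrightarrow> l a i \<in> Q\<^sub>0" "\<And>a i. a \<in> Q\<^sub>0 \<Longrightarrow> i < n a \<Longrightarrow> r a i \<in> Q\<^sub>0"
    and comult: "\<And>a. a \<in> Q\<^sub>0 \<Longrightarrow> \<Delta> a = (\<Sum>i<n a. l a i \<otimes>\<^sub>m r a i)"
    by (rule comult_sum) blast
  note mem = leg[OF a] leg[OF a']
  have ids: "(\<Sum>i<n a. \<epsilon> (l a i) *\<^sub>C r a i) = a" "(\<Sum>i<n a. \<epsilon> (r a i) *\<^sub>C l a i) = a"
    "(\<Sum>i<n a. l a i * \<kappa> (r a i)) = \<epsilon> a *\<^sub>C 1" if "a \<in> Q\<^sub>0" for a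
    using hopf_identities[OF that _ _ comult[OF that]] leg[OF that] by auto
  have cl: "clinear (\<lambda>x. x * y)" "clinear (\<lambda>x. y * x)" "clinear (\<lambda>x. \<kappa> (x * y))" "clinear (\<lambda>x. \<kappa> (y * x))"
    "clinear (\<lambda>x. \<kappa> x * y)" for y :: 'q
    by (auto intro!: clinearI simp: distrib_left distrib_right mult_scaleC_left mult_scaleC_right
        clinear_add[OF \<kappa>lin] clinear_scaleC[OF \<kappa>lin])
  let ?N = "{..<n a}" and ?M = "{..<n a'}"
  \<comment> \<open>The antipode identity for the product of the left legs, whose coproduct is
    indexed by pairs; it replaces the counits by \<kappa>.\<close>
  have 1: "(\<Sum>j<n (l a i). \<Sum>k<n (l a' m). \<kappa> (l (l a i) j * l (l a' m) k) * (r (l a i) j * r (l a' m) k))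
      = (\<epsilon> (l a i) * \<epsilon> (l a' m)) *\<^sub>C 1" (is "?s = _") if i: "i \<in> ?N" and m: "m \<in> ?M" for i m
  proof -
    have mem': "l a i \<in> Q\<^sub>0" "l a' m \<in> Q\<^sub>0" using mem i m by auto
    let ?K = "{..<n (l a i)} \<times> {..<n (l a' m)}"
    have "?s = (\<Sum>k\<in>?K. \<kappa> (l (l a i) (fst k) * l (l a' m) (snd k)) * (r (l a i) (fst k) * r (l a' m) (snd k)))"
      by (simp add: sum.cartesian_product case_prod_unfold)
    also have "\<dots> = \<epsilon> (l a i * l a' m) *\<^sub>C 1"
    proof (rule hopf_identities(3))
      show "\<Delta> (l a i * l a' m) = (\<Sum>k\<in>?K. (l (l a i) (fst k) * l (l a' m) (snd k)) \<otimes>\<^sub>m (r (l a i) (fst k) * r (l a' m) (snd k)))"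
        by (simp add: unital_star_homD(3)[OF \<Delta>] comult[OF mem'(1)] comult[OF mem'(2)] sum_product tens_mult
            sum.cartesian_product case_prod_unfold)
    qed (use mem' leg[OF mem'(1)] leg[OF mem'(2)] star_subalgebra(2) in auto)
    finally show ?thesis by (simp add: counit_mult mem')
  qed
  have "\<kappa> a' * \<kappa> a = \<kappa> (\<Sum>m\<in>?M. \<epsilon> (l a' m) *\<^sub>C r a' m) * \<kappa> (\<Sum>i\<in>?N. \<epsilon> (l a i) *\<^sub>C r a i)"
    by (simp add: ids a a')
  also have "\<dots> = (\<Sum>m\<in>?M. \<Sum>i\<in>?N. ((\<epsilon> (l a i) * \<epsilon> (l a' m)) *\<^sub>C 1) * (\<kappa> (r a' m) * \<kappa> (r a i)))"
    by (simp add: clinear_sum[OF \<kappa>lin] clinear_scaleC[OF \<kappa>lin] sum_product mult_scaleC_left mult_scaleC_right scaleC_scaleC)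
  also have "\<dots> = (\<Sum>m\<in>?M. \<Sum>i\<in>?N. (\<Sum>j<n (l a i). \<Sum>k<n (l a' m).
      \<kappa> (l (l a i) j * l (l a' m) k) * (r (l a i) j * r (l a' m) k)) * (\<kappa> (r a' m) * \<kappa> (r a i)))"
    by (rule sum.cong[OF refl], rule sum.cong[OF refl]) (simp add: 1)
  also have "\<dots> = (\<Sum>m\<in>?M. \<Sum>i\<in>?N. \<Sum>k<n (l a' m). \<Sum>j<n (l a i).
      \<kappa> (l (l a i) j * l (l a' m) k) * ((r (l a i) j * (r (l a' m) k * \<kappa> (r a' m))) * \<kappa> (r a i)))"
    unfolding sum_distrib_right mult.assoc
    by (rule sum.cong[OF refl], rule sum.cong[OF refl], rule sum.swap)
  also have "\<dots> = (\<Sum>m\<in>?M. \<Sum>k<n (l a' m). \<Sum>i\<in>?N. \<Sum>j<n (l a i).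
      \<kappa> (l (l a i) j * l (l a' m) k) * ((r (l a i) j * (r (l a' m) k * \<kappa> (r a' m))) * \<kappa> (r a i)))"
    by (rule sum.cong[OF refl], rule sum.swap)
  \<comment> \<open>Coassociativity for \<open>a\<close>, with the legs of \<open>a'\<close> held
    fixed.\<close>
  also have "\<dots> = (\<Sum>m\<in>?M. \<Sum>k<n (l a' m). \<Sum>i\<in>?N. \<Sum>j<n (r a i).
      \<kappa> (l a i * l (l a' m) k) * ((l (r a i) j * (r (l a' m) k * \<kappa> (r a' m))) * \<kappa> (r (r a i) j)))"
    by (rule sum.cong[OF refl], rule sum.cong[OF refl], rule comult_coassoc[OF _ _ _ a cl(3) cl(1) \<kappa>lin])
      (rule leg comult; assumption)+
  also have "\<dots> = (\<Sum>i\<in>?N. \<Sum>j<n (r a i). \<Sum>m\<in>?M. \<Sum>k<n (l a' m). \<kappa> (l a i * l (l a' m) k) *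
      ((l (r a i) j * r (l a' m) k) * (\<kappa> (r a' m) * \<kappa> (r (r a i) j))))"
    unfolding mult.assoc by (rule sum_swap_pairs)
  \<comment> \<open>Coassociativity for \<open>a'\<close>. The factors now stand so that the inner
    pair of \<open>a'\<close> contracts first, and the pair of \<open>a\<close> around it
    next.\<close>
  also have "\<dots> = (\<Sum>i\<in>?N. \<Sum>j<n (r a i). \<Sum>m\<in>?M. \<Sum>k<n (r a' m). \<kappa> (l a i * l a' m) *
      ((l (r a i) j * l (r a' m) k) * (\<kappa> (r (r a' m) k) * \<kappa> (r (r a i) j))))"
    by (rule sum.cong[OF refl], rule sum.cong[OF refl], rule comult_coassoc[OF _ _ _ a' cl(4) cl(2) cl(5)])
      (rule leg comult; assumption)+
  also have "\<dots> = (\<Sum>i\<in>?N. \<Sum>j<n (r a i). \<Sum>m\<in>?M. \<kappa> (l a i * l a' m) *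
      (l (r a i) j * ((\<Sum>k<n (r a' m). l (r a' m) k * \<kappa> (r (r a' m) k)) * \<kappa> (r (r a i) j))))"
    by (simp add: sum_distrib_left sum_distrib_right mult.assoc)
  also have "\<dots> = (\<Sum>i\<in>?N. \<Sum>j<n (r a i). \<Sum>m\<in>?M. \<epsilon> (r a' m) *\<^sub>C (\<kappa> (l a i * l a' m) * (l (r a i) j * \<kappa> (r (r a i) j))))"
    by (rule sum.cong[OF refl], rule sum.cong[OF refl], rule sum.cong[OF refl])
      (simp add: ids mem mult_scaleC_left mult_scaleC_right)
  also have "\<dots> = (\<Sum>i\<in>?N. \<Sum>m\<in>?M. \<Sum>j<n (r a i). \<epsilon> (r a' m) *\<^sub>C (\<kappa> (l a i * l a' m) * (l (r a i) j * \<kappa> (r (r a i) j))))"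
    by (rule sum.cong[OF refl], rule sum.swap)
  also have "\<dots> = (\<Sum>i\<in>?N. \<Sum>m\<in>?M. \<epsilon> (r a' m) *\<^sub>C (\<kappa> (l a i * l a' m) * (\<Sum>j<n (r a i). l (r a i) j * \<kappa> (r (r a i) j))))"
    by (simp add: sum_distrib_left cvec.scale_sum_right)
  also have "\<dots> = (\<Sum>i\<in>?N. \<Sum>m\<in>?M. (\<epsilon> (r a i) * \<epsilon> (r a' m)) *\<^sub>C \<kappa> (l a i * l a' m))"
    by (rule sum.cong[OF refl], rule sum.cong[OF refl])
      (simp add: ids mem mult_scaleC_right scaleC_scaleC mult.commute)
  also have "\<dots> = \<kappa> ((\<Sum>i\<in>?N. \<epsilon> (r a i) *\<^sub>C l a i) * (\<Sum>m\<in>?M. \<epsilon> (r a' m) *\<^sub>C l a' m))"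
    by (simp add: sum_product clinear_sum[OF \<kappa>lin] clinear_scaleC[OF \<kappa>lin] mult_scaleC_left mult_scaleC_right scaleC_scaleC
        mult.commute[of "\<epsilon> (r a i)" for i])
  also have "\<dots> = \<kappa> (a * a')" by (simp add: ids a a')
  finally show ?thesis by simp
qed

lemma dense_induct:
  assumes "closed {x. P x}" and "\<And>x. x \<in> Q\<^sub>0 \<Longrightarrow> P x" shows "P x"
  using closure_minimal[of Q\<^sub>0 "{x. P x}"] assms star_subalgebra(4) by auto

text \<open>Boundedness of \<kappa> carries the identity from the dense subalgebra to all elements,
  one factor at a time.\<close>

lemma antipode_mult: "\<kappa> (a * a') = \<kappa> a' * \<kappa> a"
proof -
  have c: "continuous_on UNIV (\<lambda>x. \<kappa> (g x))" if "continuous_on UNIV g" for g :: "'q \<Rightarrow> 'q"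
    by (rule bounded_clinear_continuous[OF \<kappa> that])
  have 1: "\<kappa> (x * y) = \<kappa> y * \<kappa> x" if "x \<in> Q\<^sub>0" for x y
  proof (rule dense_induct[where P="\<lambda>y. \<kappa> (x * y) = \<kappa> y * \<kappa> x"])
    show "closed {y. \<kappa> (x * y) = \<kappa> y * \<kappa> x}"
      by (intro closed_Collect_eq continuous_on_mult_right c continuous_on_mult_left continuous_on_id)
  qed (use that antipode_mult_hopf in blast)
  show ?thesis
  proof (rule dense_induct[where P="\<lambda>x. \<kappa> (x * a') = \<kappa> a' * \<kappa> x"])
    show "closed {x. \<kappa> (x * a') = \<kappa> a' * \<kappa> x}"
      by (intro closed_Collect_eq continuous_on_mult_left c continuous_on_mult_right continuous_on_id)
  qed (rule 1)
qed

lemma antipode_one: "\<kappa> 1 = 1"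
  using hopf_identities(3)[of 1 "{0 :: nat}" "\<lambda>_. 1" "\<lambda>_. 1"]
  by (simp add: star_subalgebra counit_one unital_star_homD[OF \<Delta>] tens_one cvec.scale_one)

lemma antipode_power: "\<kappa> (a ^ n) = \<kappa> a ^ n"
  by (induction n) (simp_all add: antipode_one antipode_mult power_commutes)

end

section \<open>States of $C(X)$ and measures\<close>

lemma bcontfun_power_apply [simp]:
  "apply_bcontfun (f ^ n) x = apply_bcontfun f x ^ n" for f :: "'a :: metric_space \<Rightarrow>\<^sub>C 'b :: unital_cstar_algebra"
  by (induction n) simp_all

lemma evaluation_state: "state (\<lambda>f :: 'x :: metric_space \<Rightarrow>\<^sub>C complex. apply_bcontfun f y)"
  unfolding state_def
proof (intro conjI allI)
  show "bounded_clinear (\<lambda>f :: 'x \<Rightarrow>\<^sub>C complex. apply_bcontfun f y)"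
    by (rule bounded_clinearI[where K=1]) (auto intro!: clinearI simp: norm_bounded)
  fix f :: "'x \<Rightarrow>\<^sub>C complex"
  show "apply_bcontfun (star f * f) y \<in> \<real>\<^sub>\<ge>\<^sub>0"
    by (simp add: star_complex_def complex_nonneg_Reals_iff)
qed simp

text \<open>A nonnegative function is \<open>s\<^sup>* s\<close> for its square root \<open>s\<close>.\<close>

lemma state_nonneg_function:
  fixes \<nu> :: "('x :: metric_space \<Rightarrow>\<^sub>C complex) \<Rightarrow> complex"
  assumes \<nu>: "state \<nu>" and h: "\<And>z. apply_bcontfun h z \<in> \<real>\<^sub>\<ge>\<^sub>0"
  shows "Re (\<nu> h) \<ge> 0"
proof -
  define s where "s z = complex_of_real (sqrt (Re (apply_bcontfun h z)))" for z
  have Re: "0 \<le> Re (apply_bcontfun h z)" "apply_bcontfun h z = of_real (Re (apply_bcontfun h z))" for z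
    using h[of z] by (simp_all add: complex_nonneg_Reals_iff complex_eq_iff)
  have "s \<in> bcontfun"
  proof (rule bcontfun_normI)
    show "continuous_on UNIV s" unfolding s_def by (intro continuous_intros) auto
    show "norm (s z) \<le> sqrt (norm h)" for z
      using norm_bounded[of h z] abs_Re_le_cmod[of "apply_bcontfun h z"] Re(1)[of z] by (simp add: s_def)
  qed
  then have "apply_bcontfun (Bcontfun s) = s" by (rule Bcontfun_inverse)
  then have "star (Bcontfun s) * Bcontfun s = h"
    using Re by (intro bcontfun_eqI) (simp add: star_complex_def s_def flip: of_real_mult)
  moreover have "\<nu> (star (Bcontfun s) * Bcontfun s) \<in> \<real>\<^sub>\<ge>\<^sub>0" using \<nu> by (simp add: state_def)
  ultimately show ?thesis by (simp add: complex_nonneg_Reals_iff)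
qed

text \<open>After multiplication by a phase \<open>w\<close> the value \<nu>(w g) is |\<nu>(g)|, and
  u - Re(w g) is a nonnegative function.\<close>

lemma state_dominated:
  fixes \<nu> :: "('x :: metric_space \<Rightarrow>\<^sub>C complex) \<Rightarrow> complex"
  assumes \<nu>: "state \<nu>" and le: "\<And>z. Im (apply_bcontfun u z) = 0 \<and> cmod (apply_bcontfun g z) \<le> Re (apply_bcontfun u z)"
  shows "cmod (\<nu> g) \<le> Re (\<nu> u)"
proof -
  interpret \<nu>: positive_functional scaleC star \<nu> by (rule state_positive_functional[OF \<nu>])
  define w where "w = (if \<nu> g = 0 then 1 else cnj (sgn (\<nu> g)))"
  have w: "cmod w = 1" "Re (w * \<nu> g) = cmod (\<nu> g)"
  proof -
    show "cmod w = 1" by (simp add: w_def norm_sgn)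
    show "Re (w * \<nu> g) = cmod (\<nu> g)"
    proof (cases "\<nu> g = 0")
      case False
      have "cnj (sgn (\<nu> g)) * \<nu> g = of_real (cmod (\<nu> g))"
        using False complex_norm_square[of "\<nu> g"]
        by (simp add: sgn_eq field_simps power2_eq_square)
      then show ?thesis using False by (simp add: w_def)
    qed simp
  qed
  have re: "apply_bcontfun (re_part f) z = of_real (Re (apply_bcontfun f z))" for f :: "'x \<Rightarrow>\<^sub>C complex" and z
    by (simp add: re_part_def star_complex_def complex_eq_iff)
  have "0 \<le> Re (\<nu> (u + (-1) *\<^sub>C re_part (w *\<^sub>C g)))"
  proof (rule state_nonneg_function[OF \<nu>])
    fix z
    have "Re (w * apply_bcontfun g z) \<le> cmod (apply_bcontfun g z)"
      using complex_Re_le_cmod[of "w * apply_bcontfun g z"] w(1) by (simp add: norm_mult)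
    then show "apply_bcontfun (u + (-1) *\<^sub>C re_part (w *\<^sub>C g)) z \<in> \<real>\<^sub>\<ge>\<^sub>0"
      using le[of z] by (simp add: re scaleC_complex_def complex_nonneg_Reals_iff)
  qed
  then have "Re (\<nu> (re_part (w *\<^sub>C g))) \<le> Re (\<nu> u)" unfolding \<nu>.add \<nu>.sc by simp
  moreover have "Re (\<nu> (re_part x)) = Re (\<nu> x)" for x
    by (simp add: re_part_def scaleR_scaleC \<nu>.sc \<nu>.add \<nu>.hermitian')
  ultimately show ?thesis using w(2) by (simp add: \<nu>.sc)
qed

lemma measurable_bcontfun:
  fixes f :: "'x :: metric_space \<Rightarrow>\<^sub>C complex"
  assumes "sets \<mu> = sets borel" shows "apply_bcontfun f \<in> borel_measurable \<mu>"
proof -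
  have "apply_bcontfun f \<in> borel_measurable borel"
    by (rule borel_measurable_continuous_onI) simp
  then show ?thesis by (subst measurable_cong_sets[OF assms refl])
qed

section \<open>Integration against a Borel probability measure\<close>

locale borel_prob_space = prob_space M for M :: "'a :: metric_space measure" +
  assumes s: "sets M = sets borel"
begin

lemma space_eq_UNIV: "space M = UNIV"
  using sets_eq_imp_space_eq[OF s] by simp

lemma integrable_bcontfun: "integrable M (apply_bcontfun f)" for f :: "'a \<Rightarrow>\<^sub>C complex"
  by (rule integrable_const_bound[where B="norm f"]) (simp_all add: norm_bounded measurable_bcontfun[OF s])

lemma measure_functional_state: "state (measure_functional M)"
proof -
  note int = integrable_bcontfun
  have "norm (measure_functional M f) \<le> 1 * norm f" for f
  proof -
    have "norm (measure_functional M f) \<le> (LINT x|M. norm (apply_bcontfun f x))"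
      unfolding measure_functional_def by (rule integral_norm_bound)
    also have "\<dots> \<le> (LINT x|M. norm f)"
      by (intro integral_mono integrable_norm int) (simp_all add: norm_bounded)
    finally show ?thesis by (simp add: prob_space)
  qed
  moreover have "clinear (measure_functional M)"
    by (rule clinearI) (simp_all add: measure_functional_def int scaleC_complex_def)
  ultimately have "bounded_clinear (measure_functional M)" by (rule bounded_clinearI[rotated])
  moreover have "measure_functional M (star f * f) \<in> \<real>\<^sub>\<ge>\<^sub>0" for f
  proof -
    have "measure_functional M (star f * f) = (LINT x|M. complex_of_real ((cmod (apply_bcontfun f x))\<^sup>2))"
      unfolding measure_functional_def
      by (intro Bochner_Integration.integral_cong) (simp_all add: star_complex_def complex_norm_square mult.commute del: of_real_power)
    also have "\<dots> = of_real (LINT x|M. (cmod (apply_bcontfun f x))\<^sup>2)" by (rule integral_complex_of_real)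
    finally show ?thesis by (simp add: complex_nonneg_Reals_iff integral_nonneg)
  qed
  ultimately show ?thesis by (simp add: state_def measure_functional_def prob_space)
qed

lemma integral_Riemann_sum:
  fixes h :: "'a \<Rightarrow> complex"
  assumes h: "integrable M h"
    and A: "finite I" "\<And>i. i \<in> I \<Longrightarrow> A i \<in> sets M" "disjoint_family_on A I" "(\<Union>i\<in>I. A i) = UNIV"
    and le: "\<And>i y. i \<in> I \<Longrightarrow> y \<in> A i \<Longrightarrow> cmod (h y - h (c i)) \<le> e"
  shows "cmod ((LINT y|M. h y) - (\<Sum>i\<in>I. measure M (A i) *\<^sub>R h (c i))) \<le> e"
proof -
  let ?S = "\<lambda>y. \<Sum>i\<in>I. indicator (A i) y *\<^sub>R h (c i)"
  have ind: "integrable M (indicat_real (A i))" "integral\<^sup>L M (indicat_real (A i)) = measure M (A i)" if "i \<in> I" for i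
    using A(2)[OF that] by (simp_all add: integrable_indicator_iff emeasure_eq_measure)
  then have int: "integrable M (\<lambda>y. indicator (A i) y *\<^sub>R h (c i))" if "i \<in> I" for i
    using that by (intro integrable_scaleR_left) simp
  have "(LINT y|M. ?S y) = (\<Sum>i\<in>I. LINT y|M. indicator (A i) y *\<^sub>R h (c i))"
    by (rule Bochner_Integration.integral_sum) (rule int)
  also have "\<dots> = (\<Sum>i\<in>I. measure M (A i) *\<^sub>R h (c i))"
    by (intro sum.cong refl) (simp add: ind space_eq_UNIV)
  finally have S: "(LINT y|M. ?S y) = (\<Sum>i\<in>I. measure M (A i) *\<^sub>R h (c i))" .
  have "cmod (h y - ?S y) \<le> e" for y
  proof -
    obtain i where i: "i \<in> I" "y \<in> A i" using A(4) by blast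
    have "y \<notin> A j" if "j \<in> I" "j \<noteq> i" for j
      using A(3) i that unfolding disjoint_family_on_def by blast
    then have "?S y = (\<Sum>j\<in>I. if j = i then h (c i) else 0)"
      using i by (intro sum.cong refl) (auto simp: indicator_def)
    then show ?thesis using le[OF i] i(1) A(1) by simp
  qed
  then have "cmod (LINT y|M. h y - ?S y) \<le> (LINT y|M. e)"
    by (intro order_trans[OF integral_norm_bound] integral_mono integrable_norm Bochner_Integration.integrable_diff
        h Bochner_Integration.integrable_sum int) simp_all
  then show ?thesis
    by (simp add: S prob_space Bochner_Integration.integral_diff[OF h Bochner_Integration.integrable_sum[OF int]])
qed

lemma integrable_continuous:
  fixes h :: "'a \<Rightarrow> complex"
  assumes X: "compact (UNIV :: 'a set)" and h: "continuous_on UNIV h"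
  shows "integrable M h"
proof -
  obtain b where "\<And>y. cmod (h y) \<le> b"
    using compact_imp_bounded[OF compact_continuous_image[OF h X]] by (auto simp: bounded_iff)
  moreover have "h \<in> borel_measurable M"
    using borel_measurable_continuous_onI[OF h] by (subst measurable_cong_sets[OF s refl])
  ultimately show ?thesis by (intro integrable_const_bound[where B=b]) auto
qed

text \<open>Both integrals are approximated by Riemann sums over the same partition.\<close>

lemma bounded_clinear_integral:
  fixes k :: "'a \<Rightarrow> 'a \<Rightarrow>\<^sub>C complex"
  assumes X: "compact (UNIV :: 'a set)"
    and k: "continuous_on UNIV k" and L: "bounded_clinear L"
    and G: "\<And>z. apply_bcontfun G z = (LINT y|M. apply_bcontfun (k y) z)"
  shows "L G = (LINT y|M. L (k y) :: complex)"
proof -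
  obtain K where K: "\<And>f. cmod (L f) \<le> K * norm f" using L unfolding bounded_clinear_def by blast
  define B where "B = \<bar>K\<bar> + 1"
  have B: "B > 0" "cmod (L f) \<le> B * norm f" for f
  proof -
    show "B > 0" by (simp add: B_def)
    have "K * norm f \<le> B * norm f" by (intro mult_right_mono) (simp_all add: B_def)
    then show "cmod (L f) \<le> B * norm f" using K[of f] by simp
  qed
  note lin = bounded_clinear_clinear[OF L]
  have "cmod (L G - (LINT y|M. L (k y))) \<le> e" if e: "e > 0" for e
  proof -
    \<comment> \<open>Passing to Riemann sums costs at most B d twice: once for \<open>G\<close>
      inside \<open>L\<close>, once for the scalar integral.\<close>
    define d where "d = e / (2 * B)"
    have d: "d > 0" "2 * B * d = e" using e B(1) by (simp_all add: d_def)
    have "\<exists>r>0. \<forall>x\<in>UNIV. \<forall>x'\<in>UNIV. dist x' x < r \<longrightarrow> dist (k x') (k x) < d"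
      using compact_uniformly_continuous[OF k X] d(1) by (simp add: uniformly_continuous_on_def)
    then obtain r where r: "r > 0" "\<And>y y'. dist y y' < r \<Longrightarrow> dist (k y) (k y') < d" by auto
    have "\<exists>Y. finite Y \<and> (UNIV :: 'a set) \<subseteq> (\<Union>y\<in>Y. ball y r)"
      using X r(1) unfolding compact_eq_totally_bounded by blast
    then obtain Y where Y: "finite Y" "(UNIV :: 'a set) \<subseteq> (\<Union>y\<in>Y. ball y r)" by blast
    obtain c where c: "bij_betw c {0..<card Y} Y" using ex_bij_betw_nat_finite[OF Y(1)] by blast
    define A where "A i = disjointed (\<lambda>i. ball (c i) r) i" for i
    let ?I = "{0..<card Y}"
    have A: "A i \<in> sets M" for i
      unfolding A_def disjointed_def s by (intro sets.Diff sets.finite_UN borel_open open_ball) auto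
    have dis: "disjoint_family_on A ?I"
      using disjoint_family_disjointed[of "\<lambda>i. ball (c i) r"] unfolding A_def disjoint_family_on_def by auto
    have Ab: "A i \<subseteq> ball (c i) r" for i unfolding A_def by (rule disjointed_subset)
    have "(\<Union>i\<in>?I. A i) = (\<Union>y\<in>c ` ?I. ball y r)"
      unfolding A_def finite_UN_disjointed_eq by simp
    also have "\<dots> = (\<Union>y\<in>Y. ball y r)" by (simp only: bij_betw_imp_surj_on[OF c])
    also have "\<dots> = UNIV" using Y(2) by (rule equalityI[OF subset_UNIV])
    finally have cov: "(\<Union>i\<in>?I. A i) = UNIV" .
    have near: "norm (k y - k (c i)) \<le> d" if "y \<in> A i" for i y
      using r(2)[of y "c i"] that Ab[of i] by (auto simp: dist_norm dist_commute)
    define S where "S = (\<Sum>i\<in>?I. measure M (A i) *\<^sub>R k (c i))"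
    have app: "apply_bcontfun (\<Sum>i\<in>J. f i) z = (\<Sum>i\<in>J. apply_bcontfun (f i) z)" for J :: "nat set" and f :: "nat \<Rightarrow> 'a \<Rightarrow>\<^sub>C complex" and z
      by (induction J rule: infinite_finite_induct) simp_all
    have "norm (G - S) \<le> d"
    proof (rule norm_bound)
      fix z
      have "cmod ((LINT y|M. apply_bcontfun (k y) z) - (\<Sum>i\<in>?I. measure M (A i) *\<^sub>R apply_bcontfun (k (c i)) z)) \<le> d"
      proof (rule integral_Riemann_sum[OF _ _ A dis cov])
        show "integrable M (\<lambda>y. apply_bcontfun (k y) z)"
          by (intro integrable_continuous[OF X] bounded_clinear_continuous[OF state_bounded_clinear[OF evaluation_state] k])
        show "cmod (apply_bcontfun (k y) z - apply_bcontfun (k (c i)) z) \<le> d" if "y \<in> A i" for i y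
          using norm_bounded[of "k y - k (c i)" z] near[OF that] by simp
      qed simp
      then show "cmod (apply_bcontfun (G - S) z) \<le> d" by (simp add: G S_def app)
    qed
    then have "B * norm (G - S) \<le> B * d" using B(1) by (intro mult_left_mono) simp_all
    then have 1: "cmod (L G - L S) \<le> B * d"
      using B(2)[of "G - S"] by (simp add: clinear_diff[OF lin])
    have "cmod ((LINT y|M. L (k y)) - (\<Sum>i\<in>?I. measure M (A i) *\<^sub>R L (k (c i)))) \<le> B * d"
    proof (rule integral_Riemann_sum[OF _ _ A dis cov])
      show "integrable M (\<lambda>y. L (k y))" by (intro integrable_continuous[OF X] bounded_clinear_continuous[OF L k])
      show "cmod (L (k y) - L (k (c i))) \<le> B * d" if "y \<in> A i" for i y
      proof -
        have "cmod (L (k y - k (c i))) \<le> B * norm (k y - k (c i))" by (rule B(2))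
        also have "\<dots> \<le> B * d" using near[OF that] B(1) by (intro mult_left_mono) simp_all
        finally show ?thesis by (simp add: clinear_diff[OF lin])
      qed
    qed simp
    moreover have "(\<Sum>i\<in>?I. measure M (A i) *\<^sub>R L (k (c i))) = L S"
      by (simp add: S_def clinear_sum[OF lin] scaleR_scaleC clinear_scaleC[OF lin])
    ultimately have 2: "cmod ((LINT y|M. L (k y)) - L S) \<le> B * d" by simp
    have "cmod (L G - (LINT y|M. L (k y))) \<le> cmod (L G - L S) + cmod ((LINT y|M. L (k y)) - L S)"
      using norm_triangle_ineq4[of "L G - L S" "(LINT y|M. L (k y)) - L S"] by simp
    then show ?thesis using 1 2 d(2) by simp
  qed
  then have "cmod (L G - (LINT y|M. L (k y))) \<le> 0" by (rule field_le_epsilon) simp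
  then show ?thesis by simp
qed

end

section \<open>Uniformly distributed measures\<close>

text \<open>If \<open>D\<close> is positive and at least the diameter, the values lie in [0, 1], and
  the value at \<open>x\<close> itself is 1.\<close>

definition dist_kernel :: "real \<Rightarrow> nat \<Rightarrow> 'x :: metric_space \<Rightarrow> 'x \<Rightarrow>\<^sub>C complex" where
  "dist_kernel D n x = (1 - complex_of_real (1 / D) *\<^sub>C dist_function x) ^ n"

context
  assumes X: "compact (UNIV :: 'x :: metric_space set)"
begin

lemma dist_function_apply: "apply_bcontfun (dist_function x) y = complex_of_real (dist x y)" for x :: 'x
proof -
  have "bounded (UNIV :: 'x set)" using X by (rule compact_imp_bounded)
  then obtain e where e: "\<And>y. dist x y \<le> e" unfolding bounded_any_center[where a=x] by auto
  have "(\<lambda>y. complex_of_real (dist x y)) \<in> bcontfun"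
    by (rule bcontfun_normI[where b=e]) (auto intro!: continuous_intros simp: e)
  then show ?thesis by (simp add: dist_function_def Bcontfun_inverse)
qed

lemma dist_kernel_apply:
  "apply_bcontfun (dist_kernel D n x) y = complex_of_real ((1 - dist x y / D) ^ n)" for x :: 'x
  by (simp add: dist_kernel_def dist_function_apply scaleC_complex_def)

lemma continuous_dist_kernel: "continuous_on UNIV (dist_kernel D n :: 'x \<Rightarrow> _)"
proof -
  have "continuous_on UNIV (dist_function :: 'x \<Rightarrow> _)"
    unfolding continuous_on_iff
  proof (intro ballI allI impI)
    fix x :: 'x and e :: real assume "e > 0"
    moreover have "dist (dist_function x') (dist_function x) \<le> dist x' x" for x' :: 'x
      unfolding dist_norm
    proof (rule norm_bound)
      fix y
      have "apply_bcontfun (dist_function x' - dist_function x) y = complex_of_real (dist x' y - dist x y)"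
        by (simp add: dist_function_apply)
      then show "norm (apply_bcontfun (dist_function x' - dist_function x) y) \<le> dist x' x"
        using abs_dist_diff_le[of x' y x] by (simp only: norm_of_real) (simp add: dist_commute)
    qed
    ultimately show "\<exists>d>0. \<forall>x'\<in>UNIV. dist x' x < d \<longrightarrow> dist (dist_function x') (dist_function x) < e"
      by (intro exI[of _ e]) (auto intro: le_less_trans)
  qed
  then have c: "continuous_on UNIV (\<lambda>x :: 'x. 1 - complex_of_real (1 / D) *\<^sub>C dist_function x)"
    by (intro continuous_intros bounded_linear.continuous_on[OF bounded_linear_scaleC])
  show ?thesis
    unfolding dist_kernel_def
  proof (induction n)
    case (Suc n)
    show ?case using continuous_on_mult[OF c Suc] by (simp only: power_Suc)
  qed simp
qed

end

context borel_prob_space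
begin

text \<open>Uniform distribution says that the distances from \<open>x\<close> and from
  \<open>x'\<close> have the same distribution function, hence the same law.\<close>

lemma integral_dist_eq:
  assumes u: "uniformly_distributed M" and g: "g \<in> borel_measurable borel"
  shows "(LINT y|M. g (dist x y)) = (LINT y|M. g (dist x' y) :: complex)"
proof -
  have m: "(\<lambda>y. dist x y) \<in> borel_measurable M" for x
  proof -
    have "(\<lambda>y. dist x y) \<in> borel_measurable borel"
      by (intro borel_measurable_continuous_onI continuous_intros)
    then show ?thesis by (subst measurable_cong_sets[OF s refl])
  qed
  have "cdf (distr M borel (dist x)) r = cdf (distr M borel (dist x')) r" for r
  proof -
    have "cdf (distr M borel (dist z)) r = (if r \<ge> 0 then measure M (cball z r) else 0)" for z
    proof -
      have "cdf (distr M borel (dist z)) r = measure M (dist z -` {..r} \<inter> space M)"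
        unfolding cdf_def by (rule measure_distr[OF m]) simp
      also have "dist z -` {..r} \<inter> space M = cball z r" by (auto simp: space_eq_UNIV)
      finally show ?thesis by simp
    qed
    moreover have "measure M (cball x r) = measure M (cball x' r)" if "r \<ge> 0"
      using u that unfolding uniformly_distributed_def measure_def by metis
    ultimately show ?thesis by simp
  qed
  then have eq: "distr M borel (dist x) = distr M borel (dist x')"
    by (intro cdf_unique real_distribution_distr m ext)
  have "(LINT y|M. g (dist z y)) = (LINT t|distr M borel (dist z). g t)" for z
    by (rule integral_distr[OF m g, symmetric])
  then show ?thesis using eq by metis
qed

text \<open>Otherwise every ball of radius \<open>r\<close> would be null, although finitely many of
  them cover the space.\<close>

lemma measure_cball_pos:
  assumes X: "compact (UNIV :: 'a set)" and u: "uniformly_distributed M" and r: "r > 0"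
  shows "measure M (cball x r) > 0"
proof (rule ccontr)
  assume "\<not> 0 < measure M (cball x r)"
  then have "emeasure M (cball x r) = 0" by (simp add: emeasure_eq_measure not_less measure_le_0_iff)
  then have 0: "emeasure M (cball y r) = 0" for y
    using u r unfolding uniformly_distributed_def by (metis less_imp_le)
  have "\<exists>Y. finite Y \<and> (UNIV :: 'a set) \<subseteq> (\<Union>y\<in>Y. ball y r)"
    using X r unfolding compact_eq_totally_bounded by blast
  then obtain Y where Y: "finite Y" "(UNIV :: 'a set) \<subseteq> (\<Union>y\<in>Y. ball y r)" by blast
  have "(\<Union>y\<in>Y. cball y r) = space M"
    using Y(2) ball_subset_cball unfolding space_eq_UNIV by blast
  then have "1 = emeasure M (\<Union>y\<in>Y. cball y r)" by (simp add: emeasure_space_1)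
  also have "\<dots> \<le> (\<Sum>y\<in>Y. emeasure M (cball y r))"
    by (rule emeasure_subadditive_finite[OF Y(1)]) (auto simp: s)
  finally show False by (simp add: 0)
qed

text \<open>Christensen's argument. The kernels concentrate on the diagonal, so that
  \<open>c\<^sub>n \<nu>(f) = \<integral> \<nu>(f K\<^sub>n(y)) d\<mu>(y)\<close> is close to \<open>\<integral> f(y) \<nu>(K\<^sub>n(y)) d\<mu>(y) = c\<^sub>n \<mu>(f)\<close>.\<close>

lemma state_eq_measure_functional:
  assumes X: "compact (UNIV :: 'a set)" and u: "uniformly_distributed M"
    and D: "D > 0" "\<And>x y :: 'a. dist x y \<le> D" and \<nu>: "state \<nu>"
    and eq: "\<And>n x. \<nu> (dist_kernel D n x) = measure_functional M (dist_kernel D n x)"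
  shows "\<nu> f = measure_functional M f"
proof -
  let ?K = "dist_kernel D" and ?m = "measure_functional M"
  note app = dist_kernel_apply[OF X]
  interpret \<nu>: positive_functional scaleC star \<nu> by (rule state_positive_functional[OF \<nu>])
  obtain x0 :: 'a where True by blast
  define c where "c n = (LINT y|M. (1 - dist x0 y / D) ^ n)" for n
  have mK: "?m (?K n x) = of_real (c n)" for n x
  proof -
    have "?m (?K n x) = (LINT y|M. complex_of_real ((1 - dist x y / D) ^ n))"
      by (simp add: measure_functional_def app)
    also have "\<dots> = (LINT y|M. complex_of_real ((1 - dist x0 y / D) ^ n))"
      by (rule integral_dist_eq[OF u]) simp
    also have "\<dots> = of_real (c n)" unfolding c_def by (rule integral_complex_of_real)
    finally show ?thesis .
  qed
  have frac: "0 \<le> 1 - dist x y / D" for x y :: 'a using D by simp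
  have "cmod (\<nu> f - ?m f) \<le> e" if e: "e > 0" for e
  proof -
    have "uniformly_continuous_on UNIV (apply_bcontfun f)"
      by (rule compact_uniformly_continuous[OF _ X]) simp
    then have "\<exists>r>0. \<forall>x\<in>UNIV. \<forall>x'\<in>UNIV. dist x' x < r \<longrightarrow> dist (apply_bcontfun f x') (apply_bcontfun f x) < e / 2"
      unfolding uniformly_continuous_on_def using e half_gt_zero by blast
    then obtain r0 where r0: "r0 > 0" "\<And>x x'. dist x' x < r0 \<Longrightarrow> dist (apply_bcontfun f x') (apply_bcontfun f x) < e / 2"
      by auto
    define r where "r = min r0 D"
    have r: "r > 0" "r \<le> D" "r \<le> r0" using r0(1) D(1) by (simp_all add: r_def)
    \<comment> \<open>Outside the ball of radius \<open>r\<close> the kernel is at most a^n, and on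
      the ball of radius r/2 it is at least b^n. Halving the radius gives a < b, so that (a/b)^n
      tends to 0; \<open>r \<le> D\<close> gives a \<ge> 0.\<close>
    define a where "a = 1 - r / D"
    define b where "b = 1 - r / (2 * D)"
    have ab: "0 \<le> a" "a < b" "b > 0" using r D(1) by (simp_all add: a_def b_def field_simps)
    define \<beta> where "\<beta> = measure M (cball x0 (r / 2))"
    have \<beta>: "\<beta> > 0" using measure_cball_pos[OF X u, of "r / 2" x0] r by (simp add: \<beta>_def)
    have cn: "\<beta> * b ^ n \<le> c n" for n
    proof -
      have "\<beta> * b ^ n = (LINT y|M. indicat_real (cball x0 (r / 2)) y * b ^ n)"
        by (simp add: \<beta>_def space_eq_UNIV)
      also have "\<dots> \<le> c n"
        unfolding c_def
      proof (rule integral_mono)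
        show "integrable M (\<lambda>y. indicat_real (cball x0 (r / 2)) y * b ^ n)"
          by (intro integrable_mult_left) (simp add: integrable_indicator_iff s emeasure_eq_measure)
        have "integrable M (\<lambda>y. Re (apply_bcontfun (?K n x0) y))"
          by (intro integrable_Re integrable_bcontfun)
        then show "integrable M (\<lambda>y. (1 - dist x0 y / D) ^ n)" by (simp add: app)
        fix y
        show "indicat_real (cball x0 (r / 2)) y * b ^ n \<le> (1 - dist x0 y / D) ^ n"
        proof (cases "y \<in> cball x0 (r / 2)")
          case True
          then have "b \<le> 1 - dist x0 y / D" using D(1) by (simp add: b_def field_simps)
          then show ?thesis using True ab by (simp add: power_mono)
        qed (use zero_le_power[OF frac] in simp)
      qed
      finally show ?thesis .
    qed
    have cpos: "c n > 0" for n by (rule less_le_trans[OF _ cn]) (use \<beta> ab(3) in simp)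
    have main: "c n * cmod (\<nu> f - ?m f) \<le> e / 2 * c n + 2 * norm f * a ^ n" for n
    proof -
      have cont: "continuous_on UNIV (\<lambda>y. \<nu> (f * ?K n y))"
        by (rule bounded_clinear_continuous[OF state_bounded_clinear[OF \<nu>]
              continuous_on_mult_left[OF continuous_dist_kernel[OF X]]])
      have cont': "continuous_on UNIV (\<lambda>y. apply_bcontfun f y * of_real (c n))"
        by (rule continuous_on_mult_right) simp
      \<comment> \<open>By symmetry of the distance, integrating the kernels over their base points
        gives at z the mass of the kernel based at z, which is \<open>c n\<close> for every
        z.\<close>
      have "\<nu> (of_real (c n) *\<^sub>C f) = (LINT y|M. \<nu> (f * ?K n y))"
      proof (rule bounded_clinear_integral[OF X _ state_bounded_clinear[OF \<nu>]])
        show "continuous_on UNIV (\<lambda>y. f * ?K n y)"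
          by (intro continuous_on_mult_left continuous_dist_kernel[OF X])
        fix z
        have "(LINT y|M. apply_bcontfun (f * ?K n y) z) = apply_bcontfun f z * ?m (?K n z)"
          by (simp add: measure_functional_def app dist_commute)
        then show "apply_bcontfun (of_real (c n) *\<^sub>C f) z = (LINT y|M. apply_bcontfun (f * ?K n y) z)"
          unfolding mK by (simp only: apply_bcontfun_cstar scaleC_complex_def mult.commute)
      qed
      moreover have "of_real (c n) * ?m f = (LINT y|M. apply_bcontfun f y * of_real (c n))"
        by (simp add: measure_functional_def)
      ultimately have "of_real (c n) * (\<nu> f - ?m f) =
          (LINT y|M. \<nu> (f * ?K n y)) - (LINT y|M. apply_bcontfun f y * of_real (c n))"
        by (simp add: \<nu>.sc right_diff_distrib)
      also have "\<dots> = (LINT y|M. \<nu> (f * ?K n y) - apply_bcontfun f y * of_real (c n))"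
        by (rule Bochner_Integration.integral_diff[symmetric]) (rule integrable_continuous[OF X] cont cont')+
      finally have E: "of_real (c n) * (\<nu> f - ?m f) = (LINT y|M. \<nu> (f * ?K n y) - apply_bcontfun f y * of_real (c n))" .
      have "c n * cmod (\<nu> f - ?m f) = cmod (of_real (c n) * (\<nu> f - ?m f))"
        using cpos[of n] by (simp add: norm_mult)
      also have "\<dots> = cmod (LINT y|M. \<nu> (f * ?K n y) - apply_bcontfun f y * of_real (c n))"
        by (simp only: E)
      also have "\<dots> \<le> (LINT y|M. norm (\<nu> (f * ?K n y) - apply_bcontfun f y * of_real (c n)))"
        by (rule integral_norm_bound)
      also have "\<dots> \<le> (LINT y|M. e / 2 * c n + 2 * norm f * a ^ n)"
      proof (rule integral_mono)
        show "integrable M (\<lambda>y. norm (\<nu> (f * ?K n y) - apply_bcontfun f y * of_real (c n)))"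
          by (rule integrable_norm[OF integrable_continuous[OF X continuous_on_diff[OF cont cont']]])
        fix y :: 'a
        \<comment> \<open>\<open>w\<close> dominates |g|: within \<open>r0\<close> of
          \<open>y\<close> the function \<open>f\<close> varies by less than e/2, and farther away
          the kernel is at most a^n while \<open>f\<close> varies by at most 2
          \<open>norm f\<close>.\<close>
        define w where "w = of_real (e / 2) *\<^sub>C ?K n y + of_real (2 * norm f * a ^ n) *\<^sub>C 1"
        define g where "g = f * ?K n y + (- apply_bcontfun f y) *\<^sub>C ?K n y"
        have "cmod (\<nu> g) \<le> Re (\<nu> w)"
        proof (rule state_dominated[OF \<nu>], intro conjI)
          fix z :: 'a
          let ?k = "(1 - dist y z / D) ^ n"
          have k0: "0 \<le> ?k" by (rule zero_le_power[OF frac])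
          have "apply_bcontfun g z = (apply_bcontfun f z - apply_bcontfun f y) * of_real ?k"
            by (simp add: g_def app scaleC_complex_def left_diff_distrib)
          then have g: "cmod (apply_bcontfun g z) = cmod (apply_bcontfun f z - apply_bcontfun f y) * ?k"
            using k0 by (simp only: norm_mult norm_of_real abs_of_nonneg)
          have w: "apply_bcontfun w z = of_real (e / 2 * ?k + 2 * norm f * a ^ n)"
            by (simp add: w_def app scaleC_complex_def)
          show "Im (apply_bcontfun w z) = 0" unfolding w by (rule Im_complex_of_real)
          have "cmod (apply_bcontfun f z - apply_bcontfun f y) * ?k \<le> e / 2 * ?k + 2 * norm f * a ^ n"
          proof (cases "dist z y < r0")
            case True
            then have "cmod (apply_bcontfun f z - apply_bcontfun f y) * ?k \<le> e / 2 * ?k"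
              using r0(2)[of z y] k0 by (intro mult_right_mono) (simp_all add: dist_norm)
            then show ?thesis using ab(1) by (simp add: add_increasing2)
          next
            case False
            then have "1 - dist y z / D \<le> a"
              using r(3) D(1) by (simp add: a_def divide_right_mono dist_commute)
            then have "?k \<le> a ^ n" by (intro power_mono frac)
            moreover have "cmod (apply_bcontfun f z - apply_bcontfun f y) \<le> 2 * norm f"
              using norm_triangle_ineq4[of "apply_bcontfun f z" "apply_bcontfun f y"]
                norm_bounded[of f z] norm_bounded[of f y] by simp
            ultimately have "cmod (apply_bcontfun f z - apply_bcontfun f y) * ?k \<le> 2 * norm f * a ^ n"
              using k0 by (intro mult_mono) simp_all
            then show ?thesis using e k0 by (simp add: add_increasing)
          qed
          then show "cmod (apply_bcontfun g z) \<le> Re (apply_bcontfun w z)"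
            unfolding g w Re_complex_of_real .
        qed
        moreover have "\<nu> g = \<nu> (f * ?K n y) - apply_bcontfun f y * of_real (c n)"
          unfolding g_def \<nu>.add \<nu>.sc by (simp add: eq mK)
        moreover have "Re (\<nu> w) = e / 2 * c n + 2 * norm f * a ^ n"
          unfolding w_def \<nu>.add \<nu>.sc eq mK state_one[OF \<nu>] by simp
        ultimately show "norm (\<nu> (f * ?K n y) - apply_bcontfun f y * of_real (c n)) \<le> e / 2 * c n + 2 * norm f * a ^ n"
          by simp
      qed simp
      finally show ?thesis by (simp add: prob_space)
    qed
    have "cmod (\<nu> f - ?m f) \<le> e / 2 + 2 * norm f / \<beta> * (a / b) ^ n" for n
    proof -
      have "a ^ n \<le> (a / b) ^ n * (c n / \<beta>)"
      proof -
        have "b ^ n \<le> c n / \<beta>" using cn[of n] \<beta> by (simp add: pos_le_divide_eq mult.commute)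
        then have "(a / b) ^ n * b ^ n \<le> (a / b) ^ n * (c n / \<beta>)"
          using ab by (intro mult_left_mono) simp_all
        then show ?thesis using ab(3) by (simp add: power_divide)
      qed
      then have "2 * norm f * a ^ n \<le> 2 * norm f * ((a / b) ^ n * (c n / \<beta>))"
        by (intro mult_left_mono) simp_all
      then have "c n * cmod (\<nu> f - ?m f) \<le> c n * (e / 2 + 2 * norm f / \<beta> * (a / b) ^ n)"
        using main[of n] by (simp add: algebra_simps)
      then show ?thesis using cpos[of n] by simp
    qed
    moreover have "(\<lambda>n. e / 2 + 2 * norm f / \<beta> * (a / b) ^ n) \<longlonglongrightarrow> e / 2 + 2 * norm f / \<beta> * 0"
      using ab by (intro tendsto_intros LIMSEQ_realpow_zero) auto
    ultimately have "cmod (\<nu> f - ?m f) \<le> e / 2 + 2 * norm f / \<beta> * 0"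
      by (intro LIMSEQ_le_const) auto
    then show ?thesis using e by simp
  qed
  then have "cmod (\<nu> f - ?m f) \<le> 0" by (rule field_le_epsilon) simp
  then show ?thesis by simp
qed

end

section \<open>Invariance\<close>

text \<open>Slicing with a character is a homomorphism. For point evaluations this makes f \<mapsto>
  \<alpha>(f)(y) multiplicative.\<close>

lemma slice_character_mult:
  fixes u v :: "'a :: unital_cstar_algebra \<otimes>\<^sub>m 'b :: unital_cstar_algebra"
  assumes \<phi>: "state \<phi>" and mult: "\<And>a b. \<phi> (a * b) = \<phi> a * \<phi> b"
  shows "slice \<phi> (u * v) = slice \<phi> u * slice \<phi> v"
proof -
  note S = slice_facts[OF state_span_state[OF \<phi>], where 'b='b]
  have 1: "(\<lambda>u. slice \<phi> (u * (a \<otimes>\<^sub>m b))) = (\<lambda>u. slice \<phi> u * slice \<phi> (a \<otimes>\<^sub>m b))" for a and b :: 'b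
  proof (rule bounded_clinear_tensor_eqI)
    show "bounded_clinear (\<lambda>u. slice \<phi> (u * (a \<otimes>\<^sub>m b)))"
      by (rule bounded_clinear_intros(6)[OF S(1)], rule bounded_clinear_intros(3), rule bounded_clinear_intros(1))
    show "bounded_clinear (\<lambda>u. slice \<phi> u * slice \<phi> (a \<otimes>\<^sub>m b))"
      by (rule bounded_clinear_intros(3), rule S(1))
  qed (simp add: S(2) tens_mult mult mult_scaleC_left mult_scaleC_right scaleC_scaleC mult.commute)
  have "(\<lambda>v. slice \<phi> (u * v)) = (\<lambda>v. slice \<phi> u * slice \<phi> v)"
  proof (rule bounded_clinear_tensor_eqI)
    show "bounded_clinear (\<lambda>v. slice \<phi> (u * v))"
      by (rule bounded_clinear_intros(6)[OF S(1)], rule bounded_clinear_intros(2), rule bounded_clinear_intros(1))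
    show "bounded_clinear (\<lambda>v. slice \<phi> u * slice \<phi> v)"
      by (rule bounded_clinear_intros(2), rule S(1))
    show "slice \<phi> (u * (a \<otimes>\<^sub>m b)) = slice \<phi> u * slice \<phi> (a \<otimes>\<^sub>m b)" for a b
      using 1 by metis
  qed
  then show ?thesis by metis
qed

text \<open>A Fubini rule. The first equation turns \<mu> \<otimes> \<phi> into the integral of a
  sliced function; the second, for point evaluations, computes the values of that function.\<close>

lemma tensor_functional_right_slice:
  assumes \<phi>: "state \<phi>" and \<psi>: "state \<psi>"
  shows "tensor_functional \<phi> \<psi> t = \<phi> (right_slice \<psi> t)" and "\<phi> (right_slice \<psi> t) = \<psi> (slice \<phi> t)"
proof -
  note T = tensor_functional_state_facts[OF \<phi> \<psi>] and R = right_slice_facts[OF \<psi>]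
    and S = slice_facts[OF state_span_state[OF \<phi>]]
  note sc = clinear_scaleC[OF state_clinear[OF \<phi>]] clinear_scaleC[OF state_clinear[OF \<psi>]]
  have "tensor_functional \<phi> \<psi> = (\<lambda>t. \<phi> (right_slice \<psi> t))"
    by (rule bounded_clinear_tensor_eqI[OF T(1) bounded_clinear_intros(6)[OF state_bounded_clinear[OF \<phi>] R(1)]])
      (simp add: T(3) R(2) sc scaleC_complex_def)
  then show "tensor_functional \<phi> \<psi> t = \<phi> (right_slice \<psi> t)" by metis
  have "(\<lambda>t. \<phi> (right_slice \<psi> t)) = (\<lambda>t. \<psi> (slice \<phi> t))"
    by (rule bounded_clinear_tensor_eqI[OF bounded_clinear_intros(6)[OF state_bounded_clinear[OF \<phi>] R(1)]
          bounded_clinear_intros(6)[OF state_bounded_clinear[OF \<psi>] S(1)]])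
      (simp add: R(2) S(2) sc scaleC_complex_def mult.commute)
  then show "\<phi> (right_slice \<psi> t) = \<psi> (slice \<phi> t)" by metis
qed

theorem theorem0p3:
  fixes \<mu> :: "'x :: metric_space measure"
    and \<Delta> :: "'q :: unital_cstar_algebra \<Rightarrow> 'q \<otimes>\<^sub>m 'q"
    and \<kappa> :: "'q \<Rightarrow> 'q"
    and \<alpha> :: "('x \<Rightarrow>\<^sub>C complex) \<Rightarrow> ('x \<Rightarrow>\<^sub>C complex) \<otimes>\<^sub>m 'q"
    and \<phi> :: "'q \<Rightarrow> complex"
  assumes "compact (UNIV :: 'x set)"
    and "prob_space \<mu>" and "uniformly_distributed \<mu>"
    and "compact_quantum_group \<Delta>" and "bounded_antipode \<Delta> \<kappa>"
    and "isometric_action \<Delta> \<kappa> \<alpha>"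
    and "state \<phi>"
  shows "convolve \<alpha> (measure_functional \<mu>) \<phi> = measure_functional \<mu>"
proof -
  note X = assms(1) and u = assms(3) and \<phi> = assms(7)
  interpret prob_space \<mu> by (rule assms(2))
  interpret borel_prob_space \<mu>
    by unfold_locales (use u in \<open>simp add: uniformly_distributed_def\<close>)
  obtain Q\<^sub>0 \<epsilon> where \<kappa>: "bounded_clinear \<kappa>" and hopf: "dense_hopf_star_subalgebra \<Delta> Q\<^sub>0 \<epsilon> \<kappa>"
    using assms(5) unfolding bounded_antipode_def by blast
  have \<Delta>: "unital_star_hom \<Delta>"
    using assms(4) unfolding compact_quantum_group_def by (rule conjunct1)
  have coassoc: "\<forall>a. tensor_assoc (tensor_map \<Delta> id (\<Delta> a)) = tensor_map id \<Delta> (\<Delta> a)"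
    using assms(4) unfolding compact_quantum_group_def by (elim conjE)
  interpret hopf_star_algebra \<Delta> \<kappa> Q\<^sub>0 \<epsilon>
    by (rule hopf_star_algebra.intro[OF \<Delta> spec[OF coassoc] \<kappa> hopf])
  have \<alpha>: "unital_star_hom \<alpha>"
    using assms(6) unfolding isometric_action_def cqg_action_def by (elim conjE)
  have iso: "point_value (\<alpha> (dist_function x)) y = \<kappa> (point_value (\<alpha> (dist_function y)) x)" for x y
    using assms(6) unfolding isometric_action_def by (elim conjE) (erule allE, erule spec)
  note \<alpha>h = unital_star_homD[OF \<alpha>] and \<kappa>lin = bounded_clinear_clinear[OF \<kappa>]
  define ev :: "'x \<Rightarrow> ('x \<Rightarrow>\<^sub>C complex) \<otimes>\<^sub>m 'q \<Rightarrow> 'q" where "ev y = slice (\<lambda>f. apply_bcontfun f y)" for y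
  have ev: "bounded_clinear (ev y)" "ev y (f \<otimes>\<^sub>m q) = apply_bcontfun f y *\<^sub>C q" for y f q
    unfolding ev_def using slice_facts[OF state_span_state[OF evaluation_state]] by auto
  note evlin = bounded_clinear_clinear[OF ev(1)]
  have ev1: "ev y 1 = 1" for y
    using ev(2)[of y 1 1] by (simp add: tens_one cvec.scale_one)
  have evm: "ev y (t * t') = ev y t * ev y t'" for y t t'
    unfolding ev_def by (rule slice_character_mult[OF evaluation_state]) simp
  obtain D where D: "D > 0" "\<And>x y :: 'x. dist x y \<le> D"
  proof -
    obtain e where "\<And>x y :: 'x. dist x y \<le> e"
      using compact_imp_bounded[OF X] by (auto simp: bounded_two_points)
    \<comment> \<open>The maximum with 1 keeps \<open>D\<close> positive even on a one-point
      space.\<close>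
    then show ?thesis using that[of "max e 1"] by (meson less_max_iff_disj max.coboundedI1 zero_less_one)
  qed
  let ?K = "dist_kernel D"
  have kernel: "ev y (\<alpha> (?K n x)) = \<kappa> (ev x (\<alpha> (?K n y)))" for n x y
  proof -
    define d where "d z = 1 - complex_of_real (1 / D) *\<^sub>C dist_function z" for z :: 'x
    have ev_d: "ev w (\<alpha> (d z)) = 1 - complex_of_real (1 / D) *\<^sub>C ev w (\<alpha> (dist_function z))" for w z
      unfolding d_def clinear_diff[OF \<alpha>h(1)] clinear_diff[OF evlin] clinear_scaleC[OF \<alpha>h(1)]
        clinear_scaleC[OF evlin] \<alpha>h(2) ev1 ..
    have "ev y (\<alpha> (d x)) = \<kappa> (ev x (\<alpha> (d y)))"
      unfolding ev_d clinear_diff[OF \<kappa>lin] clinear_scaleC[OF \<kappa>lin] antipode_one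
      using iso[of x y] by (simp add: point_value_def ev_def)
    moreover have "ev w (\<alpha> (d z ^ n)) = ev w (\<alpha> (d z)) ^ n" for w z
      by (induction n) (simp_all add: \<alpha>h ev1 evm)
    moreover have "?K n z = d z ^ n" for z
      by (simp only: dist_kernel_def d_def)
    ultimately show ?thesis by (simp only: antipode_power)
  qed
  let ?m = "measure_functional \<mu>" and ?\<nu> = "convolve \<alpha> (measure_functional \<mu>) \<phi>"
  note m = measure_functional_state
  \<comment> \<open>Written as a vector functional with vector 1, so that positivity comes from
    \<open>unital_star_hom_positive_functional\<close>.\<close>
  have "?\<nu> = (\<lambda>f. tensor_functional ?m \<phi> (star 1 * (\<alpha> f * 1)))"
    by (simp add: convolve_def fun_eq_iff star_1)
  moreover have "?\<nu> 1 = 1"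
    by (simp add: convolve_def \<alpha>h state_one[OF tensor_functional_state[OF m \<phi>]])
  ultimately have \<nu>: "state ?\<nu>"
    using positive_functional_state unital_star_hom_positive_functional[OF \<alpha> tensor_functional_state[OF m \<phi>], of 1]
    by metis
  have "?\<nu> (?K n x) = ?m (?K n x)" for n x
  proof -
    define L where "L f = \<phi> (\<kappa> (ev x (\<alpha> f)))" for f
    have L: "bounded_clinear L"
      unfolding L_def
      by (rule bounded_clinear_intros(6)[OF state_bounded_clinear[OF \<phi>]], rule bounded_clinear_intros(6)[OF \<kappa>],
          rule bounded_clinear_intros(6)[OF ev(1)], rule unital_star_hom_bounded_clinear[OF \<alpha>])
    define c where "c = ?m (?K n x)"
    have "?\<nu> (?K n x) = ?m (right_slice \<phi> (\<alpha> (?K n x)))"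
      by (simp add: convolve_def tensor_functional_right_slice(1)[OF m \<phi>])
    \<comment> \<open>The integrand at \<open>y\<close> is \<phi> applied to
      \<open>ev y (\<alpha> (?K n x))\<close>, and \<open>kernel\<close> moves \<open>y\<close> into
      the argument of \<alpha>, where the integral can be pulled through \<open>L\<close>.\<close>
    also have "\<dots> = (LINT y|\<mu>. L (?K n y))"
      unfolding L_def kernel[symmetric] unfolding measure_functional_def ev_def
        tensor_functional_right_slice(2)[OF evaluation_state \<phi>] ..
    also have "\<dots> = L (c *\<^sub>C 1)"
    proof (rule bounded_clinear_integral[OF X continuous_dist_kernel[OF X] L, symmetric])
      fix z
      have "(LINT y|\<mu>. apply_bcontfun (?K n y) z) = (LINT y|\<mu>. complex_of_real ((1 - dist z y / D) ^ n))"
        by (simp add: dist_kernel_apply[OF X] dist_commute)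
      also have "\<dots> = (LINT y|\<mu>. complex_of_real ((1 - dist x y / D) ^ n))"
        by (rule integral_dist_eq[OF u]) simp
      also have "\<dots> = c" by (simp add: c_def measure_functional_def dist_kernel_apply[OF X])
      finally show "apply_bcontfun (c *\<^sub>C 1) z = (LINT y|\<mu>. apply_bcontfun (?K n y) z)"
        by (simp add: scaleC_complex_def)
    qed
    also have "\<dots> = c"
      using clinear_scaleC[OF bounded_clinear_clinear[OF L], of c 1]
      by (simp add: L_def \<alpha>h ev1 antipode_one state_one[OF \<phi>] scaleC_complex_def)
    finally show ?thesis by (simp add: c_def)
  qed
  then show ?thesis
    using state_eq_measure_functional[OF X u D \<nu>] by blast
qed

end
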